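(* There exists $c^\ast>0$ such that the function $g_0:(0,\infty)\to\mathbb R$ is non-analytic at $c=c^\ast$, where $$g_0(c)=\liminf_{n\to\infty}\mathbb E_{c/\sqrt n}\big[\mathrm{MC}(G)\,\big|\,X=0\big].$$
   Context: $\mathbb E_p$ is expectation for the Erdős–Rényi random graph $G=G(n,p)$ on $n$ labeled vertices, and $X$ is its number of triangles. $\mathrm{MC}(G)$ denotes the fraction of the edges of $G$ that lie in a maximum cut of $G$, with $\mathrm{MC}(G)=0$ if $G$ has no edges. Non-analytic at a point means not real-analytic at that point. *)

theory Defs
  imports "HOL-Probability.Probability" "HOL-Analysis.FPS_Convergence" "HOL-Library.Ramsey"
begin

text \<open>
  A graph on the vertex set \<^term>\<open>{..<n::nat}\<close> is given by its set of edges, a subset of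
  \<^term>\<open>nsets {..<n::nat} 2\<close>.
\<close>

definition erdos_renyi :: "nat \<Rightarrow> real \<Rightarrow> nat set set pmf" where
  "erdos_renyi n p =
     map_pmf (\<lambda>f. {e \<in> nsets {..<n} 2. f e})
       (Pi_pmf (nsets {..<n} 2) False (\<lambda>_. bernoulli_pmf p))"

definition num_triangles :: "nat \<Rightarrow> nat set set \<Rightarrow> nat" where
  "num_triangles n E = card {T \<in> nsets {..<n} 3. clique T E}"

definition cut_edges :: "nat set set \<Rightarrow> nat set \<Rightarrow> nat set set" where
  "cut_edges E S = {e \<in> E. e \<inter> S \<noteq> {} \<and> e - S \<noteq> {}}"

definition max_cut :: "nat \<Rightarrow> nat set set \<Rightarrow> nat" where
  "max_cut n E = Max ((\<lambda>S. card (cut_edges E S)) ` Pow {..<n})"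

definition MC :: "nat \<Rightarrow> nat set set \<Rightarrow> real" where
  "MC n E = (if E = {} then 0 else real (max_cut n E) / real (card E))"

text \<open>
  Where \<open>c / sqrt n \<ge> 1\<close>, which concerns only finitely many \<open>n\<close> for each \<open>c > 0\<close> and so does not
  affect the lower limit, \<^const>\<open>bernoulli_pmf\<close> truncates the edge probability to \<open>1\<close>, and the
  conditioning event may have probability \<open>0\<close>, in which case \<^const>\<open>cond_pmf\<close> is unspecified.
  The lower limit is taken in \<^typ>\<open>ereal\<close>; it is finite since \<^const>\<open>MC\<close> takes values in \<open>[0, 1]\<close>.
\<close>

definition g0 :: "real \<Rightarrow> real" where
  "g0 c = real_of_ereal (liminf (\<lambda>n. ereal (measure_pmf.expectation
     (cond_pmf (erdos_renyi n (c / sqrt (real n))) {E. num_triangles n E = 0}) (MC n))))"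

text \<open>
  Only the values of \<open>f\<close> near \<open>c\<close> matter, so that for \<open>c > 0\<close> the values of \<^const>\<open>g0\<close> outside
  its intended domain \<open>(0, \<infinity>)\<close> are irrelevant.
\<close>

definition real_analytic_at :: "(real \<Rightarrow> real) \<Rightarrow> real \<Rightarrow> bool" where
  "real_analytic_at f c \<longleftrightarrow> (\<exists>F. (\<lambda>h. f (c + h)) has_fps_expansion F)"

end

theory Submission
  imports Defs "HOL-Real_Asymp.Real_Asymp"
begin

text \<open>
  Conditioned on being triangle-free, the random graph is a random triangle-free graph \<open>G\<close> with weight
  \<open>l ^ card G\<close>, where \<open>l\<close> is the odds \<open>p / (1 - p)\<close>. The function \<^const>\<open>g0\<close> is constantly \<open>1/2\<close> for
  small \<open>c\<close> but exceeds \<open>1/2\<close> at some large \<open>c\<close>, so it is not analytic at the supremum of the \<open>c\<close> up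
  to which it is constant.

  For small \<open>c\<close>, degrees above \<open>sqrt n\<close> are penalised, which changes the measure very little. The Glauber
  dynamics of the penalised model contracts a path metric in which flipping the edge \<open>uv\<close> costs
  \<open>1 + (deg u + deg v) / sqrt n\<close>. Comparing stationary measures shows that tilting the model by
  \<open>exp (t f)\<close>, where \<open>f\<close> is the size of a fixed cut minus half the number of edges, moves the mean of \<open>f\<close> by
  \<open>O(t n powr (3/2))\<close>. Hence \<open>f\<close> exceeds its mean, which is \<open>O(n)\<close> by symmetry, by \<open>\<epsilon> n powr (3/2)\<close> with
  probability at most \<open>exp (- \<Omega>(n powr (3/2)))\<close>, and this survives a union bound over all \<open>2 ^ n\<close> cuts.

  For large \<open>c\<close>, split \<open>G\<close> at random into a small part \<open>H\<close> and the rest. Neighbourhoods in \<open>G - H\<close> are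
  independent sets of \<open>H\<close>, so Kleitman--Winston containers confine them. If no cut is much larger than
  half of the edges, a set spanning few edges touches little more than a quarter of all edge endpoints,
  so the containers are small, and the total weight of such \<open>G\<close> is exponentially smaller than that of
  the bipartite graphs, which is at least \<open>(1 + l) ^ (n\<^sup>2 div 4)\<close>.
\<close>

subsection \<open>Triangle-free graphs weighted by their number of edges\<close>

text \<open>Both regimes compare exponential rates. At small \<open>c\<close> the union bound costs
  \<open>2 ^ n\<close>, while a graph has order \<open>n powr (3/2)\<close> edges, so a tail
  exponential in \<open>n powr (3/2)\<close> leaves room. The obstacle is that inserting
  \<open>uv\<close> blocks up to \<open>deg u + deg v\<close> further edges, so that a constant cost
  per flip would not control vertices of large degree. The degree-dependent cost pays for the
  blocked edges, and the penalty keeps rate times cost bounded where the cost is large. No process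
  is constructed: its generator, whose mean vanishes under the stationary weight, carries the
  argument. At large \<open>c\<close> the yardstick is the rate \<open>1/4\<close> in units of
  \<open>l * n ^ 2\<close>, coming from the subgraphs of one balanced complete bipartite graph. The
  estimates for graphs without a large cut have to add up to less; they reach \<open>23/100\<close>,
  made up of \<open>37/200\<close> for the container pattern, \<open>4/200\<close> for the
  fingerprints and \<open>5/200\<close> for the choice of \<open>H\<close>. The numbers
  \<open>1/64\<close> and \<open>10 ^ 4\<close> put one point on either side of the transition,
  whose position stays unknown.\<close>

abbreviation edges :: "nat \<Rightarrow> nat set set" where
  "edges n \<equiv> nsets {..<n} 2"

definition tri_free :: "nat \<Rightarrow> nat set set set" where
  "tri_free n = {G. G \<subseteq> edges n \<and> num_triangles n G = 0}"

definition gibbs :: "nat \<Rightarrow> real \<Rightarrow> nat set set set \<Rightarrow> real" where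
  "gibbs n l A = (\<Sum>G\<in>tri_free n \<inter> A. l ^ card G) / (\<Sum>G\<in>tri_free n. l ^ card G)"

lemma finite_edges [simp]: "finite (edges n)"
  by (simp add: finite_imp_finite_nsets)

text \<open>Degenerate choices of \<open>x\<close>, \<open>y\<close>, \<open>z\<close> are harmless
  on the right-hand side: two equal vertices would make one of the three sets a singleton, which is
  no edge.\<close>

lemma tri_free_iff:
  "G \<in> tri_free n \<longleftrightarrow>
     G \<subseteq> edges n \<and> (\<forall>x y z. {x, y} \<in> G \<longrightarrow> {y, z} \<in> G \<longrightarrow> {x, z} \<notin> G)"
proof (cases "G \<subseteq> edges n")
  case True
  have fin: "finite {T \<in> nsets {..<n} 3. clique T G}"
    by (simp add: finite_imp_finite_nsets)
  have "num_triangles n G = 0 \<longleftrightarrow> {T \<in> nsets {..<n} 3. clique T G} = {}"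
    unfolding num_triangles_def using fin card_0_eq by blast
  also have "\<dots> \<longleftrightarrow> (\<forall>x y z. {x, y} \<in> G \<longrightarrow> {y, z} \<in> G \<longrightarrow> {x, z} \<notin> G)" (is "?L \<longleftrightarrow> ?R")
  proof
    assume L: ?L
    show ?R
    proof (intro allI impI notI)
      fix x y z assume *: "{x, y} \<in> G" "{y, z} \<in> G" "{x, z} \<in> G"
      have "{x, y} \<in> edges n" "{y, z} \<in> edges n" "{x, z} \<in> edges n"
        using * True by blast+
      then have "x \<noteq> y" "y \<noteq> z" "x \<noteq> z" "x < n" "y < n" "z < n"
        unfolding doubleton_in_nsets_2 by auto
      then have "{x, y, z} \<in> nsets {..<n} 3"
        by (simp add: nsets_def)
      moreover have "clique {x, y, z} G"
        using * by (auto simp: clique_def insert_commute)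
      ultimately show False using L by blast
    qed
  next
    assume R: ?R
    show ?L
    proof (rule ccontr)
      assume "\<not> ?L"
      then obtain T where T: "T \<in> nsets {..<n} 3" "clique T G" by blast
      then obtain x y z where "T = {x, y, z}" "x \<noteq> y" "y \<noteq> z" "x \<noteq> z"
        by (auto simp: nsets_def card_3_iff)
      then have "{x, y} \<in> G" "{y, z} \<in> G" "{x, z} \<in> G"
        using T(2) by (auto simp: clique_def)
      then show False using R by blast
    qed
  qed
  finally show ?thesis using True by (simp add: tri_free_def)
qed (simp add: tri_free_def)

lemma tri_free_edges: "G \<in> tri_free n \<Longrightarrow> G \<subseteq> edges n"
  by (simp add: tri_free_def)

lemma finite_tri_free [simp]: "finite (tri_free n)"
  by (rule finite_subset[of _ "Pow (edges n)"]) (auto simp: tri_free_def)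

lemma finite_tri_free_member: "G \<in> tri_free n \<Longrightarrow> finite G"
  using tri_free_edges finite_edges finite_subset by blast

lemma tri_free_mono: "G \<in> tri_free n \<Longrightarrow> H \<subseteq> G \<Longrightarrow> H \<in> tri_free n"
  unfolding tri_free_iff by blast

lemma empty_tri_free [simp]: "{} \<in> tri_free n"
  by (simp add: tri_free_iff)

lemma partition_pos: "l > 0 \<Longrightarrow> (\<Sum>G\<in>tri_free n. l ^ card G) > (0::real)"
  using empty_tri_free[of n] by (intro sum_pos) (auto simp del: empty_tri_free)

section \<open>Generating functions of families of edge sets\<close>

lemma sum_subsets_prod:
  fixes z :: "'a \<Rightarrow> real"
  assumes "finite E"
  shows "(\<Sum>G\<in>Pow E. \<Prod>e\<in>G. z e) = (\<Prod>e\<in>E. 1 + z e)"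
  using prod_add[OF assms, of z "\<lambda>_. 1"] by (simp add: add.commute)

lemma prod_one_plus_le_exp:
  fixes z :: "'a \<Rightarrow> real"
  assumes "finite E" "\<And>e. e \<in> E \<Longrightarrow> z e \<ge> 0"
  shows "(\<Prod>e\<in>E. 1 + z e) \<le> exp (\<Sum>e\<in>E. z e)"
  unfolding exp_sum[OF assms(1)] using assms(2)
  by (intro prod_mono conjI) (auto simp: add_nonneg_nonneg)

lemma sum_subsets_prod_le_exp:
  fixes z :: "'a \<Rightarrow> real"
  assumes "finite E" "\<And>e. e \<in> E \<Longrightarrow> z e \<ge> 0"
  shows "(\<Sum>G\<in>Pow E. \<Prod>e\<in>G. z e) \<le> exp (\<Sum>e\<in>E. z e)"
  using prod_one_plus_le_exp[OF assms] by (simp add: sum_subsets_prod[OF assms(1)])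

lemma sum_subsets_power_le_exp:
  assumes "finite E" "(l::real) \<ge> 0"
  shows "(\<Sum>G\<in>Pow E. l ^ card G) \<le> exp (l * real (card E))"
  using sum_subsets_prod_le_exp[of E "\<lambda>_. l"] assms by (simp add: mult.commute)

text \<open>Exponential Markov inequality: on the range of summation
  \<open>y powr (- x) * y ^ card G\<close> is at least \<open>1\<close>, so the weight per edge may
  be lowered from \<open>l\<close> to \<open>y * l\<close> at the price
  \<open>y powr (- x)\<close>.\<close>

lemma sum_few_edges_le:
  assumes "finite E" "l \<ge> 0" "0 < y" "y \<le> (1::real)"
  shows "(\<Sum>G | G \<subseteq> E \<and> real (card G) \<le> x. l ^ card G)
           \<le> y powr (- x) * exp (y * l * real (card E))"
proof -
  have "(\<Sum>G | G \<subseteq> E \<and> real (card G) \<le> x. l ^ card G)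
          \<le> (\<Sum>G | G \<subseteq> E \<and> real (card G) \<le> x. y powr (- x) * (y * l) ^ card G)"
  proof (rule sum_mono)
    fix G assume "G \<in> {G. G \<subseteq> E \<and> real (card G) \<le> x}"
    then have "y powr x \<le> y powr (real (card G))"
      using assms by (intro powr_mono') auto
    then have "1 \<le> y powr (- x) * y ^ card G"
      using assms by (simp add: powr_minus powr_realpow field_simps)
    then have "l ^ card G * 1 \<le> l ^ card G * (y powr (- x) * y ^ card G)"
      using assms by (intro mult_left_mono) auto
    then show "l ^ card G \<le> y powr (- x) * (y * l) ^ card G"
      by (simp add: power_mult_distrib mult_ac)
  qed
  also have "\<dots> \<le> (\<Sum>G\<in>Pow E. y powr (- x) * (y * l) ^ card G)"
    using assms by (intro sum_mono2) auto
  also have "\<dots> \<le> y powr (- x) * exp (y * l * real (card E))"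
    unfolding sum_distrib_left[symmetric]
    using sum_subsets_power_le_exp[OF assms(1), of "y * l"] assms by (intro mult_left_mono) auto
  finally show ?thesis .
qed

lemma card_edges_real: "real (card (edges n)) = real n * (real n - 1) / 2"
proof -
  have "card (edges n) = n choose 2" by simp
  moreover have "real (n choose 2) = real n * (real n - 1) / 2"
    by (cases n) (auto simp: choose_two real_of_nat_div field_simps)
  ultimately show ?thesis by simp
qed

lemma card_edges_le: "real (card (edges n)) \<le> real n ^ 2 / 2"
  unfolding card_edges_real by (simp add: field_simps power2_eq_square)

section \<open>Cuts of the complete graph and the bipartite lower bound\<close>

lemma finite_cut_edges [simp]: "finite G \<Longrightarrow> finite (cut_edges G S)"
  by (simp add: cut_edges_def)

lemma doubleton_in_cut_edges:
  "{x, y} \<in> cut_edges G S \<longleftrightarrow> {x, y} \<in> G \<and> (x \<in> S \<longleftrightarrow> y \<notin> S)"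
  by (auto simp: cut_edges_def)

lemma card_cut_edges_complete:
  assumes "S \<subseteq> {..<n}"
  shows "card (cut_edges (edges n) S) = card S * (n - card S)"
proof -
  have "bij_betw (\<lambda>(x, y). {x, y}) (S \<times> ({..<n} - S)) (cut_edges (edges n) S)"
  proof (rule bij_betwI')
    fix p q assume "p \<in> S \<times> ({..<n} - S)" "q \<in> S \<times> ({..<n} - S)"
    then show "((case p of (x, y) \<Rightarrow> {x, y}) = (case q of (x, y) \<Rightarrow> {x, y})) = (p = q)"
      by (auto simp: doubleton_eq_iff)
  next
    fix p assume "p \<in> S \<times> ({..<n} - S)"
    then show "(case p of (x, y) \<Rightarrow> {x, y}) \<in> cut_edges (edges n) S"
      using assms by (auto simp: doubleton_in_cut_edges)
  next
    fix e assume e: "e \<in> cut_edges (edges n) S"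
    then have "e \<in> edges n" by (simp add: cut_edges_def)
    then obtain x y where "e = {x, y}" "x < n" "y < n" by (auto elim!: nsets2_E)
    then show "\<exists>p\<in>S \<times> ({..<n} - S). e = (case p of (x, y) \<Rightarrow> {x, y})"
      using e by (auto simp: doubleton_in_cut_edges insert_commute)
  qed
  then have "card (cut_edges (edges n) S) = card (S \<times> ({..<n} - S))"
    by (simp add: bij_betw_same_card)
  also have "\<dots> = card S * (n - card S)"
    using assms by (simp add: card_cartesian_product card_Diff_subset finite_subset)
  finally show ?thesis .
qed

lemma subset_cut_tri_free:
  assumes "G \<subseteq> cut_edges (edges n) S"
  shows "G \<in> tri_free n"
  unfolding tri_free_iff
proof (intro conjI allI impI notI)
  show "G \<subseteq> edges n" using assms by (auto simp: cut_edges_def)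
next
  fix x y z assume "{x, y} \<in> G" "{y, z} \<in> G" "{x, z} \<in> G"
  then have "{x, y} \<in> cut_edges (edges n) S" "{y, z} \<in> cut_edges (edges n) S"
    "{x, z} \<in> cut_edges (edges n) S" using assms by auto
  then show False unfolding doubleton_in_cut_edges by auto
qed

text \<open>The subgraphs of a balanced complete bipartite graph \<open>B\<close> alone have total
  weight \<open>(1 + l) ^ card B\<close>. The loss \<open>l ^ 2\<close> comes from
  \<open>ln (1 + l) \<ge> l - l ^ 2\<close>, and the \<open>- 1\<close> from odd \<open>n\<close>,
  where the two sides differ by one vertex.\<close>

lemma partition_lower_bound:
  assumes "0 < l" "l \<le> 1"
  shows "exp ((l - l\<^sup>2) * ((real n)\<^sup>2 - 1) / 4) \<le> (\<Sum>G\<in>tri_free n. l ^ card G)"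
proof -
  define k where "k = n div 2"
  define B where "B = cut_edges (edges n) {..<k}"
  have fB: "finite B" by (simp add: B_def)
  have "card B = k * (n - k)"
    unfolding B_def by (subst card_cut_edges_complete) (auto simp: k_def)
  then have "4 * real (card B) \<ge> (real n)\<^sup>2 - 1"
    by (cases "even n") (auto simp: k_def power2_eq_square field_simps elim!: evenE oddE)
  then have "(l - l\<^sup>2) * ((real n)\<^sup>2 - 1) / 4 \<le> (l - l\<^sup>2) * real (card B)"
    using mult_left_mono[of "(real n)\<^sup>2 - 1" "4 * real (card B)" "l - l\<^sup>2"] assms
    by (simp add: power2_eq_square mult_left_le_one_le)
  also have "\<dots> \<le> ln (1 + l) * real (card B)"
    using ln_one_plus_pos_lower_bound[of l] assms by (intro mult_right_mono) auto
  finally have "exp ((l - l\<^sup>2) * ((real n)\<^sup>2 - 1) / 4) \<le> exp (real (card B) * ln (1 + l))"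
    by (simp add: mult.commute)
  also have "\<dots> = (1 + l) ^ card B"
    using assms by (subst exp_of_nat_mult) simp
  also have "\<dots> = (\<Sum>G\<in>Pow B. l ^ card G)"
    using sum_subsets_prod[OF fB, of "\<lambda>_. l"] by simp
  also have "\<dots> \<le> (\<Sum>G\<in>tri_free n. l ^ card G)"
    using assms subset_cut_tri_free by (intro sum_mono2) (auto simp: B_def)
  finally show ?thesis .
qed

section \<open>Elementary properties of the Gibbs measure\<close>

lemma gibbs_nonneg: "l > 0 \<Longrightarrow> gibbs n l A \<ge> 0"
  unfolding gibbs_def by (intro divide_nonneg_nonneg sum_nonneg) auto

lemma gibbs_mono: "l > 0 \<Longrightarrow> tri_free n \<inter> A \<subseteq> B \<Longrightarrow> gibbs n l A \<le> gibbs n l B"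
  unfolding gibbs_def by (intro divide_right_mono sum_mono2 sum_nonneg) auto

lemma gibbs_Un: "l > 0 \<Longrightarrow> gibbs n l (A \<union> B) \<le> gibbs n l A + gibbs n l B"
  unfolding gibbs_def add_divide_distrib[symmetric]
  by (intro divide_right_mono sum_nonneg, unfold Int_Un_distrib)
     (auto simp: sum_Un sum_nonneg)

lemma gibbs_le_UN:
  assumes "l > 0" "finite I"
  shows "gibbs n l (\<Union>i\<in>I. A i) \<le> (\<Sum>i\<in>I. gibbs n l (A i))"
  using assms(2)
proof (induction I rule: finite_induct)
  case empty
  then show ?case by (simp add: gibbs_def)
next
  case (insert i I)
  then show ?case using gibbs_Un[OF assms(1), of n "A i" "\<Union>i\<in>I. A i"] by simp
qed

text \<open>Markov's bound with \<open>y = 1/8\<close> has the rate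
  \<open>(ln 8 + 1) / 16 < 37/191\<close> in units of \<open>l * n ^ 2\<close>, below the rate
  \<open>9/40\<close> that is left of the bipartite lower bound when \<open>l \<le> 1/10\<close>;
  the gap exceeds \<open>1/40\<close>. The \<open>1\<close> in the exponent absorbs the lower-order
  term \<open>(l - l ^ 2) / 4\<close>.\<close>

lemma gibbs_few_edges:
  assumes "0 < l" "l \<le> 1/10"
  shows "gibbs n l {G. real (card G) \<le> l * real (card (edges n)) / 8}
      \<le> exp (1 - l * (real n)\<^sup>2 / 40)"
proof -
  define N where "N = real (card (edges n))"
  define Z where "Z = (\<Sum>G\<in>tri_free n. l ^ card G)"
  have Zpos: "Z > 0" unfolding Z_def using assms by (simp add: partition_pos)
  have "(\<Sum>G\<in>tri_free n \<inter> {G. real (card G) \<le> l * N / 8}. l ^ card G)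
          \<le> (\<Sum>G | G \<subseteq> edges n \<and> real (card G) \<le> l * N / 8. l ^ card G)"
    using assms by (intro sum_mono2) (auto simp: tri_free_def)
  also have "\<dots> \<le> (1/8) powr (- (l * N / 8)) * exp (1/8 * l * N)"
    unfolding N_def using assms by (intro sum_few_edges_le) auto
  also have "(1/8::real) powr (- (l * N / 8)) = exp (l * N / 8 * ln 8)"
    by (simp add: powr_def ln_div)
  also have "\<dots> * exp (1/8 * l * N) = exp (l * N * (ln 8 + 1) / 8)"
    by (simp add: exp_add[symmetric] field_simps)
  also have "\<dots> \<le> exp ((1 - l * (real n)\<^sup>2 / 40) + (l - l\<^sup>2) * ((real n)\<^sup>2 - 1) / 4)"
  proof -
    have "ln (8::real) = 3 * ln 2" using ln_realpow[of 2 3] by simp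
    then have "(ln 8 + 1) / 8 \<le> (37 / 96 :: real)" using ln2_le_25_over_36 by simp
    then have "l * N * ((ln 8 + 1) / 8) \<le> l * ((real n)\<^sup>2 / 2) * (37 / 96)"
      using card_edges_le[of n] assms ln2_le_25_over_36
      by (intro mult_mono) (auto simp: N_def)
    moreover have "9/10 * l * (real n)\<^sup>2 \<le> (l - l\<^sup>2) * (real n)\<^sup>2"
      using assms by (intro mult_right_mono) (auto simp: power2_eq_square)
    moreover have "l - l\<^sup>2 \<le> 1" "l * (real n)\<^sup>2 \<ge> 0"
      using assms by (auto simp: power2_eq_square intro: order_trans[of _ l])
    ultimately show ?thesis by (simp add: field_simps)
  qed
  also have "\<dots> = exp (1 - l * (real n)\<^sup>2 / 40) * exp ((l - l\<^sup>2) * ((real n)\<^sup>2 - 1) / 4)"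
    by (simp add: exp_add)
  also have "\<dots> \<le> exp (1 - l * (real n)\<^sup>2 / 40) * Z"
    unfolding Z_def using partition_lower_bound assms by (intro mult_left_mono) auto
  finally show ?thesis
    unfolding gibbs_def using Zpos by (simp add: N_def Z_def pos_divide_le_eq)
qed

subsection \<open>Contracting birth and death dynamics\<close>

definition wmean :: "'a set set \<Rightarrow> ('a set \<Rightarrow> real) \<Rightarrow> ('a set \<Rightarrow> real) \<Rightarrow> real" where
  "wmean F W f = (\<Sum>G\<in>F. W G * f G) / (\<Sum>G\<in>F. W G)"

text \<open>Generator of the continuous-time chain in which an absent \<open>e\<close> is born at
  rate \<open>b e G\<close> and each present element dies at rate \<open>1\<close>.\<close>

definition generator :: "'a set \<Rightarrow> ('a \<Rightarrow> 'a set \<Rightarrow> real) \<Rightarrow> ('a set \<Rightarrow> real) \<Rightarrow> 'a set \<Rightarrow> real" where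
  "generator E b f G =
     (\<Sum>e\<in>E - G. b e G * (f (insert e G) - f G)) + (\<Sum>e\<in>G. f (G - {e}) - f G)"

text \<open>\<open>balance\<close> is detailed balance for death rate \<open>1\<close>, so
  \<open>W\<close> is the stationary weight of the chain; \<open>b_blocked\<close> keeps the chain
  inside the down-closed family \<open>F\<close>.\<close>

locale birth_death =
  fixes E :: "'a set" and F :: "'a set set" and b :: "'a \<Rightarrow> 'a set \<Rightarrow> real" and W :: "'a set \<Rightarrow> real"
  assumes finite_E: "finite E"
    and F_subset: "G \<in> F \<Longrightarrow> G \<subseteq> E"
    and empty_F: "{} \<in> F"
    and F_down: "G \<in> F \<Longrightarrow> H \<subseteq> G \<Longrightarrow> H \<in> F"
    and W_pos: "G \<in> F \<Longrightarrow> W G > 0"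
    and b_nonneg: "b e G \<ge> 0"
    and b_blocked: "e \<in> E - G \<Longrightarrow> insert e G \<notin> F \<Longrightarrow> b e G = 0"
    and balance: "e \<in> E - G \<Longrightarrow> insert e G \<in> F \<Longrightarrow> W (insert e G) = W G * b e G"
begin

lemma finite_F: "finite F"
  using F_subset finite_E by (meson PowI finite_Pow_iff finite_subset subsetI)

lemma finite_member: "G \<in> F \<Longrightarrow> finite G"
  using F_subset finite_E finite_subset by blast

lemma total_pos: "(\<Sum>G\<in>F. W G) > 0"
  using finite_F empty_F W_pos by (intro sum_pos) auto

lemma wmean_mono:
  assumes "\<And>G. G \<in> F \<Longrightarrow> f G \<le> g G"
  shows "wmean F W f \<le> wmean F W g"
  unfolding wmean_def using total_pos W_pos assms
  by (intro divide_right_mono sum_mono mult_left_mono) (auto intro: less_imp_le)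

lemma wmean_const: "wmean F W (\<lambda>_. c) = c"
  unfolding wmean_def using total_pos by (simp add: sum_distrib_right[symmetric])

lemma wmean_add: "wmean F W (\<lambda>G. f G + g G) = wmean F W f + wmean F W g"
  unfolding wmean_def by (simp add: distrib_left sum.distrib add_divide_distrib)

lemma wmean_cmult: "wmean F W (\<lambda>G. c * f G) = c * wmean F W f"
  unfolding wmean_def by (simp add: sum_distrib_left mult.left_commute)

text \<open>Stationarity: by detailed balance the contribution of each birth cancels that of the
  reverse death.\<close>

lemma wmean_generator: "wmean F W (generator E b f) = 0"
proof -
  have "(\<Sum>G\<in>F. W G * (\<Sum>e\<in>E - G. b e G * (f (insert e G) - f G)))
      = (\<Sum>G\<in>F. \<Sum>e\<in>E - G. W G * b e G * (f (insert e G) - f G))"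
    by (simp add: sum_distrib_left mult.assoc)
  also have "\<dots> = (\<Sum>(G, e)\<in>Sigma F (\<lambda>G. E - G). W G * b e G * (f (insert e G) - f G))"
    using finite_F finite_E by (intro sum.Sigma) auto
  also have "\<dots> = (\<Sum>(G, e)\<in>{(G, e). e \<in> E - G \<and> insert e G \<in> F}. W G * b e G * (f (insert e G)
      - f G))"
  proof (rule sum.mono_neutral_right)
    show "finite (Sigma F (\<lambda>G. E - G))" using finite_F finite_E by simp
    show "{(G, e). e \<in> E - G \<and> insert e G \<in> F} \<subseteq> Sigma F (\<lambda>G. E - G)"
      using F_down[OF _ subset_insertI] by auto
    show "\<forall>i\<in>Sigma F (\<lambda>G. E - G) - {(G, e). e \<in> E - G \<and> insert e G \<in> F}.
        (case i of (G, e) \<Rightarrow> W G * b e G * (f (insert e G) - f G)) = 0"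
      using b_blocked by fastforce
  qed
  \<comment> \<open>A birth \<open>G\<close> to \<open>insert e G\<close> and the death of
    \<open>e\<close> in \<open>H = insert e G\<close> are the same pair of sets; indexing by the
    upper set turns births into deaths.\<close>
  also have "\<dots> = (\<Sum>(H, e)\<in>Sigma F (\<lambda>H. H). W H * (f H - f (H - {e})))"
    by (rule sum.reindex_bij_witness[where i = "\<lambda>(H, e). (H - {e}, e)" and j
        = "\<lambda>(G, e). (insert e G, e)"])
       (use balance F_subset in \<open>auto simp: insert_absorb\<close>)
  also have "\<dots> = (\<Sum>H\<in>F. \<Sum>e\<in>H. W H * (f H - f (H - {e})))"
    using finite_F finite_member by (intro sum.Sigma[symmetric]) auto
  also have "\<dots> = - (\<Sum>H\<in>F. W H * (\<Sum>e\<in>H. f (H - {e}) - f H))"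
    by (simp add: sum_distrib_left sum_negf[symmetric] algebra_simps)
  finally have "(\<Sum>G\<in>F. W G * generator E b f G) = 0"
    by (simp add: generator_def distrib_left sum.distrib)
  then show ?thesis by (simp add: wmean_def)
qed

end

text \<open>Path coupling of two copies that start from \<open>G\<close> and
  \<open>insert a G\<close>. The first two sums in \<open>drift\<close> are the change of the cost
  of the discrepancy \<open>a\<close> under common moves. The third is the cost of new
  discrepancies, born only in the lower copy because \<open>b\<close> decreases when
  \<open>a\<close> is added. The death of \<open>a\<close> removes its cost at rate
  \<open>1\<close>, so growth by at most half of the cost leaves contraction at rate
  \<open>1/2\<close>.\<close>

locale contracting_birth_death = birth_death +
  fixes cost :: "'a \<Rightarrow> 'a set \<Rightarrow> real"
  assumes cost_nonneg: "cost e G \<ge> 0"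
    and b_antimono: "a \<in> E - G \<Longrightarrow> insert a G \<in> F \<Longrightarrow> e \<in> E - insert a G \<Longrightarrow> b e (insert a G) \<le> b e G"
    and drift: "a \<in> E - G \<Longrightarrow> insert a G \<in> F \<Longrightarrow>
      (\<Sum>e\<in>E - insert a G. b e (insert a G) * (cost a (insert e G) - cost a G))
      + (\<Sum>e\<in>G. cost a (G - {e}) - cost a G)
      + (\<Sum>e\<in>E - insert a G. (b e G - b e (insert a G)) * cost e G) \<le> cost a G / 2"
begin

text \<open>Lipschitz condition for the path metric on \<open>F\<close> in which the step from
  \<open>G\<close> to \<open>insert a G\<close> has length \<open>cost a G\<close>.\<close>

definition lip :: "real \<Rightarrow> ('a set \<Rightarrow> real) \<Rightarrow> bool" where
  "lip K f \<longleftrightarrow> (\<forall>G. \<forall>a\<in>E - G. insert a G \<in> F \<longrightarrow> \<bar>f (insert a G) - f G\<bar> \<le> K * cost a G)"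

lemma lipD: "lip K f \<Longrightarrow> a \<in> E - G \<Longrightarrow> insert a G \<in> F \<Longrightarrow> \<bar>f (insert a G) - f G\<bar> \<le> K * cost a G"
  by (auto simp: lip_def)

text \<open>The generator of the coupled pair in terms of the discrete derivative \<open>D\<close>
  in direction \<open>a\<close>. In the last factor, \<open>1\<close> and \<open>b a G\<close> are
  the rates at which \<open>a\<close> dies in the upper copy or is born in the lower one, either of
  which removes the discrepancy.\<close>

lemma generator_diff:
  fixes f :: "'a set \<Rightarrow> real"
  assumes a: "a \<in> E - G" and ins: "insert a G \<in> F"
  defines "D \<equiv> \<lambda>H. f (insert a H) - f H"
  shows "generator E b f (insert a G) - generator E b f G =
    (\<Sum>e\<in>E - insert a G. b e (insert a G) * D (insert e G))
    - (\<Sum>e\<in>E - insert a G. (b e G - b e (insert a G)) * (f (insert e G) - f G))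
    + (\<Sum>e\<in>G. D (G - {e}))
    - ((\<Sum>e\<in>E - insert a G. b e (insert a G)) + real (card G) + 1 + b a G) * D G"
proof -
  have fin: "finite G" using finite_member[OF ins] by simp
  have E_split: "E - G = insert a (E - insert a G)" using a by auto
  have 1: "(\<Sum>e\<in>E - G. b e G * (f (insert e G) - f G))
      = b a G * D G + (\<Sum>e\<in>E - insert a G. b e G * (f (insert e G) - f G))"
    unfolding E_split using finite_E by (subst sum.insert) (auto simp: D_def)
  have del: "insert a G - {e} = insert a (G - {e})" if "e \<in> G" for e using that a by auto
  have 2: "(\<Sum>e\<in>insert a G. f (insert a G - {e}) - f (insert a G))
      = - D G + (\<Sum>e\<in>G. f (insert a (G - {e})) - f (insert a G))"
    using fin a del by (simp add: D_def)
  have 3: "(\<Sum>e\<in>G. f (insert a (G - {e})) - f (insert a G)) - (\<Sum>e\<in>G. f (G - {e}) - f G)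
      = (\<Sum>e\<in>G. D (G - {e})) - real (card G) * D G"
    by (simp add: D_def sum_subtractf right_diff_distrib)
  have 4: "(\<Sum>e\<in>E - insert a G. b e (insert a G) * (f (insert e (insert a G)) - f (insert a G)))
      - (\<Sum>e\<in>E - insert a G. b e G * (f (insert e G) - f G))
      = (\<Sum>e\<in>E - insert a G. b e (insert a G) * D (insert e G))
        - (\<Sum>e\<in>E - insert a G. (b e G - b e (insert a G)) * (f (insert e G) - f G))
        - (\<Sum>e\<in>E - insert a G. b e (insert a G)) * D G"
    unfolding sum_distrib_right sum_subtractf[symmetric]
    by (rule sum.cong) (auto simp: D_def algebra_simps insert_commute)
  show ?thesis
    unfolding generator_def 1 2 using 3 4 by (simp add: algebra_simps)
qed

text \<open>An Euler step of length \<open>h\<close> for the semigroup contracts Lipschitz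
  constants. The bound on \<open>h\<close> makes the weight \<open>q\<close> that remains at the
  present state nonnegative, so the triangle inequality loses nothing there.\<close>

lemma lip_generator_step:
  assumes f: "lip K f" and "K \<ge> 0" "h \<ge> 0"
    and h: "h * (2 + real (card E) + 2 * (\<Sum>G\<in>F. \<Sum>e\<in>E. b e G)) \<le> 1"
  shows "lip ((1 - h / 2) * K) (\<lambda>G. f G + h * generator E b f G)"
  unfolding lip_def
proof (intro allI ballI impI)
  fix G a assume a: "a \<in> E - G" and ins: "insert a G \<in> F"
  define D where "D = (\<lambda>H. f (insert a H) - f H)"
  define o1 where "o1 = cost a G"
  define T1 where "T1 = (\<Sum>e\<in>E - insert a G. b e (insert a G) * cost a (insert e G))"
  define S1 where "S1 = (\<Sum>e\<in>E - insert a G. b e (insert a G))"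
  define T2 where "T2 = (\<Sum>e\<in>G. cost a (G - {e}))"
  define T3 where "T3 = (\<Sum>e\<in>E - insert a G. (b e G - b e (insert a G)) * cost e G)"
  define q where "q = 1 - h * (S1 + real (card G) + 1 + b a G)"
  have GF: "G \<in> F" using F_down[OF ins] by auto
  have fin: "finite G" using finite_member[OF GF] .
  have drift': "T1 - S1 * o1 + (T2 - real (card G) * o1) + T3 \<le> o1 / 2"
    using drift[OF a ins]
    by (simp add: T1_def S1_def T2_def T3_def o1_def sum_subtractf right_diff_distrib
        sum_distrib_right)
  have sum_le: "(\<Sum>e\<in>A. b e H) \<le> (\<Sum>G\<in>F. \<Sum>e\<in>E. b e G)" if "A \<subseteq> E" "H \<in> F" for A H
  proof -
    have "(\<Sum>e\<in>A. b e H) \<le> (\<Sum>e\<in>E. b e H)"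
      using that finite_E b_nonneg by (intro sum_mono2) auto
    also have "\<dots> \<le> (\<Sum>G\<in>F. \<Sum>e\<in>E. b e G)"
      using that finite_F b_nonneg by (intro member_le_sum) (auto intro: sum_nonneg)
    finally show ?thesis .
  qed
  have "S1 \<le> (\<Sum>G\<in>F. \<Sum>e\<in>E. b e G)" unfolding S1_def using ins by (intro sum_le) auto
  moreover have "b a G \<le> (\<Sum>G\<in>F. \<Sum>e\<in>E. b e G)" using sum_le[of "{a}" G] a GF by auto
  moreover have "card G \<le> card E" using F_subset[OF GF] finite_E by (simp add: card_mono)
  ultimately have "h * (S1 + real (card G) + 1 + b a G) \<le> 1"
    using h \<open>h \<ge> 0\<close> by (intro order_trans[OF mult_left_mono h]) auto
  then have q: "q \<ge> 0" by (simp add: q_def)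
  define U1 where "U1 = (\<Sum>e\<in>E - insert a G. b e (insert a G) * D (insert e G))"
  define U2 where "U2 = (\<Sum>e\<in>G. D (G - {e}))"
  define U3 where "U3 = (\<Sum>e\<in>E - insert a G. (b e G - b e (insert a G)) * (f (insert e G) - f G))"
  have "\<bar>U1\<bar> \<le> K * T1"
    unfolding T1_def U1_def sum_distrib_left
  proof (rule order_trans[OF sum_abs], rule sum_mono)
    fix e assume e: "e \<in> E - insert a G"
    show "\<bar>b e (insert a G) * D (insert e G)\<bar> \<le> K * (b e (insert a G) * cost a (insert e G))"
    proof (cases "insert e (insert a G) \<in> F")
      case True
      have "\<bar>D (insert e G)\<bar> \<le> K * cost a (insert e G)"
        unfolding D_def using True e a by (intro lipD[OF f]) (auto simp: insert_commute)
      then have "b e (insert a G) * \<bar>D (insert e G)\<bar> \<le> b e (insert a G) * (K * cost a (insert e G))"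
        using b_nonneg by (intro mult_left_mono)
      then show ?thesis
        using b_nonneg[of e "insert a G"] by (simp add: abs_mult mult.left_commute)
    next
      case False
      then show ?thesis using b_blocked[of e "insert a G"] e by simp
    qed
  qed
  moreover have "\<bar>U3\<bar> \<le> K * T3"
    unfolding T3_def U3_def sum_distrib_left
  proof (rule order_trans[OF sum_abs], rule sum_mono)
    fix e assume e: "e \<in> E - insert a G"
    show "\<bar>(b e G - b e (insert a G)) * (f (insert e G) - f G)\<bar>
        \<le> K * ((b e G - b e (insert a G)) * cost e G)"
    proof (cases "insert e G \<in> F")
      case True
      then have "(b e G - b e (insert a G)) * \<bar>f (insert e G) - f G\<bar>
          \<le> (b e G - b e (insert a G)) * (K * cost e G)"
        using b_antimono[OF a ins e] e by (intro mult_left_mono lipD[OF f]) auto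
      then show ?thesis
        using b_antimono[OF a ins e] by (simp add: abs_mult mult.left_commute)
    next
      case False
      then have "insert e (insert a G) \<notin> F" using F_down[of "insert e (insert a G)" "insert e G"]
          by blast
      then show ?thesis using b_blocked[of e "insert a G"] b_blocked[of e G] e False by simp
    qed
  qed
  moreover have "\<bar>U2\<bar> \<le> K * T2"
    unfolding T2_def U2_def sum_distrib_left
  proof (rule order_trans[OF sum_abs], rule sum_mono)
    fix e assume e: "e \<in> G"
    show "\<bar>D (G - {e})\<bar> \<le> K * cost a (G - {e})"
      unfolding D_def using a e by (intro lipD[OF f] F_down[OF ins]) auto
  qed
  moreover have "\<bar>q * D G\<bar> \<le> q * (K * o1)"
    using q lipD[OF f a ins] by (simp add: abs_mult D_def o1_def mult_left_mono)
  moreover have "f (insert a G) + h * generator E b f (insert a G) - (f G + h * generator E b f G)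
    = q * D G + h * (U1 - U3 + U2)"
  proof -
    have 1: "f (insert a G) = f G + D G" by (simp add: D_def)
    have 2: "generator E b f (insert a G)
        = generator E b f G + (U1 - U3 + U2 - (S1 + real (card G) + 1 + b a G) * D G)"
      using generator_diff[OF a ins, of f] by (simp add: D_def U1_def U2_def U3_def S1_def)
    show ?thesis unfolding 1 2 by (simp add: q_def algebra_simps)
  qed
  ultimately have "\<bar>f (insert a G) + h * generator E b f (insert a G) - (f G + h
      * generator E b f G)\<bar>
     \<le> q * (K * o1) + h * (K * T1 + K * T3 + K * T2)"
  proof -
    assume U: "\<bar>U1\<bar> \<le> K * T1" "\<bar>U3\<bar> \<le> K * T3" "\<bar>U2\<bar> \<le> K * T2" and "\<bar>q * D G\<bar> \<le> q * (K * o1)"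
      and eq: "f (insert a G) + h * generator E b f (insert a G) - (f G + h * generator E b f G)
        = q * D G + h * (U1 - U3 + U2)"
    have "\<bar>h * (U1 - U3 + U2)\<bar> \<le> h * (K * T1 + K * T3 + K * T2)"
      using U \<open>h \<ge> 0\<close> unfolding abs_mult by (auto intro!: mult_mono)
    then show ?thesis unfolding eq using \<open>\<bar>q * D G\<bar> \<le> q * (K * o1)\<close> by linarith
  qed
  also have "\<dots> = K * (o1 + h * (T1 - S1 * o1 + (T2 - real (card G) * o1) + T3 - o1 - b a G * o1))"
    by (simp add: q_def algebra_simps)
  \<comment> \<open>The \<open>- o1\<close> is the death of \<open>a\<close>, which outweighs the
    drift \<open>o1 / 2\<close>; the birth of \<open>a\<close> in the lower copy can only
    help.\<close>
  also have "\<dots> \<le> K * (o1 + h * (o1 / 2 - o1 - 0))"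
    using drift' \<open>K \<ge> 0\<close> \<open>h \<ge> 0\<close> b_nonneg[of a G] cost_nonneg[of a G]
    by (intro mult_left_mono add_left_mono diff_mono) (auto simp: o1_def)
  also have "\<dots> = (1 - h / 2) * K * cost a G" by (simp add: o1_def algebra_simps)
  finally show "\<bar>f (insert a G) + h * generator E b f (insert a G) - (f G + h * generator E b f G)\<bar>
     \<le> (1 - h / 2) * K * cost a G" .
qed

text \<open>A crude bound whose size is irrelevant: its finiteness makes the supremum over Lipschitz
  functions in \<open>wmean_diff_le\<close> exist.\<close>

lemma lip_bounded:
  assumes "lip 1 f" "G \<in> F"
  shows "\<bar>f G - f {}\<bar> \<le> real (card E) * (\<Sum>e\<in>E. \<Sum>H\<in>F. cost e H)"
proof -
  define M where "M = (\<Sum>e\<in>E. \<Sum>H\<in>F. cost e H)"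
  have M: "M \<ge> 0" unfolding M_def using cost_nonneg by (intro sum_nonneg) auto
  have "\<bar>f G - f {}\<bar> \<le> real (card G) * M"
    using finite_member[OF assms(2)] assms(2)
  proof (induction G rule: finite_induct)
    case (insert e G)
    then have GF: "G \<in> F" using F_down[OF insert.prems] by auto
    have eE: "e \<in> E" using F_subset[OF insert.prems] by auto
    have "cost e G \<le> (\<Sum>H\<in>F. cost e H)"
      using GF finite_F cost_nonneg by (intro member_le_sum) auto
    also have "\<dots> \<le> M"
      unfolding M_def using eE finite_E cost_nonneg
      by (intro member_le_sum[of e E "\<lambda>e. \<Sum>H\<in>F. cost e H"]) (auto intro: sum_nonneg)
    finally have "\<bar>f (insert e G) - f G\<bar> \<le> M"
      using lipD[OF assms(1), of e G] insert eE by auto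
    then show ?case
      using insert.IH[OF GF] insert.hyps by (simp add: algebra_simps)
  qed simp
  also have "\<dots> \<le> real (card E) * M"
    using M F_subset[OF assms(2)] finite_E by (intro mult_right_mono) (auto intro: card_mono)
  finally show ?thesis by (simp add: M_def)
qed

text \<open>Applying the contraction to an extremal Lipschitz function gives the bound on the
  Wasserstein distance \<open>s\<close> in the form \<open>s \<le> (1 - h/2) s + h \<delta>\<close>.\<close>

lemma wmean_diff_le:
  assumes "birth_death E F b' W'"
    and delta: "\<And>G. G \<in> F \<Longrightarrow> (\<Sum>e\<in>E - G. \<bar>b e G - b' e G\<bar> * cost e G) \<le> \<delta>"
    and f: "lip 1 f"
  shows "wmean F W' f - wmean F W f \<le> 2 * \<delta>"
proof -
  interpret B: birth_death E F b' W' by fact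
  define R where "R = 2 + real (card E) + 2 * (\<Sum>G\<in>F. \<Sum>e\<in>E. b e G)"
  define h where "h = 1 / R"
  have R: "R \<ge> 2" unfolding R_def using b_nonneg by (simp add: sum_nonneg)
  have h: "h > 0" "h < 2" "h * R \<le> 1" using R by (auto simp: h_def field_simps)
  define d where "d = (\<lambda>f. wmean F W' f - wmean F W f)"
  define X where "X = d ` {f. lip 1 f}"
  have step: "d f \<le> (1 - h / 2) * Sup X + h * \<delta>" if f: "lip 1 f" and bdd: "bdd_above X" for f
  proof -
    define P where "P = (\<lambda>G. f G + h * generator E b f G)"
    have "lip ((1 - h / 2) * 1) P"
      unfolding P_def using h by (intro lip_generator_step[OF f]) (auto simp: R_def)
    \<comment> \<open>Rescaled, the function after one step competes in the supremum again, which
      closes the recursion.\<close>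
    then have "lip 1 (\<lambda>G. (1 / (1 - h / 2)) * P G)"
      unfolding lip_def right_diff_distrib[symmetric] abs_mult using h by (auto simp: field_simps)
    then have "d (\<lambda>G. (1 / (1 - h / 2)) * P G) \<le> Sup X"
      by (intro cSup_upper[OF _ bdd]) (auto simp: X_def)
    then have "d P \<le> (1 - h / 2) * Sup X"
      using h unfolding d_def wmean_cmult B.wmean_cmult right_diff_distrib[symmetric]
      by (simp add: pos_divide_le_eq mult.commute)
    moreover have "wmean F W P = wmean F W f"
      unfolding P_def wmean_add wmean_cmult wmean_generator by simp
    moreover have "wmean F W' P = wmean F W' f + h * wmean F W' (generator E b f)"
      unfolding P_def B.wmean_add B.wmean_cmult by simp
    \<comment> \<open>The generator with rates \<open>b'\<close> has mean zero under
      \<open>W'\<close>, so only the difference of the two rates contributes, weighted by the cost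
      of the flip.\<close>
    moreover have "- \<delta> \<le> wmean F W' (generator E b f)"
    proof -
      have "- \<delta> + generator E b' f G \<le> generator E b f G" if G: "G \<in> F" for G
      proof -
        have "generator E b' f G - generator E b f G
            = (\<Sum>e\<in>E - G. (b' e G - b e G) * (f (insert e G) - f G))"
          by (simp add: generator_def sum_subtractf[symmetric] left_diff_distrib)
        also have "\<dots> \<le> (\<Sum>e\<in>E - G. \<bar>b e G - b' e G\<bar> * cost e G)"
        proof (rule sum_mono)
          fix e assume e: "e \<in> E - G"
          show "(b' e G - b e G) * (f (insert e G) - f G) \<le> \<bar>b e G - b' e G\<bar> * cost e G"
          proof (cases "insert e G \<in> F")
            case True
            have "(b' e G - b e G) * (f (insert e G) - f G)
                \<le> \<bar>b' e G - b e G\<bar> * \<bar>f (insert e G) - f G\<bar>"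
              by (metis abs_ge_self abs_mult)
            also have "\<dots> \<le> \<bar>b' e G - b e G\<bar> * cost e G"
              using lipD[OF f e True] by (intro mult_left_mono) auto
            finally show ?thesis by (simp add: abs_minus_commute)
          next
            case False
            then show ?thesis using b_blocked[OF e] B.b_blocked[OF e] by simp
          qed
        qed
        also have "\<dots> \<le> \<delta>" using delta[OF G] .
        finally show ?thesis by simp
      qed
      then have "wmean F W' (\<lambda>G. - \<delta> + generator E b' f G) \<le> wmean F W' (generator E b f)"
        by (intro B.wmean_mono) auto
      then show ?thesis
        unfolding B.wmean_add B.wmean_const B.wmean_generator by simp
    qed
    ultimately show ?thesis
      using h mult_left_mono[of "- \<delta>" "wmean F W' (generator E b f)" h] by (simp add: d_def)
  qed
  define M where "M = real (card E) * (\<Sum>e\<in>E. \<Sum>H\<in>F. cost e H)"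
  have "d f \<le> 2 * M" if f: "lip 1 f" for f
  proof -
    have "wmean F W' f \<le> wmean F W' (\<lambda>_. f {} + M)"
      using lip_bounded[OF f] by (intro B.wmean_mono) (force simp: M_def abs_le_iff)
    moreover have "wmean F W (\<lambda>_. f {} - M) \<le> wmean F W f"
      using lip_bounded[OF f] by (intro wmean_mono) (force simp: M_def abs_le_iff)
    ultimately show ?thesis by (simp add: d_def wmean_const B.wmean_const)
  qed
  then have bdd: "bdd_above X" unfolding X_def by (intro bdd_aboveI2) auto
  have "Sup X \<le> (1 - h / 2) * Sup X + h * \<delta>"
  proof (rule cSup_least)
    show "X \<noteq> {}" using f by (auto simp: X_def)
    show "x \<le> (1 - h / 2) * Sup X + h * \<delta>" if "x \<in> X" for x
      using that step[OF _ bdd] by (auto simp: X_def)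
  qed
  then have "h * Sup X \<le> h * (2 * \<delta>)" by (simp add: algebra_simps)
  then have "Sup X \<le> 2 * \<delta>" using h by simp
  moreover have "d f \<le> Sup X" using f by (intro cSup_upper[OF _ bdd]) (auto simp: X_def)
  ultimately show ?thesis by (simp add: d_def)
qed

end

subsection \<open>Triangle-free graphs with penalised degrees\<close>

definition degree :: "nat set set \<Rightarrow> nat \<Rightarrow> nat" where
  "degree G v = card {e \<in> G. v \<in> e}"

text \<open>The penalty is chosen so that \<open>i \<mapsto> i * penalty D i\<close> is bounded by \<open>D\<close> while consecutive
  penalties differ by at most \<open>1 / D\<close>.\<close>

definition penalty :: "real \<Rightarrow> nat \<Rightarrow> real" where
  "penalty D i = D / max D (real i)"

definition rate :: "nat \<Rightarrow> real \<Rightarrow> (nat set \<Rightarrow> real) \<Rightarrow> nat set \<Rightarrow> nat set set \<Rightarrow> real" where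
  "rate n D z e G =
     (if insert e G \<in> tri_free n then z e * (\<Prod>v\<in>e. penalty D (degree G v)) else 0)"

text \<open>The product over \<open>i < degree G v\<close> telescopes: an edge inserted at
  \<open>v\<close> multiplies it by the penalty at the current degree, which gives detailed balance
  with \<open>rate\<close>.\<close>

definition weight :: "nat \<Rightarrow> real \<Rightarrow> (nat set \<Rightarrow> real) \<Rightarrow> nat set set \<Rightarrow> real" where
  "weight n D z G = (\<Prod>e\<in>G. z e) * (\<Prod>v<n. \<Prod>i<degree G v. penalty D i)"

definition cost :: "real \<Rightarrow> nat set \<Rightarrow> nat set set \<Rightarrow> real" where
  "cost D e G = 1 + real (\<Sum>v\<in>e. degree G v) / D"

lemma degree_insert:
  "finite G \<Longrightarrow> e \<notin> G \<Longrightarrow> degree (insert e G) v = degree G v + of_bool (v \<in> e)"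
proof -
  assume *: "finite G" "e \<notin> G"
  have "{f \<in> insert e G. v \<in> f} = (if v \<in> e then insert e {f \<in> G. v \<in> f} else {f \<in> G. v \<in> f})"
    by auto
  then show ?thesis using * by (simp add: degree_def)
qed

lemma degree_mono: "finite G \<Longrightarrow> H \<subseteq> G \<Longrightarrow> degree H v \<le> degree G v"
  unfolding degree_def by (intro card_mono) auto

lemma penalty_pos: "D > 0 \<Longrightarrow> penalty D i > 0"
  by (auto simp: penalty_def)

lemma penalty_le_1: "D > 0 \<Longrightarrow> penalty D i \<le> 1"
  by (auto simp: penalty_def divide_le_eq_1)

lemma penalty_eq_1: "D > 0 \<Longrightarrow> real i \<le> D \<Longrightarrow> penalty D i = 1"
  by (auto simp: penalty_def max_def)

lemma penalty_antimono: "D > 0 \<Longrightarrow> i \<le> j \<Longrightarrow> penalty D j \<le> penalty D i"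
  unfolding penalty_def by (intro divide_left_mono) auto

lemma mult_penalty_le: "D > 0 \<Longrightarrow> real i * penalty D i \<le> D"
  by (auto simp: penalty_def pos_divide_le_eq max_def mult.commute)

text \<open>The penalty is constant up to \<open>D\<close>, and beyond \<open>D\<close> it drops by
  \<open>D / (i * (i + 1))\<close>. The case in between occurs because \<open>D\<close>, later
  \<open>sqrt n\<close>, need not be an integer.\<close>

lemma penalty_diff:
  assumes "D > 0"
  shows "penalty D i - penalty D (Suc i) \<le> 1 / D"
    and "real i * (penalty D i - penalty D (Suc i)) \<le> 1"
proof -
  consider "real (Suc i) \<le> D" | "real i < D" "D < real (Suc i)" | "D \<le> real i" by linarith
  then have "penalty D i - penalty D (Suc i) \<le> 1 / D
      \<and> real i * (penalty D i - penalty D (Suc i)) \<le> 1"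
  proof cases
    case 1
    then show ?thesis using assms by (simp add: penalty_eq_1)
  next
    case 2
    then have eq: "penalty D i - penalty D (Suc i) = 1 - D / (1 + real i)"
      using assms by (simp add: penalty_def max_def)
    have "(1 + real i - D) / (1 + real i) \<le> 1 / (1 + real i)"
      using 2 by (intro divide_right_mono) auto
    then have "1 - D / (1 + real i) \<le> 1 / (1 + real i)" by (simp add: diff_divide_distrib)
    moreover from this have "real i * (1 - D / (1 + real i)) \<le> real i * (1 / (1 + real i))"
      by (rule mult_left_mono) simp
    moreover have "real i * (1 / (1 + real i)) \<le> 1" by (simp add: field_simps)
    moreover have "1 / (1 + real i) \<le> 1 / D" using 2 assms by (intro divide_left_mono) auto
    ultimately show ?thesis unfolding eq by (auto intro: order_trans)
  next
    case 3
    then have i: "real i > 0" using assms by linarith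
    have eq: "penalty D i - penalty D (Suc i) = D / (real i * (1 + real i))"
      using 3 i assms by (simp add: penalty_def max_def divide_simps) (simp add: algebra_simps)
    have "D / (real i * (1 + real i)) \<le> real i / (real i * (1 + real i))"
      using 3 i by (intro divide_right_mono) auto
    also have "\<dots> = 1 / (1 + real i)" using i by simp
    also have "\<dots> \<le> 1 / D" using 3 assms by (intro divide_left_mono) auto
    finally have "D / (real i * (1 + real i)) \<le> 1 / D" .
    moreover have "real i * (D / (real i * (1 + real i))) = D / (1 + real i)" using i by simp
    moreover have "D / (1 + real i) \<le> 1" using 3 by simp
    ultimately show ?thesis unfolding eq by simp
  qed
  then show "penalty D i - penalty D (Suc i) \<le> 1 / D"
    and "real i * (penalty D i - penalty D (Suc i)) \<le> 1" by auto
qed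

lemma edges_subset: "e \<in> edges n \<Longrightarrow> e \<subseteq> {..<n}"
  by (auto simp: nsets_def)

lemma edges_finite: "e \<in> edges n \<Longrightarrow> finite e"
  by (auto simp: nsets_def)

lemma weight_pos: "D > 0 \<Longrightarrow> (\<And>e. z e > 0) \<Longrightarrow> weight n D z G > 0"
  unfolding weight_def by (intro mult_pos_pos prod_pos) (auto simp: penalty_pos)

lemma weight_insert:
  assumes "e \<in> edges n - G" "insert e G \<in> tri_free n"
  shows "weight n D z (insert e G) = weight n D z G * rate n D z e G"
proof -
  have fin: "finite G" using finite_tri_free_member[OF assms(2)] by simp
  have e: "e \<subseteq> {..<n}" using assms(1) edges_subset by auto
  have "(\<Prod>v<n. \<Prod>i<degree (insert e G) v. penalty D i)
      = (\<Prod>v<n. (\<Prod>i<degree G v. penalty D i) * (if v \<in> e then penalty D (degree G v) else 1))"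
    using fin assms(1) by (intro prod.cong) (auto simp: degree_insert)
  also have "\<dots> = (\<Prod>v<n. \<Prod>i<degree G v. penalty D i) * (\<Prod>v\<in>e. penalty D (degree G v))"
    using e by (simp add: prod.distrib prod.If_cases Int_absorb1)
  finally show ?thesis
    using assms fin by (simp add: weight_def rate_def mult_ac)
qed

lemma birth_death_tri_free:
  assumes "D > 0" "\<And>e. z e > 0"
  shows "birth_death (edges n) (tri_free n) (rate n D z) (weight n D z)"
proof
  show "rate n D z e G \<ge> 0" for e G
    unfolding rate_def using assms by (simp add: less_imp_le penalty_pos prod_nonneg)
qed (use assms in \<open>auto simp: tri_free_edges weight_pos weight_insert rate_def intro:
    tri_free_mono dest: tri_free_edges\<close>)

text \<open>Neither edge alone closes a triangle, so a triangle in the union contains both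
  \<open>e\<close> and \<open>a\<close>; they share a vertex, and the third side lies in
  \<open>G\<close>, which the last assumption forbids.\<close>

lemma tri_free_insert2:
  assumes e: "insert e G \<in> tri_free n" and a: "insert a G \<in> tri_free n"
    and no: "\<And>x y z. e = {x, y} \<Longrightarrow> a = {y, z} \<Longrightarrow> {x, z} \<notin> G"
  shows "insert e (insert a G) \<in> tri_free n"
  unfolding tri_free_iff
proof (intro conjI allI impI notI)
  show "insert e (insert a G) \<subseteq> edges n" using tri_free_edges[OF e] tri_free_edges[OF a] by blast
next
  fix x y z
  let ?H = "insert e (insert a G)"
  assume T: "{x, y} \<in> ?H" "{y, z} \<in> ?H" "{x, z} \<in> ?H"
  have H: "?H \<subseteq> edges n" using tri_free_edges[OF e] tri_free_edges[OF a] by blast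
  have "{x, y} \<in> edges n" "{y, z} \<in> edges n" "{x, z} \<in> edges n"
    by (rule subsetD[OF H], fact)+
  then have d: "x \<noteq> y" "y \<noteq> z" "x \<noteq> z" unfolding doubleton_in_nsets_2 by auto
  have e': "\<not> ({x, y} \<in> insert e G \<and> {y, z} \<in> insert e G \<and> {x, z} \<in> insert e G)"
    using e unfolding tri_free_iff by blast
  have a': "\<not> ({x, y} \<in> insert a G \<and> {y, z} \<in> insert a G \<and> {x, z} \<in> insert a G)"
    using a unfolding tri_free_iff by blast
  \<comment> \<open>The six cases below place \<open>e\<close> and \<open>a\<close> on two sides of
    the triangle; each reduces to this pattern by renaming the vertices.\<close>
  have key: "False" if "{p, q} = e" "{q, r} = a" "{p, r} \<in> ?H" "p \<noteq> q" "q \<noteq> r" "p \<noteq> r" for p q r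
    using no[OF that(1,2)[symmetric]] that by (auto simp: doubleton_eq_iff)
  have T': "{y, x} \<in> ?H" "{z, y} \<in> ?H" "{z, x} \<in> ?H" using T by (simp_all add: insert_commute)
  have d': "y \<noteq> x" "z \<noteq> y" "z \<noteq> x" using d by auto
  have "e \<noteq> a" using a' T by blast
  moreover have "{x, y} = e \<or> {y, z} = e \<or> {x, z} = e" using a' T unfolding insert_iff by argo
  moreover have "{x, y} = a \<or> {y, z} = a \<or> {x, z} = a" using e' T unfolding insert_iff by argo
  ultimately consider "{x, y} = e" "{y, z} = a" | "{x, y} = e" "{x, z} = a" | "{y, z} = e" "{x, y}
      = a"
    | "{y, z} = e" "{x, z} = a" | "{x, z} = e" "{x, y} = a" | "{x, z} = e" "{y, z} = a"
    by argo
  then show False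
  proof cases
    case 1
    then show ?thesis by (intro key[OF _ _ T(3) d(1) d(2) d(3)]) auto
  next
    case 2
    then show ?thesis by (intro key[OF _ _ T(2) d'(1) d(3) d(2)]) auto
  next
    case 3
    then show ?thesis by (intro key[OF _ _ T'(3) d'(2) d'(1) d'(3)]) auto
  next
    case 4
    then show ?thesis by (intro key[OF _ _ T'(1) d(2) d'(3) d'(1)]) auto
  next
    case 5
    then show ?thesis by (intro key[OF _ _ T'(2) d'(3) d(1) d'(2)]) auto
  next
    case 6
    then show ?thesis by (intro key[OF _ _ T(1) d(3) d'(2) d(1)]) auto
  qed
qed

text \<open>Flipping \<open>a\<close> influences only edges meeting \<open>a\<close>, and such an
  edge other than \<open>a\<close> has a unique form \<open>{x, w}\<close> with \<open>x\<close> in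
  \<open>a\<close> and \<open>w\<close> outside. Both sums over births in the drift condition are
  estimated in this way.\<close>

lemma sum_adjacent_le:
  fixes g :: "nat set \<Rightarrow> real"
  assumes a: "a \<in> edges n" and A: "A \<subseteq> edges n - {a}"
    and g0: "\<And>e. e \<in> A \<Longrightarrow> e \<inter> a = {} \<Longrightarrow> g e \<le> 0"
    and gh: "\<And>x w. x \<in> a \<Longrightarrow> w < n \<Longrightarrow> w \<notin> a \<Longrightarrow> {x, w} \<in> A \<Longrightarrow> g {x, w} \<le> h x w"
    and h: "\<And>x w. h x w \<ge> 0"
  shows "(\<Sum>e\<in>A. g e) \<le> (\<Sum>x\<in>a. \<Sum>w<n. h x w)"
proof -
  define T where "T = {(x, w). x \<in> a \<and> w < n \<and> w \<notin> a \<and> {x, w} \<in> A}"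
  have finA: "finite A" using A finite_edges finite_subset by blast
  have fina: "finite a" using a by (rule edges_finite)
  have "T \<subseteq> a \<times> {..<n}" by (auto simp: T_def)
  then have finT: "finite T" using fina finite_subset by blast
  have bij: "bij_betw (\<lambda>(x, w). {x, w}) T {e \<in> A. e \<inter> a \<noteq> {}}"
  proof (rule bij_betwI')
    fix p q assume "p \<in> T" "q \<in> T"
    then show "((case p of (x, w) \<Rightarrow> {x, w}) = (case q of (x, w) \<Rightarrow> {x, w})) = (p = q)"
      by (auto simp: T_def doubleton_eq_iff)
  next
    fix p assume "p \<in> T"
    then show "(case p of (x, w) \<Rightarrow> {x, w}) \<in> {e \<in> A. e \<inter> a \<noteq> {}}" by (auto simp: T_def)
  next
    fix e assume e: "e \<in> {e \<in> A. e \<inter> a \<noteq> {}}"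
    then have "e \<in> edges n" "e \<noteq> a" using A by auto
    then obtain x y where xy: "e = {x, y}" "x < n" "y < n" "x \<noteq> y" by (auto elim!: nsets2_E)
    obtain u v where uv: "a = {u, v}" "u \<noteq> v" using a by (auto elim!: nsets2_E)
    have "x \<in> a \<and> y \<notin> a \<or> y \<in> a \<and> x \<notin> a"
      using e xy uv \<open>e \<noteq> a\<close> by auto
    then show "\<exists>p\<in>T. e = (case p of (x, w) \<Rightarrow> {x, w})"
      using e xy by (force simp: T_def insert_commute)
  qed
  have "(\<Sum>e\<in>A. g e) = (\<Sum>e\<in>{e \<in> A. e \<inter> a \<noteq> {}}. g e) + (\<Sum>e\<in>{e \<in> A. e \<inter> a = {}}. g e)"
    using finA by (subst sum.union_disjoint[symmetric]) (auto intro: sum.cong)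
  also have "\<dots> \<le> (\<Sum>e\<in>{e \<in> A. e \<inter> a \<noteq> {}}. g e)"
    using g0 sum_nonpos[of "{e \<in> A. e \<inter> a = {}}" g] by auto
  also have "\<dots> = (\<Sum>p\<in>T. g (case p of (x, w) \<Rightarrow> {x, w}))"
    by (rule sum.reindex_bij_betw[OF bij, symmetric])
  also have "\<dots> \<le> (\<Sum>p\<in>T. case p of (x, w) \<Rightarrow> h x w)"
    using gh by (intro sum_mono) (auto simp: T_def)
  also have "\<dots> \<le> (\<Sum>p\<in>a \<times> {..<n}. case p of (x, w) \<Rightarrow> h x w)"
    using \<open>T \<subseteq> a \<times> {..<n}\<close> fina h by (intro sum_mono2) auto
  also have "\<dots> = (\<Sum>x\<in>a. \<Sum>w<n. h x w)" by (rule sum.cartesian_product[symmetric])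
  finally show ?thesis .
qed

lemma sum_neighbours_le_degree:
  assumes "finite G"
  shows "(\<Sum>w<n. of_bool ({y, w} \<in> G)) \<le> real (degree G y)"
proof -
  have "(\<Sum>w<n. of_bool ({y, w} \<in> G)) = real (card {w \<in> {..<n}. {y, w} \<in> G})"
    by (simp add: of_bool_def sum.If_cases Int_def)
  also have "card {w \<in> {..<n}. {y, w} \<in> G} = card ((\<lambda>w. {y, w}) ` {w \<in> {..<n}. {y, w} \<in> G})"
    by (rule card_image[symmetric]) (auto simp: inj_on_def doubleton_eq_iff)
  also have "\<dots> \<le> degree G y"
    unfolding degree_def using assms by (intro card_mono) auto
  finally show ?thesis by simp
qed

lemma cost_ge_1: "D > 0 \<Longrightarrow> cost D e G \<ge> 1"
  by (simp add: cost_def sum_nonneg)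

text \<open>The purpose of the penalty: the cost consists of \<open>1\<close> and two terms
  \<open>deg / D\<close>, and each of the latter is brought down to at most \<open>1\<close> by the
  penalty at the same vertex.\<close>

lemma penalty_prod_cost_le:
  assumes "D > 0" "e \<in> edges n"
  shows "(\<Prod>v\<in>e. penalty D (degree G v)) * cost D e G \<le> 3"
proof -
  obtain x w where e: "e = {x, w}" "x \<noteq> w" using assms(2) by (auto elim!: nsets2_E)
  define p q where "p = penalty D (degree G x)" and "q = penalty D (degree G w)"
  have p: "0 < p" "p \<le> 1" "real (degree G x) * p \<le> D"
    unfolding p_def using assms by (auto intro: penalty_pos penalty_le_1 mult_penalty_le)
  have q: "0 < q" "q \<le> 1" "real (degree G w) * q \<le> D"
    unfolding q_def using assms by (auto intro: penalty_pos penalty_le_1 mult_penalty_le)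
  have "(\<Prod>v\<in>e. penalty D (degree G v)) * cost D e G
      = p * q + q * (real (degree G x) * p / D) + p * (real (degree G w) * q / D)"
    using e by (simp add: cost_def p_def q_def algebra_simps add_divide_distrib)
  also have "\<dots> \<le> 1 * 1 + 1 * 1 + 1 * 1"
    using p q assms by (intro add_mono mult_mono) (auto simp: pos_divide_le_eq)
  finally show ?thesis by simp
qed

lemma rate_cost_le:
  assumes "D > 0" "\<And>e. z e > 0" "e \<in> edges n" "z e \<le> L"
  shows "rate n D z e G * cost D e G \<le> 3 * L"
proof -
  have L: "L > 0" using assms(2)[of e] assms(4) by linarith
  have "z e * ((\<Prod>v\<in>e. penalty D (degree G v)) * cost D e G) \<le> L * 3"
    using L assms penalty_prod_cost_le[OF assms(1,3), of G] cost_ge_1[OF assms(1), of e G]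
    by (intro mult_mono mult_nonneg_nonneg prod_nonneg) (auto intro: less_imp_le[OF penalty_pos])
  with L show ?thesis by (simp add: rate_def)
qed

text \<open>Inserting \<open>a\<close> can lower the rate of the adjacent edge \<open>{x, w}\<close>
  in two ways. If \<open>w\<close> is joined to the other end of \<open>a\<close>, the edge is
  blocked and its whole rate is lost. Otherwise only the degree of \<open>x\<close> has grown, which
  changes the penalty by at most \<open>1 / D\<close>; against the degree of \<open>x\<close> in the
  cost, the second bound of \<open>penalty_diff\<close> is used.\<close>

lemma rate_diff_cost_le:
  assumes D: "D > 0" and z: "\<And>e. z e > 0" "\<And>e. z e \<le> L"
    and a: "a \<in> edges n - G" "insert a G \<in> tri_free n"
    and x: "x \<in> a" "w \<notin> a" "{x, w} \<in> edges n - insert a G"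
  shows "(rate n D z {x, w} G - rate n D z {x, w} (insert a G)) * cost D {x, w} G
    \<le> 3 * L * (of_bool (\<exists>y\<in>a - {x}. {y, w} \<in> G) + 1 / D)"
proof -
  interpret birth_death "edges n" "tri_free n" "rate n D z" "weight n D z"
    using birth_death_tri_free[OF D z(1)] .
  let ?e = "{x, w}"
  have L: "L > 0" using z(1)[of ?e] z(2)[of ?e] by linarith
  have fin: "finite G" using finite_tri_free_member[OF a(2)] by simp
  have cost: "cost D ?e G \<ge> 0" using cost_ge_1[OF D, of ?e G] by simp
  show ?thesis
  proof (cases "\<exists>y\<in>a - {x}. {y, w} \<in> G")
    case True
    have "(rate n D z ?e G - rate n D z ?e (insert a G)) * cost D ?e G
        \<le> rate n D z ?e G * cost D ?e G"
      using cost b_nonneg[of ?e "insert a G"] by (intro mult_right_mono) auto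
    also have "\<dots> \<le> 3 * L" using D z x by (intro rate_cost_le) auto
    also have "3 * L * 1 \<le> 3 * L * (1 + 1 / D)" using L D by (intro mult_left_mono) auto
    finally show ?thesis using True by simp
  next
    case no: False
    show ?thesis
    proof (cases "insert ?e G \<in> tri_free n")
      case False
      then have "rate n D z ?e G = 0" by (simp add: rate_def)
      then have "(rate n D z ?e G - rate n D z ?e (insert a G)) * cost D ?e G \<le> 0"
        using cost b_nonneg[of ?e "insert a G"] by (simp add: mult_nonneg_nonneg)
      also have "0 \<le> 3 * L * (of_bool (\<exists>y\<in>a - {x}. {y, w} \<in> G) + 1 / D)"
        using L D by simp
      finally show ?thesis .
    next
      case True
      obtain u v where uv: "a = {u, v}" "u \<noteq> v" using a by (auto elim!: nsets2_E)
      have True': "insert ?e (insert a G) \<in> tri_free n"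
      proof (rule tri_free_insert2[OF True a(2)])
        fix p q r assume pqr: "{x, w} = {p, q}" "a = {q, r}"
        have "q = x" "p = w" using pqr x by (auto simp: doubleton_eq_iff)
        moreover have "r \<in> a - {x}" using pqr uv \<open>q = x\<close> by (auto simp: doubleton_eq_iff)
        ultimately show "{p, r} \<notin> G" using no by (auto simp: insert_commute)
      qed
      define p p' q where "p = penalty D (degree G x)" and "p' = penalty D (Suc (degree G x))"
        and "q = penalty D (degree G w)"
      have xw: "x \<noteq> w" using x by auto
      have deg: "degree (insert a G) x = Suc (degree G x)" "degree (insert a G) w = degree G w"
        using fin a x by (auto simp: degree_insert)
      have eq: "rate n D z ?e G - rate n D z ?e (insert a G) = z ?e * (q * (p - p'))"
        using True True' xw by (simp add: rate_def p_def p'_def q_def deg algebra_simps)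
      have q: "0 < q" "q \<le> 1" "real (degree G w) * q \<le> D"
        unfolding q_def using D by (auto intro: penalty_pos penalty_le_1 mult_penalty_le)
      have p: "p - p' \<ge> 0" "p - p' \<le> 1 / D" "real (degree G x) * (p - p') \<le> 1"
        unfolding p_def p'_def using penalty_diff[OF D, of "degree G x"]
        by (auto intro: penalty_antimono[OF D])
      have "q * (p - p') * cost D ?e G = q * (p - p') + q * ((real (degree G x) * (p - p')) / D)
          + (real (degree G w) * q / D) * (p - p')"
        using xw by (simp add: cost_def algebra_simps add_divide_distrib diff_divide_distrib)
      also have "\<dots> \<le> 1 * (1 / D) + 1 * (1 / D) + 1 * (1 / D)"
        using p q D by (intro add_mono mult_mono divide_right_mono) (auto simp: pos_divide_le_eq)
      finally have "z ?e * (q * (p - p') * cost D ?e G) \<le> L * (3 / D)"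
        using z(1)[of ?e] z(2)[of ?e] cost p q L by (intro mult_mono) auto
      then show ?thesis using no unfolding eq by (simp add: mult_ac)
    qed
  qed
qed

text \<open>With \<open>D = sqrt n\<close> and \<open>L = 1 / (32 * D)\<close> one has
  \<open>n * L / D = 1/32\<close>. The drift is then at most
  \<open>2/32 + 3/32 * (cost - 1) + 6/32\<close>, and since the cost is at least \<open>1\<close>
  this is at most a quarter of it.\<close>

lemma contracting_tri_free:
  assumes n: "n > 0" and z: "\<And>e. z e > 0" "\<And>e. z e \<le> 1 / (32 * sqrt n)"
  defines "D \<equiv> sqrt n"
  shows "contracting_birth_death (edges n) (tri_free n) (rate n D z) (weight n D z) (cost D)"
proof -
  have D: "D > 0" "D * D = real n" using n by (auto simp: D_def)
  interpret birth_death "edges n" "tri_free n" "rate n D z" "weight n D z"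
    using birth_death_tri_free[OF D(1) z(1)] .
  define L where "L = 1 / (32 * D)"
  have L: "L > 0" "\<And>e. z e \<le> L" using D z by (auto simp: L_def D_def)
  show ?thesis
  proof
    show "cost D e G \<ge> 0" for e G using cost_ge_1[OF D(1), of e G] by simp
  next
    fix a e G assume a: "a \<in> edges n - G" "insert a G \<in> tri_free n" and e: "e \<in> edges n
        - insert a G"
    have fin: "finite G" using finite_tri_free_member[OF a(2)] by simp
    show "rate n D z e (insert a G) \<le> rate n D z e G"
    proof (cases "insert e (insert a G) \<in> tri_free n")
      case True
      then have "insert e G \<in> tri_free n" by (rule tri_free_mono) auto
      moreover have "(\<Prod>v\<in>e. penalty D (degree (insert a G) v)) \<le> (\<Prod>v\<in>e. penalty D (degree G v))"
        using D fin by (intro prod_mono conjI penalty_antimono degree_mono)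
          (auto intro: less_imp_le[OF penalty_pos])
      ultimately show ?thesis using True z(1)[of e] by (simp add: rate_def)
    next
      case False
      then show ?thesis using b_nonneg[of e G] by (simp add: rate_def)
    qed
  next
    fix a G assume a: "a \<in> edges n - G" "insert a G \<in> tri_free n"
    have fin: "finite G" using finite_tri_free_member[OF a(2)] by simp
    obtain u v where uv: "a = {u, v}" "u \<noteq> v" using a by (auto elim!: nsets2_E)
    have 1: "(\<Sum>e\<in>edges n - insert a G. rate n D z e (insert a G) * (cost D a (insert e G)
        - cost D a G))
        \<le> (\<Sum>x\<in>a. \<Sum>w<n. L / D)"
    proof (rule sum_adjacent_le)
      fix e assume e: "e \<in> edges n - insert a G" "e \<inter> a = {}"
      then have "cost D a (insert e G) = cost D a G"
        using fin uv by (auto simp: cost_def degree_insert)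
      then show "rate n D z e (insert a G) * (cost D a (insert e G) - cost D a G) \<le> 0" by simp
    next
      fix x w assume x: "x \<in> a" "w \<notin> a" "{x, w} \<in> edges n - insert a G"
      have "cost D a (insert {x, w} G) - cost D a G = 1 / D"
        using fin uv x by (auto simp: cost_def degree_insert add_divide_distrib)
      moreover have "rate n D z {x, w} (insert a G)
          \<le> rate n D z {x, w} (insert a G) * cost D {x, w} (insert a G)"
        using cost_ge_1[OF D(1), of "{x, w}" "insert a G"] b_nonneg[of "{x, w}" "insert a G"]
        by (simp add: mult_le_cancel_left1)
      moreover have "rate n D z {x, w} (insert a G) \<le> L"
      proof -
        have "(\<Prod>v\<in>{x, w}. penalty D (degree (insert a G) v)) \<le> 1"
          using D by (intro prod_le_1) (auto intro: less_imp_le[OF penalty_pos] penalty_le_1)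
        then have "z {x, w} * (\<Prod>v\<in>{x, w}. penalty D (degree (insert a G) v)) \<le> L * 1"
          using L z(1)[of "{x, w}"] D
          by (intro mult_mono prod_nonneg) (auto intro: less_imp_le[OF penalty_pos])
        then show ?thesis using L by (simp add: rate_def)
      qed
      ultimately show "rate n D z {x, w} (insert a G) * (cost D a (insert {x, w} G) - cost D a G)
          \<le> L / D"
        using D by (simp add: divide_right_mono)
    qed (use a D L in auto)
    have 2: "(\<Sum>e\<in>G. cost D a (G - {e}) - cost D a G) \<le> 0"
      using D fin unfolding cost_def
      by (intro sum_nonpos) (auto intro!: divide_right_mono sum_mono degree_mono)
    have 3: "(\<Sum>e\<in>edges n - insert a G. (rate n D z e G - rate n D z e (insert a G)) * cost D e G)
        \<le> (\<Sum>x\<in>a. \<Sum>w<n. 3 * L * (of_bool (\<exists>y\<in>a - {x}. {y, w} \<in> G) + 1 / D))"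
    proof (rule sum_adjacent_le)
      fix e assume e: "e \<in> edges n - insert a G" "e \<inter> a = {}"
      have "insert e (insert a G) \<in> tri_free n \<longleftrightarrow> insert e G \<in> tri_free n"
      proof
        assume "insert e (insert a G) \<in> tri_free n"
        then show "insert e G \<in> tri_free n" by (rule tri_free_mono) auto
      next
        assume "insert e G \<in> tri_free n"
        then show "insert e (insert a G) \<in> tri_free n"
          by (rule tri_free_insert2) (use a(2) e(2) in auto)
      qed
      moreover have "(\<Prod>v\<in>e. penalty D (degree (insert a G) v)) = (\<Prod>v\<in>e. penalty D (degree G v))"
        using fin a e by (intro prod.cong) (auto simp: degree_insert)
      ultimately have "rate n D z e G = rate n D z e (insert a G)"
        by (simp add: rate_def)
      then show "(rate n D z e G - rate n D z e (insert a G)) * cost D e G \<le> 0" by simp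
    next
      fix x w assume "x \<in> a" "w \<notin> a" "{x, w} \<in> edges n - insert a G"
      then show "(rate n D z {x, w} G - rate n D z {x, w} (insert a G)) * cost D {x, w} G
          \<le> 3 * L * (of_bool (\<exists>y\<in>a - {x}. {y, w} \<in> G) + 1 / D)"
        using D(1) z(1) L(2) a by (intro rate_diff_cost_le)
    qed (use a D L in auto)
    have nL: "real n * (L / D) = 1 / 32" using D n by (simp add: L_def field_simps)
    \<comment> \<open>A neighbour \<open>w\<close> of \<open>v\<close> blocks \<open>{u, w}\<close>
      and vice versa, so the number of blocked edges is governed by the degrees of the two ends of
      \<open>a\<close>.\<close>
    have "(\<Sum>x\<in>a. \<Sum>w<n. 3 * L * (of_bool (\<exists>y\<in>a - {x}. {y, w} \<in> G) + 1 / D))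
        = 3 * L * (\<Sum>w<n. of_bool ({v, w} \<in> G)) + 3 * L * (\<Sum>w<n. of_bool ({u, w} \<in> G)) + 6
            * (real n * (L / D))"
    proof -
      have "a - {u} = {v}" "a - {v} = {u}" using uv by auto
      then have "(\<Sum>x\<in>a. \<Sum>w<n. 3 * L * (of_bool (\<exists>y\<in>a - {x}. {y, w} \<in> G) + 1 / D))
        = (\<Sum>w<n. 3 * L * (of_bool ({v, w} \<in> G) + 1 / D)) + (\<Sum>w<n. 3 * L * (of_bool ({u, w} \<in> G)
            + 1 / D))"
        unfolding uv(1) using uv(2) by simp
      then show ?thesis
        by (simp only: sum_distrib_left[symmetric] sum.distrib sum_constant card_lessThan)
           (simp add: algebra_simps)
    qed
    also have "\<dots> \<le> 3 * L * real (degree G v) + 3 * L * real (degree G u) + 6 * (real n * (L / D))"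
      using L sum_neighbours_le_degree[OF fin] by (intro add_mono mult_left_mono) auto
    \<comment> \<open>Here the degree term in the cost of \<open>a\<close> pays for the blocked
      edges, because \<open>3 * L\<close> is \<open>3/32\<close> of \<open>1 / D\<close>.\<close>
    also have "\<dots> = 3 / 32 * (cost D a G - 1) + 6 / 32"
      unfolding nL using D uv by (simp add: cost_def L_def field_simps)
    finally have 4: "(\<Sum>x\<in>a. \<Sum>w<n. 3 * L * (of_bool (\<exists>y\<in>a - {x}. {y, w} \<in> G) + 1 / D))
       \<le> 3 / 32 * (cost D a G - 1) + 6 / 32" .
    have 5: "(\<Sum>x\<in>a. \<Sum>w<n. L / D) = 2 * (real n * (L / D))" using uv by simp
    have "(\<Sum>e\<in>edges n - insert a G. rate n D z e (insert a G) * (cost D a (insert e G)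
        - cost D a G))
       + (\<Sum>e\<in>G. cost D a (G - {e}) - cost D a G)
       + (\<Sum>e\<in>edges n - insert a G. (rate n D z e G - rate n D z e (insert a G)) * cost D e G)
       \<le> 2 * (1 / 32) + 0 + (3 / 32 * (cost D a G - 1) + 6 / 32)"
      by (intro add_mono 1[unfolded 5 nL] 2 order_trans[OF 3 4])
    also have "\<dots> \<le> cost D a G / 2" using cost_ge_1[OF D(1), of a G] by (simp add: field_simps)
    finally show "(\<Sum>e\<in>edges n - insert a G. rate n D z e (insert a G) * (cost D a (insert e G)
        - cost D a G))
       + (\<Sum>e\<in>G. cost D a (G - {e}) - cost D a G)
       + (\<Sum>e\<in>edges n - insert a G. (rate n D z e G - rate n D z e (insert a G)) * cost D e G)
       \<le> cost D a G / 2" .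
  qed
qed

subsection \<open>Concentration of cuts at low density\<close>

lemma sum_UN_le:
  fixes f :: "'a \<Rightarrow> real"
  assumes "finite I" "\<And>i. finite (A i)" "\<And>x. f x \<ge> 0"
  shows "(\<Sum>x\<in>(\<Union>i\<in>I. A i). f x) \<le> (\<Sum>i\<in>I. \<Sum>x\<in>A i. f x)"
  using assms(1)
proof (induction I rule: finite_induct)
  case (insert i I)
  have "(\<Sum>x\<in>A i \<union> (\<Union>i\<in>I. A i). f x) \<le> (\<Sum>x\<in>A i. f x) + (\<Sum>x\<in>(\<Union>i\<in>I. A i). f x)"
    using assms insert.hyps by (simp add: sum_Un sum_nonneg)
  then show ?case using insert by simp
qed simp

text \<open>A tilt by a sum over edges only changes the activity of each edge, so the tilted measure
  stays within the family \<open>weight n D z\<close>. This is why \<open>z\<close> is a function of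
  the edge.\<close>

lemma weight_tilt:
  assumes "finite G"
  shows "weight n D (\<lambda>e. l * exp (t * s e)) G = weight n D (\<lambda>_. l) G * exp (t * (\<Sum>e\<in>G. s e))"
  using assms by (simp add: weight_def prod.distrib sum_distrib_left exp_sum)

lemma abs_exp_minus_1_le:
  fixes y :: real
  assumes "\<bar>y\<bar> \<le> 1 / 2"
  shows "\<bar>exp y - 1\<bar> \<le> 2 * \<bar>y\<bar>"
proof -
  have "norm (exp y) \<le> 1 + 2 * norm y" using assms by (intro exp_bound_lemma) simp
  then have "exp y \<le> 1 + 2 * \<bar>y\<bar>" by simp
  then show ?thesis using exp_ge_add_one_self[of y] by linarith
qed

text \<open>By Jensen's inequality the ratio of the tilted to the untilted partition function is at most
  \<open>exp (t m)\<close>, where \<open>m\<close> is the tilted mean, and the contraction compares \<open>m\<close> with the untilted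
  mean.\<close>

lemma weight_tail:
  fixes s :: "nat set \<Rightarrow> real"
  assumes n: "n > 0" and l: "0 < l" "l \<le> 1 / (32 * sqrt n)"
    and s: "\<And>e. \<bar>s e\<bar> \<le> 1 / 2" and t: "0 \<le> t" "t \<le> 1"
  defines "W \<equiv> weight n (sqrt n) (\<lambda>_. l)" and "f \<equiv> \<lambda>G. \<Sum>e\<in>G. s e"
  shows "(\<Sum>G\<in>tri_free n \<inter> {G. f G \<ge> x}. W G)
    \<le> exp (- t * (x - wmean (tri_free n) W f - 6 * l * t * real (card (edges n))))
        * (\<Sum>G\<in>tri_free n. W G)"
proof -
  define D where "D = sqrt n"
  have D: "D > 0" using n by (simp add: D_def)
  define z where "z = (\<lambda>e. l * exp (t * s e))"
  define W' where "W' = weight n D z"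
  interpret C: contracting_birth_death "edges n" "tri_free n" "rate n D (\<lambda>_. l)" W "cost D"
    unfolding W_def D_def using n l by (intro contracting_tri_free) auto
  have z: "z e > 0" for e using l by (simp add: z_def)
  \<comment> \<open>The untilted chain supplies the contraction. From the tilted one only
    stationarity enters, so its activities may exceed \<open>1 / (32 * sqrt n)\<close>.\<close>
  interpret B: birth_death "edges n" "tri_free n" "rate n D z" W'
    unfolding W'_def using D z by (rule birth_death_tri_free)
  have W': "W' G = W G * exp (t * f G)" if "G \<in> tri_free n" for G
    unfolding W'_def z_def W_def f_def D_def using finite_tri_free_member[OF that]
        by (rule weight_tilt)
  define m m' where "m = wmean (tri_free n) W f" and "m' = wmean (tri_free n) W' f"
  define Z Z' where "Z = (\<Sum>G\<in>tri_free n. W G)" and "Z' = (\<Sum>G\<in>tri_free n. W' G)"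
  \<comment> \<open>The rates differ by at most \<open>l * t\<close> times the penalties, and
    penalties times cost are at most \<open>3\<close>; this gives \<open>3 * l * t\<close> for each
    absent edge.\<close>
  have "m' - m \<le> 2 * (3 * l * t * real (card (edges n)))"
    unfolding m_def m'_def
  proof (rule C.wmean_diff_le)
    show "birth_death (edges n) (tri_free n) (rate n D z) W'" by (rule B.birth_death_axioms)
    show "C.lip 1 f" unfolding C.lip_def
    proof (intro allI ballI impI)
      fix G a assume "a \<in> edges n - G" "insert a G \<in> tri_free n"
      then have "\<bar>f (insert a G) - f G\<bar> = \<bar>s a\<bar>"
        using finite_tri_free_member[of "insert a G"] by (simp add: f_def)
      then show "\<bar>f (insert a G) - f G\<bar> \<le> 1 * cost D a G"
        using s[of a] cost_ge_1[OF D, of a G] by simp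
    qed
    fix G assume G: "G \<in> tri_free n"
    have "(\<Sum>e\<in>edges n - G. \<bar>rate n D (\<lambda>_. l) e G - rate n D z e G\<bar> * cost D e G)
        \<le> (\<Sum>e\<in>edges n - G. 3 * l * t)"
    proof (rule sum_mono)
      fix e assume e: "e \<in> edges n - G"
      define p where "p = (\<Prod>v\<in>e. penalty D (degree G v))"
      have p: "p \<ge> 0" unfolding p_def using D
          by (intro prod_nonneg) (auto intro: less_imp_le[OF penalty_pos])
      have "\<bar>t * s e\<bar> \<le> 1 * (1 / 2)" unfolding abs_mult using s[of e] t by (intro mult_mono) auto
      then have "\<bar>exp (t * s e) - 1\<bar> \<le> 2 * \<bar>t * s e\<bar>" by (intro abs_exp_minus_1_le) simp
      also have "\<dots> \<le> t" using s[of e] t mult_left_mono[of "\<bar>s e\<bar>" "1/2" t] by (simp add: abs_mult)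
      finally have "\<bar>exp (t * s e) - 1\<bar> \<le> t" .
      then have "l * \<bar>exp (t * s e) - 1\<bar> \<le> l * t" using l by (intro mult_left_mono) auto
      moreover have "l - z e = - (l * (exp (t * s e) - 1))" by (simp add: z_def algebra_simps)
      ultimately have z_diff: "\<bar>l - z e\<bar> \<le> l * t" using l by (simp only: abs_minus_cancel abs_mult)
      have "\<bar>rate n D (\<lambda>_. l) e G - rate n D z e G\<bar> \<le> \<bar>l - z e\<bar> * p"
        using p by (simp add: rate_def p_def[symmetric] left_diff_distrib[symmetric] abs_mult)
      also have "\<dots> \<le> l * t * p" using z_diff p by (intro mult_right_mono)
      finally have "\<bar>rate n D (\<lambda>_. l) e G - rate n D z e G\<bar> * cost D e G \<le> l * t * p * cost D e G"
        using cost_ge_1[OF D, of e G] by (intro mult_right_mono) auto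
      also have "\<dots> = (l * t) * (p * cost D e G)" by simp
      also have "\<dots> \<le> (l * t) * 3"
        using penalty_prod_cost_le[OF D, of e n G] e l t
            by (intro mult_left_mono) (auto simp: p_def)
      finally show "\<bar>rate n D (\<lambda>_. l) e G - rate n D z e G\<bar> * cost D e G \<le> 3 * l * t" by simp
    qed
    also have "\<dots> = 3 * l * t * real (card (edges n - G))" by simp
    also have "\<dots> \<le> 3 * l * t * real (card (edges n))"
      using l t by (intro mult_left_mono of_nat_mono card_mono) auto
    finally show "(\<Sum>e\<in>edges n - G. \<bar>rate n D (\<lambda>_. l) e G - rate n D z e G\<bar> * cost D e G)
        \<le> 3 * l * t * real (card (edges n))" .
  qed
  then have m': "m' \<le> m + 6 * l * t * real (card (edges n))" by simp
  \<comment> \<open>Jensen's inequality in tangent form: \<open>1 - t * (f G - m')\<close> has mean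
    \<open>1\<close> under \<open>W'\<close>, since \<open>m'\<close> is the mean of
    \<open>f\<close> there.\<close>
  have "exp (- t * m') * Z' = (\<Sum>G\<in>tri_free n. W' G * (exp (- t * m') * (1 - t * (f G - m'))))"
  proof -
    have "(\<Sum>G\<in>tri_free n. W' G * (exp (- t * m') * (1 - t * (f G - m'))))
        = exp (- t * m') * (Z' - t * ((\<Sum>G\<in>tri_free n. W' G * f G) - m' * Z'))"
      by (simp add: Z'_def sum_distrib_left sum_subtractf[symmetric] algebra_simps)
    moreover have "(\<Sum>G\<in>tri_free n. W' G * f G) = m' * Z'"
      using B.total_pos by (simp add: m'_def Z'_def wmean_def)
    ultimately show ?thesis by simp
  qed
  also have "\<dots> \<le> (\<Sum>G\<in>tri_free n. W G)"
  proof (rule sum_mono)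
    fix G assume G: "G \<in> tri_free n"
    have "exp (- t * m') * (1 - t * (f G - m')) \<le> exp (- t * m') * exp (- t * (f G - m'))"
      using exp_ge_add_one_self[of "- t * (f G - m')"] by (intro mult_left_mono) auto
    also have "\<dots> = exp (- (t * f G))" by (simp add: exp_add[symmetric] algebra_simps)
    finally have "W' G * (exp (- t * m') * (1 - t * (f G - m'))) \<le> W' G * exp (- (t * f G))"
      using B.W_pos[OF G] by (intro mult_left_mono) auto
    also have "\<dots> = W G" by (simp add: W'[OF G] exp_minus)
    finally show "W' G * (exp (- t * m') * (1 - t * (f G - m'))) \<le> W G" .
  qed
  finally have "exp (- t * m') * Z' \<le> Z" by (simp add: Z_def)
  then have Z': "Z' \<le> exp (t * m') * Z" by (simp add: exp_minus field_simps)
  have "(\<Sum>G\<in>tri_free n \<inter> {G. f G \<ge> x}. W G) \<le> (\<Sum>G\<in>tri_free n \<inter> {G. f G \<ge> x}. exp (- t * x) * W' G)"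
  proof (rule sum_mono)
    fix G assume G: "G \<in> tri_free n \<inter> {G. f G \<ge> x}"
    then have "1 \<le> exp (- t * x) * exp (t * f G)"
      using t by (simp add: exp_add[symmetric] mult_left_mono)
    then have "W G * 1 \<le> W G * (exp (- t * x) * exp (t * f G))"
      using G C.W_pos[of G] by (intro mult_left_mono) auto
    then show "W G \<le> exp (- t * x) * W' G" using G W'[of G] by (simp add: mult_ac)
  qed
  also have "\<dots> \<le> (\<Sum>G\<in>tri_free n. exp (- t * x) * W' G)"
    using B.W_pos by (intro sum_mono2) (auto intro: less_imp_le)
  also have "\<dots> = exp (- t * x) * Z'" by (simp add: Z'_def sum_distrib_left)
  also have "\<dots> \<le> exp (- t * x) * (exp (t * m') * Z)" using Z' by (intro mult_left_mono) auto
  also have "\<dots> = exp (- t * (x - m')) * Z" by (simp add: exp_add[symmetric] algebra_simps)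
  also have "\<dots> \<le> exp (- t * (x - m - 6 * l * t * real (card (edges n)))) * Z"
  proof -
    have "t * m' \<le> t * (m + 6 * l * t * real (card (edges n)))" using m' t by (intro mult_left_mono)
    then show ?thesis
      using C.total_pos by (intro mult_right_mono) (auto simp: Z_def algebra_simps)
  qed
  finally show ?thesis by (simp add: Z_def m_def)
qed

section \<open>Exchangeability of the edges\<close>

definition relabel :: "(nat \<Rightarrow> nat) \<Rightarrow> nat set set \<Rightarrow> nat set set" where
  "relabel p G = (\<lambda>e. p ` e) ` G"

lemma relabel_weight:
  assumes ij: "i < n" "j < n"
  defines "p \<equiv> Transposition.transpose i j"
  shows "relabel p (relabel p G) = G" and "e \<in> relabel p G \<longleftrightarrow> p ` e \<in> G"
    and "G \<in> tri_free n \<Longrightarrow> relabel p G \<in> tri_free n"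
    and "weight n D (\<lambda>_. l) (relabel p G) = weight n D (\<lambda>_. l) G"
proof -
  have pp [simp]: "p (p x) = x" for x by (simp add: p_def)
  have pp' [simp]: "p ` p ` e = e" for e by (simp add: image_image)
  have pn [simp]: "p x < n \<longleftrightarrow> x < n" for x using ij by (auto simp: p_def Transposition.transpose_def)
  have inj: "inj p" by (metis injI pp)
  have mem: "e \<in> relabel p G \<longleftrightarrow> p ` e \<in> G" for e G
    unfolding relabel_def by (metis (no_types, lifting) image_iff pp')
  show "relabel p (relabel p G) = G" by (auto simp: mem)
  show "e \<in> relabel p G \<longleftrightarrow> p ` e \<in> G" by (rule mem)
  have edge: "p ` e \<in> edges n \<longleftrightarrow> e \<in> edges n" for e
  proof
    assume "p ` e \<in> edges n"
    then obtain x y where "p ` e = {x, y}" "x < n" "y < n" "x \<noteq> y" by (auto elim!: nsets2_E)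
    then have "e = {p x, p y}" "p x \<noteq> p y" "p x < n" "p y < n"
      using pp'[of e] inj by (auto dest: injD)
    then show "e \<in> edges n" by simp
  next
    assume "e \<in> edges n"
    then obtain x y where "e = {x, y}" "x < n" "y < n" "x \<noteq> y" by (auto elim!: nsets2_E)
    then show "p ` e \<in> edges n" using inj by (auto dest: injD)
  qed
  show "relabel p G \<in> tri_free n" if "G \<in> tri_free n"
    using that edge unfolding tri_free_iff by (auto simp: mem subset_iff)
  have inj': "inj_on (\<lambda>e. p ` e) A" for A using inj by (auto simp: inj_on_def inj_image_eq_iff)
  have deg: "degree (relabel p G) v = degree G (p v)" for v
  proof -
    have "{e \<in> relabel p G. v \<in> e} = (\<lambda>e. p ` e) ` {e \<in> G. p v \<in> e}"
      unfolding relabel_def by (auto simp: image_iff) (metis pp)+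
    then show ?thesis by (simp add: degree_def card_image[OF inj'])
  qed
  have "(\<Prod>v<n. \<Prod>i<degree G (p v). penalty D i) = (\<Prod>v<n. \<Prod>i<degree G v. penalty D i)"
    by (rule prod.reindex_bij_witness[where i = p and j = p]) auto
  then show "weight n D (\<lambda>_. l) (relabel p G) = weight n D (\<lambda>_. l) G"
    by (simp add: weight_def deg) (simp add: relabel_def card_image[OF inj'])
qed

lemma edge_probability_transpose:
  assumes "i < n" "j < n"
  shows "wmean (tri_free n) (weight n D (\<lambda>_. l)) (\<lambda>G. of_bool (Transposition.transpose i j ` e \<in> G))
    = wmean (tri_free n) (weight n D (\<lambda>_. l)) (\<lambda>G. of_bool (e \<in> G))"
proof -
  note r = relabel_weight[OF assms]
  have "(\<Sum>G\<in>tri_free n. weight n D (\<lambda>_. l) G * of_bool (Transposition.transpose i j ` e \<in> G))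
    = (\<Sum>G\<in>tri_free n. weight n D (\<lambda>_. l) G * of_bool (e \<in> G))"
    by (rule sum.reindex_bij_witness[where i = "relabel (Transposition.transpose i j)"
          and j = "relabel (Transposition.transpose i j)"])
       (auto simp: r(1,3,4) r(2))
  then show ?thesis by (simp add: wmean_def)
qed

text \<open>Two transpositions carry \<open>e\<close> to \<open>e'\<close>: one moves
  \<open>x\<close> to \<open>x'\<close>, the next moves the image \<open>w\<close> of
  \<open>y\<close> to \<open>y'\<close> and fixes \<open>x'\<close>, which differs from both
  \<open>w\<close> and \<open>y'\<close>.\<close>

lemma edge_probability_eq:
  assumes "e \<in> edges n" "e' \<in> edges n"
  shows "wmean (tri_free n) (weight n D (\<lambda>_. l)) (\<lambda>G. of_bool (e \<in> G))
    = wmean (tri_free n) (weight n D (\<lambda>_. l)) (\<lambda>G. of_bool (e' \<in> G))"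
proof -
  obtain x y where e: "e = {x, y}" "x < n" "y < n" "x \<noteq> y" using assms(1) by (auto elim!: nsets2_E)
  obtain x' y' where e': "e' = {x', y'}" "x' < n" "y' < n" "x' \<noteq> y'" using assms(2)
      by (auto elim!: nsets2_E)
  define w where "w = Transposition.transpose x x' y"
  have w: "w < n" "w \<noteq> x'" using e e' by (auto simp: w_def Transposition.transpose_def)
  have 1: "Transposition.transpose x x' ` e = {x', w}" by (simp add: e w_def)
  have 2: "Transposition.transpose w y' ` {x', w}
      = e'" using w e' by (simp add: Transposition.transpose_def)
  show ?thesis
    using edge_probability_transpose[of x n x' D l e] edge_probability_transpose[of w n y' D l
        "{x', w}"]
      e e' w unfolding 1 2 by simp
qed

definition cut_sign :: "nat set \<Rightarrow> nat set \<Rightarrow> real" where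
  "cut_sign S e = (if e \<inter> S \<noteq> {} \<and> e - S \<noteq> {} then 1 / 2 else - 1 / 2)"

lemma sum_cut_sign:
  assumes "finite G"
  shows "(\<Sum>e\<in>G. cut_sign S e) = real (card (cut_edges G S)) - real (card G) / 2"
proof -
  have "(\<Sum>e\<in>G. cut_sign S e) = (\<Sum>e\<in>G. of_bool (e \<inter> S \<noteq> {} \<and> e - S \<noteq> {}) - 1 / 2)"
    by (intro sum.cong) (auto simp: cut_sign_def)
  also have "\<dots> = real (card (cut_edges G S)) - real (card G) / 2"
    using assms by (simp add: sum_subtractf cut_edges_def of_bool_def sum.If_cases Int_def)
  finally show ?thesis .
qed

text \<open>All edges have the same probability \<open>q\<close>, so the mean is \<open>q\<close>
  times the excess of the cut over half of the edges in the complete graph. That excess is at most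
  \<open>n ^ 2 / 4 - n * (n - 1) / 4 = n / 4\<close>.\<close>

lemma wmean_cut_sign_le:
  assumes D: "D > 0" and l: "l > 0" and S: "S \<subseteq> {..<n}"
  shows "wmean (tri_free n) (weight n D (\<lambda>_. l)) (\<lambda>G. \<Sum>e\<in>G. cut_sign S e) \<le> real n / 4"
proof (cases "edges n = {}")
  case True
  then have "tri_free n = {{}}" using tri_free_edges empty_tri_free by blast
  then show ?thesis by (simp add: wmean_def)
next
  case False
  then obtain e0 where e0: "e0 \<in> edges n" by blast
  interpret birth_death "edges n" "tri_free n" "rate n D (\<lambda>_. l)" "weight n D (\<lambda>_. l)"
    using D l by (intro birth_death_tri_free)
  let ?W = "weight n D (\<lambda>_. l)"
  define q where "q = wmean (tri_free n) ?W (\<lambda>G. of_bool (e0 \<in> G))"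
  have "q \<ge> wmean (tri_free n) ?W (\<lambda>_. 0)" unfolding q_def by (rule wmean_mono) simp
  then have q0: "q \<ge> 0" by (simp add: wmean_const)
  have "q \<le> wmean (tri_free n) ?W (\<lambda>_. 1)" unfolding q_def by (rule wmean_mono) simp
  then have q1: "q \<le> 1" by (simp add: wmean_const)
  have "(\<Sum>G\<in>tri_free n. ?W G * (\<Sum>e\<in>G. cut_sign S e))
      = (\<Sum>G\<in>tri_free n. \<Sum>e\<in>edges n. cut_sign S e * (?W G * of_bool (e \<in> G)))"
  proof (rule sum.cong[OF refl])
    fix G assume "G \<in> tri_free n"
    then have "G \<subseteq> edges n" by (rule tri_free_edges)
    then have "(\<Sum>e\<in>G. cut_sign S e) = (\<Sum>e\<in>edges n. cut_sign S e * of_bool (e \<in> G))"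
      by (simp add: of_bool_def if_distrib sum.If_cases Int_absorb1 cong: if_cong)
    then show "?W G * (\<Sum>e\<in>G. cut_sign S e) = (\<Sum>e\<in>edges n. cut_sign S e * (?W G * of_bool (e \<in> G)))"
      by (simp only: sum_distrib_left mult.left_commute)
  qed
  also have "\<dots> = (\<Sum>e\<in>edges n. cut_sign S e * (\<Sum>G\<in>tri_free n. ?W G * of_bool (e \<in> G)))"
    by (subst sum.swap) (simp only: sum_distrib_left)
  finally have "wmean (tri_free n) ?W (\<lambda>G. \<Sum>e\<in>G. cut_sign S e)
      = (\<Sum>e\<in>edges n. cut_sign S e * wmean (tri_free n) ?W (\<lambda>G. of_bool (e \<in> G)))"
    unfolding wmean_def times_divide_eq_right by (simp only: sum_divide_distrib[symmetric])
  also have "\<dots> = (\<Sum>e\<in>edges n. cut_sign S e * q)"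
    unfolding q_def using e0 by (intro sum.cong refl arg_cong2[where f = "(*)"] edge_probability_eq)
  also have "\<dots> = q * (real (card S * (n - card S)) - real n * (real n - 1) / 4)"
    unfolding sum_distrib_right[symmetric] sum_cut_sign[OF finite_edges]
        card_cut_edges_complete[OF S]
      card_edges_real by simp
  also have "\<dots> \<le> 1 * (real n / 4)"
  proof -
    have "card S \<le> n" using card_mono[OF _ S] by simp
    then have "real (card S * (n - card S)) = real (card S) * (real n - real (card S))"
      by (simp add: of_nat_diff)
    moreover have "4 * (real (card S) * (real n - real (card S))) \<le> (real n)\<^sup>2"
      using zero_le_power2[of "real n - 2 * real (card S)"]
          by (simp add: power2_eq_square algebra_simps)
    ultimately have "real (card S * (n - card S)) - real n * (real n - 1) / 4 \<le> real n / 4"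
      by (simp add: power2_eq_square field_simps)
    then have "q * (real (card S * (n - card S)) - real n * (real n - 1) / 4) \<le> q * (real n / 4)"
      using q0 by (rule mult_left_mono)
    also have "\<dots> \<le> 1 * (real n / 4)" using q1 by (intro mult_right_mono) auto
    finally show ?thesis .
  qed
  finally show ?thesis by simp
qed

section \<open>Rarity of large degrees, and removal of the penalty\<close>

lemma sum_supersets_le:
  assumes l: "l > 0"
  shows "(\<Sum>G\<in>tri_free n \<inter> {G. A \<subseteq> G}. l ^ card G)
      \<le> l ^ card A * (\<Sum>G\<in>tri_free n. (l::real) ^ card G)"
proof -
  have "(\<Sum>G\<in>tri_free n \<inter> {G. A \<subseteq> G}. l ^ card G)
      = (\<Sum>G\<in>tri_free n \<inter> {G. A \<subseteq> G}. l ^ card A * l ^ card (G - A))"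
  proof (rule sum.cong[OF refl])
    fix G assume G: "G \<in> tri_free n \<inter> {G. A \<subseteq> G}"
    then have "finite G" using finite_tri_free_member by auto
    then have "card G = card A + card (G - A)"
      using G by (auto simp: card_Diff_subset finite_subset card_mono)
    then show "l ^ card G = l ^ card A * l ^ card (G - A)" by (simp add: power_add)
  qed
  \<comment> \<open>Deleting \<open>A\<close> is injective on the graphs that contain
    \<open>A\<close> and preserves triangle-freeness; hence every prescribed edge costs a factor of
    at most \<open>l\<close>.\<close>
  also have "\<dots> = l ^ card A * (\<Sum>H\<in>(\<lambda>G. G - A) ` (tri_free n \<inter> {G. A \<subseteq> G}). l ^ card H)"
    by (subst sum.reindex) (auto simp: inj_on_def sum_distrib_left)
  also have "\<dots> \<le> l ^ card A * (\<Sum>G\<in>tri_free n. l ^ card G)"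
    using l by (intro mult_left_mono sum_mono2) (auto intro: tri_free_mono)
  finally show ?thesis .
qed

text \<open>The moment of \<open>3 ^ degree G v\<close> is bounded as for independent edges by
  \<open>exp (2 * l * n)\<close>, at most \<open>exp (sqrt n / 16)\<close>, because prescribed edges
  cost at most \<open>l\<close> each. The base \<open>3\<close> serves as an upper bound for
  \<open>exp 1\<close>.\<close>

lemma gibbs_degree_tail:
  assumes n: "n > 0" and l: "0 < l" "l \<le> 1 / (32 * sqrt n)"
  shows "gibbs n l {G. real (degree G v) > sqrt n} \<le> exp (- sqrt n / 2)"
proof -
  define D where "D = sqrt n"
  have D: "D > 0" "D * D = real n" using n by (auto simp: D_def)
  define Z where "Z = (\<Sum>G\<in>tri_free n. l ^ card G)"
  have Z: "Z > 0" unfolding Z_def using l by (simp add: partition_pos)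
  define star where "star = {e \<in> edges n. v \<in> e}"
  have fin: "finite star" by (simp add: star_def)
  have "star \<subseteq> (\<lambda>w. {v, w}) ` {..<n}"
    unfolding star_def by (auto elim!: nsets2_E)
  then have "card star \<le> card ((\<lambda>w. {v, w}) ` {..<n})" by (intro card_mono) auto
  also have "\<dots> \<le> n" using card_image_le[of "{..<n}" "\<lambda>w. {v, w}"] by simp
  finally have star: "card star \<le> n" .
  have "(\<Sum>G\<in>tri_free n \<inter> {G. real (degree G v) > D}. l ^ card G)
      \<le> (\<Sum>G\<in>tri_free n \<inter> {G. real (degree G v) > D}. exp (- D) * (l ^ card G * 3 ^ degree G v))"
  proof (rule sum_mono)
    fix G assume G: "G \<in> tri_free n \<inter> {G. real (degree G v) > D}"
    have "exp D \<le> exp (real (degree G v))" using G by simp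
    also have "\<dots> = exp 1 ^ degree G v" by (simp add: exp_of_nat_mult[symmetric])
    also have "\<dots> \<le> 3 ^ degree G v" using exp_le by (intro power_mono) auto
    finally have "1 \<le> exp (- D) * 3 ^ degree G v" by (simp add: exp_minus field_simps)
    then have "l ^ card G * 1 \<le> l ^ card G * (exp (- D) * 3 ^ degree G v)"
      using l by (intro mult_left_mono) auto
    then show "l ^ card G \<le> exp (- D) * (l ^ card G * 3 ^ degree G v)" by (simp add: mult_ac)
  qed
  also have "\<dots> \<le> (\<Sum>G\<in>tri_free n. exp (- D) * (l ^ card G * 3 ^ degree G v))"
    using l by (intro sum_mono2) auto
  also have "\<dots> = exp (- D) * (\<Sum>G\<in>tri_free n. l ^ card G * 3 ^ degree G v)"
    by (simp add: sum_distrib_left)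
  also have "(\<Sum>G\<in>tri_free n. l ^ card G * 3 ^ degree G v)
      = (\<Sum>G\<in>tri_free n. \<Sum>A\<in>Pow star. if A \<subseteq> G then l ^ card G * 2 ^ card A else 0)"
  proof (rule sum.cong[OF refl])
    fix G assume G: "G \<in> tri_free n"
    then have sub: "{e \<in> G. v \<in> e} = star \<inter> G" using tri_free_edges by (auto simp: star_def)
    \<comment> \<open>Writing \<open>3 = 1 + 2\<close> and expanding over the sets \<open>A\<close>
      of edges at \<open>v\<close> contained in \<open>G\<close> brings in
      \<open>sum_supersets_le\<close>.\<close>
    have "3 ^ degree G v = (\<Sum>A\<in>Pow (star \<inter> G). 2 ^ card A :: real)"
      using sum_subsets_prod[of "star \<inter> G" "\<lambda>_. 2"] fin by (simp add: degree_def sub)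
    also have "\<dots> = (\<Sum>A\<in>Pow star. if A \<subseteq> G then 2 ^ card A else 0)"
      using fin by (simp add: sum.If_cases) (rule arg_cong2[where f = sum], auto)
    finally show "l ^ card G * 3 ^ degree G v
        = (\<Sum>A\<in>Pow star. if A \<subseteq> G then l ^ card G * 2 ^ card A else 0)"
      by (simp add: sum_distrib_left if_distrib cong: if_cong)
  qed
  also have "\<dots> = (\<Sum>A\<in>Pow star. \<Sum>G\<in>tri_free n. if A \<subseteq> G then l ^ card G * 2 ^ card A else 0)"
    by (rule sum.swap)
  also have "\<dots> = (\<Sum>A\<in>Pow star. 2 ^ card A * (\<Sum>G\<in>tri_free n \<inter> {G. A \<subseteq> G}. l ^ card G))"
    by (simp add: sum.If_cases sum_distrib_left mult.commute)
  also have "\<dots> \<le> (\<Sum>A\<in>Pow star. 2 ^ card A * (l ^ card A * Z))"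
    unfolding Z_def using l by (intro sum_mono mult_left_mono sum_supersets_le) auto
  also have "\<dots> = (\<Sum>A\<in>Pow star. (2 * l) ^ card A) * Z"
    unfolding sum_distrib_right by (intro sum.cong) (auto simp: power_mult_distrib)
  also have "\<dots> \<le> exp (2 * l * real (card star)) * Z"
    using l Z fin by (intro mult_right_mono sum_subsets_power_le_exp) auto
  also have "\<dots> \<le> exp (D / 2) * Z"
  proof -
    have "2 * l * real (card star) \<le> 2 * (1 / (32 * D)) * real n"
      using l star by (intro mult_mono) (auto simp: D_def)
    also have "\<dots> = D / 16" using D by (simp add: D(2)[symmetric])
    finally show ?thesis using Z D by (intro mult_right_mono) auto
  qed
  finally have "(\<Sum>G\<in>tri_free n \<inter> {G. real (degree G v) > D}. l ^ card G)
      \<le> exp (- D) * (exp (D / 2) * Z)"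
    by (simp add: mult_left_mono)
  also have "\<dots> = exp (- D / 2) * Z" by (simp add: mult.assoc[symmetric] exp_add[symmetric])
  finally show ?thesis
    unfolding gibbs_def using Z by (simp add: Z_def D_def pos_divide_le_eq)
qed

lemma weight_le: "D > 0 \<Longrightarrow> l > 0 \<Longrightarrow> weight n D (\<lambda>_. l) G \<le> l ^ card G"
  unfolding weight_def
  by (simp add: mult_left_le prod_nonneg prod_le_1 penalty_le_1 less_imp_le[OF penalty_pos])

lemma weight_eq:
  assumes "D > 0" "\<And>v. v < n \<Longrightarrow> real (degree G v) \<le> D"
  shows "weight n D (\<lambda>_. l) G = l ^ card G"
proof -
  have "(\<Prod>i<degree G v. penalty D i) = 1" if "v < n" for v
    using assms(2)[OF that] by (intro prod.neutral ballI penalty_eq_1 assms(1)) simp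
  then show ?thesis by (simp add: weight_def)
qed

text \<open>Both weights agree on graphs with all degrees at most \<open>sqrt n\<close>. Elsewhere
  the penalised weight is the smaller one, so replacing the normalising sum by the penalised one
  only increases the quotient. The last term is the probability of a large degree.\<close>

lemma gibbs_le_weight:
  assumes n: "n > 0" and l: "0 < l" "l \<le> 1 / (32 * sqrt n)"
  defines "W \<equiv> weight n (sqrt n) (\<lambda>_. l)"
  shows "gibbs n l A \<le> (\<Sum>G\<in>tri_free n \<inter> A. W G) / (\<Sum>G\<in>tri_free n. W G) + real n * exp (- sqrt n
      / 2)"
proof -
  define D where "D = sqrt n"
  have D: "D > 0" using n by (auto simp: D_def)
  interpret birth_death "edges n" "tri_free n" "rate n D (\<lambda>_. l)" W
    unfolding W_def D_def[symmetric] using D l by (intro birth_death_tri_free)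
  define bad where "bad = (\<Union>v<n. {G. real (degree G v) > D})"
  define Z where "Z = (\<Sum>G\<in>tri_free n. l ^ card G)"
  have Z: "Z > 0" unfolding Z_def using l by (simp add: partition_pos)
  have "gibbs n l A \<le> gibbs n l ((A - bad) \<union> bad)" using l by (intro gibbs_mono) auto
  also have "\<dots> \<le> gibbs n l (A - bad) + gibbs n l bad" using l by (intro gibbs_Un) auto
  also have "gibbs n l (A - bad) \<le> (\<Sum>G\<in>tri_free n \<inter> A. W G) / (\<Sum>G\<in>tri_free n. W G)"
  proof -
    have "(\<Sum>G\<in>tri_free n \<inter> (A - bad). l ^ card G) = (\<Sum>G\<in>tri_free n \<inter> (A - bad). W G)"
      unfolding W_def D_def[symmetric] bad_def using D
          by (intro sum.cong weight_eq[symmetric]) (auto simp: not_less)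
    also have "\<dots> \<le> (\<Sum>G\<in>tri_free n \<inter> A. W G)"
      using W_pos by (intro sum_mono2) (auto intro: less_imp_le)
    finally have "gibbs n l (A - bad) \<le> (\<Sum>G\<in>tri_free n \<inter> A. W G) / Z"
      unfolding gibbs_def using Z by (simp add: Z_def divide_right_mono)
    also have "\<dots> \<le> (\<Sum>G\<in>tri_free n \<inter> A. W G) / (\<Sum>G\<in>tri_free n. W G)"
      using total_pos Z W_pos D l unfolding Z_def
      by (intro divide_left_mono sum_mono sum_nonneg mult_pos_pos)
         (auto simp: W_def D_def[symmetric] intro: weight_le less_imp_le)
    finally show ?thesis .
  qed
  also have "gibbs n l bad \<le> (\<Sum>v<n. gibbs n l {G. real (degree G v) > D})"
    unfolding bad_def using l by (intro gibbs_le_UN) auto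
  also have "\<dots> \<le> (\<Sum>v<n. exp (- sqrt n / 2))"
    unfolding D_def using n l by (intro sum_mono gibbs_degree_tail)
  finally show ?thesis by simp
qed

lemma max_cut_witness: "\<exists>S\<subseteq>{..<n}. max_cut n G = card (cut_edges G S)"
proof -
  have "max_cut n G \<in> (\<lambda>S. card (cut_edges G S)) ` Pow {..<n}"
    unfolding max_cut_def by (intro Max_in) auto
  then show ?thesis by auto
qed

lemma card_cut_le_max_cut: "S \<subseteq> {..<n} \<Longrightarrow> card (cut_edges G S) \<le> max_cut n G"
  unfolding max_cut_def by (intro Max_ge) auto

text \<open>The first term removes graphs with few edges. In any other graph, a cut with share
  \<open>1/2 + eps\<close> exceeds half of the edges by at least \<open>eps * l * N / 8\<close>, to
  which the tail bound is applied for each of the \<open>2 ^ n\<close> sets.\<close>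

lemma gibbs_max_cut_small:
  assumes n: "n > 0" and l: "0 < l" "l \<le> 1 / (32 * sqrt n)" and eps: "0 < eps" "eps \<le> 1"
  defines "N \<equiv> real (card (edges n))"
  shows "gibbs n l {G. MC n G \<ge> 1 / 2 + eps}
    \<le> exp (1 - l * (real n)\<^sup>2 / 40)
      + (2 ^ n * exp (- (eps / 96) * (eps * l * N / 16 - real n / 4)) + real n * exp (- sqrt n
          / 2))"
proof -
  have "1 / (32 * sqrt n) \<le> 1 / (32 * 1)" using n by (intro divide_left_mono mult_left_mono) auto
  then have l': "l \<le> 1 / 10" using l by simp
  define D where "D = sqrt n"
  have D: "D > 0" using n by (auto simp: D_def)
  define W where "W = weight n D (\<lambda>_. l)"
  interpret birth_death "edges n" "tri_free n" "rate n D (\<lambda>_. l)" W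
    unfolding W_def using D l by (intro birth_death_tri_free)
  define Z where "Z = (\<Sum>G\<in>tri_free n. W G)"
  have Z: "Z > 0" unfolding Z_def by (rule total_pos)
  define few where "few = {G::nat set set. real (card G) \<le> l * N / 8}"
  define x where "x = eps * l * N / 8"
  define T where "T = (\<lambda>S. {G. (\<Sum>e\<in>G. cut_sign S e) \<ge> x})"
  \<comment> \<open>With this choice the correction \<open>6 * l * t * N\<close> is exactly half of
    \<open>x\<close>.\<close>
  define t where "t = eps / 96"
  have t: "0 \<le> t" "t \<le> 1" using eps by (auto simp: t_def)
  define A where "A = (\<Union>S\<in>Pow {..<n}. T S)"
  have tail: "(\<Sum>G\<in>tri_free n \<inter> T S. W G) \<le> exp (- t * (eps * l * N / 16 - real n / 4)) * Z" if "S
      \<subseteq> {..<n}" for S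
  proof -
    have "(\<Sum>G\<in>tri_free n \<inter> T S. W G)
        \<le> exp (- t * (x - wmean (tri_free n) W (\<lambda>G. \<Sum>e\<in>G. cut_sign S e) - 6 * l * t * N)) * Z"
      unfolding T_def W_def D_def Z_def N_def using n l t
          by (intro weight_tail) (auto simp: cut_sign_def)
    also have "\<dots> \<le> exp (- t * (eps * l * N / 16 - real n / 4)) * Z"
    proof -
      have "wmean (tri_free n) W (\<lambda>G. \<Sum>e\<in>G. cut_sign S e) \<le> real n / 4"
        unfolding W_def using D l(1) that by (rule wmean_cut_sign_le)
      then have "eps * l * N / 16 - real n / 4
          \<le> x - wmean (tri_free n) W (\<lambda>G. \<Sum>e\<in>G. cut_sign S e) - 6 * l * t * N"
        by (simp add: x_def t_def field_simps)
      then show ?thesis using t Z by (simp add: mult_left_mono)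
    qed
    finally show ?thesis .
  qed
  have "tri_free n \<inter> {G. MC n G \<ge> 1 / 2 + eps} \<subseteq> few \<union> A"
  proof
    fix G assume G: "G \<in> tri_free n \<inter> {G. MC n G \<ge> 1 / 2 + eps}"
    then have fin: "finite G" using finite_tri_free_member by auto
    have ne: "G \<noteq> {}" using G eps by (auto simp: MC_def)
    obtain S where S: "S \<subseteq> {..<n}" "max_cut n G
        = card (cut_edges G S)" using max_cut_witness by blast
    have "1 / 2 + eps \<le> real (card (cut_edges G S)) / real (card G)"
      using G ne S by (simp add: MC_def)
    then have "(1 / 2 + eps) * real (card G) \<le> real (card (cut_edges G S))"
      using ne fin by (simp add: pos_le_divide_eq card_gt_0_iff)
    then have f: "(\<Sum>e\<in>G. cut_sign S e) \<ge> eps * real (card G)"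
      by (simp add: sum_cut_sign[OF fin] algebra_simps)
    show "G \<in> few \<union> A"
    proof (cases "G \<in> few")
      case False
      then have "eps * (l * N / 8) \<le> eps * real (card G)" using eps
          by (intro mult_left_mono) (auto simp: few_def)
      then have "G \<in> T S" using f by (simp add: T_def x_def)
      then show ?thesis using S by (auto simp: A_def)
    qed simp
  qed
  then have "gibbs n l {G. MC n G \<ge> 1 / 2 + eps}
      \<le> gibbs n l (few \<union> A)" using l by (intro gibbs_mono)
  also have "\<dots> \<le> gibbs n l few + gibbs n l A" using l by (intro gibbs_Un)
  also have "gibbs n l few \<le> exp (1 - l * (real n)\<^sup>2 / 40)"
    unfolding few_def N_def using l l' by (intro gibbs_few_edges)
  also have "gibbs n l A \<le> (\<Sum>G\<in>tri_free n \<inter> A. W G) / Z + real n * exp (- sqrt n / 2)"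
    unfolding W_def Z_def D_def using n l by (rule gibbs_le_weight)
  also have "(\<Sum>G\<in>tri_free n \<inter> A. W G) \<le> (\<Sum>S\<in>Pow {..<n}. \<Sum>G\<in>tri_free n \<inter> T S. W G)"
    unfolding A_def Int_UN_distrib
    using D l by (intro sum_UN_le) (auto simp: W_def intro: less_imp_le weight_pos)
  also have "\<dots> \<le> (\<Sum>S\<in>Pow {..<n}. exp (- t * (eps * l * N / 16 - real n / 4)) * Z)"
    using tail by (intro sum_mono) auto
  also have "\<dots> = 2 ^ n * exp (- t * (eps * l * N / 16 - real n / 4)) * Z"
    by (simp add: card_Pow)
  finally show ?thesis using Z by (simp add: t_def divide_right_mono)
qed

subsection \<open>Containers for neighbourhoods at high density\<close>

definition inside :: "nat set set \<Rightarrow> nat set \<Rightarrow> nat set set" where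
  "inside G S = {e \<in> G. e \<subseteq> S}"

text \<open>Each edge inside \<open>A\<close> is seen from at least one of its ends, so the degrees
  within \<open>A\<close> add up to more than \<open>T\<close>, while \<open>A\<close> has at most
  \<open>n\<close> vertices.\<close>

lemma exists_large_degree:
  assumes H: "H \<subseteq> edges n" and A: "A \<subseteq> {..<n}" and T: "0 \<le> T" "T < real (card (inside H A))"
  shows "\<exists>v\<in>A. T / real n \<le> real (card {w \<in> A. {v, w} \<in> H})"
proof (rule ccontr)
  assume *: "\<not> ?thesis"
  have finA: "finite A" using A finite_subset by blast
  have "inside H A \<subseteq> (\<lambda>(v, w). {v, w}) ` (SIGMA v:A. {w \<in> A. {v, w} \<in> H})"
  proof
    fix e assume e: "e \<in> inside H A"
    then obtain v w where "e = {v, w}" using H by (auto simp: inside_def elim!: nsets2_E)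
    then show "e \<in> (\<lambda>(v, w). {v, w}) ` (SIGMA v:A. {w \<in> A. {v, w} \<in> H})"
      using e by (force simp: inside_def)
  qed
  then have "card (inside H A) \<le> card (SIGMA v:A. {w \<in> A. {v, w} \<in> H})"
    using finA by (intro surj_card_le finite_SigmaI) auto
  also have "\<dots> = (\<Sum>v\<in>A. card {w \<in> A. {v, w} \<in> H})" using finA by (subst card_SigmaI) auto
  finally have "T < (\<Sum>v\<in>A. real (card {w \<in> A. {v, w} \<in> H}))"
    using T by (simp flip: of_nat_sum)
  also have "\<dots> \<le> (\<Sum>v\<in>A. T / real n)" using *
      by (intro sum_mono) (auto simp: not_le intro: less_imp_le)
  also have "\<dots> = real (card A) / real n * T" by simp
  also have "\<dots> \<le> T"
  proof -
    have "card A \<le> n" using card_mono[OF _ A] by simp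
    then have "real (card A) / real n \<le> 1" by (cases "n = 0") auto
    then show ?thesis using mult_right_mono[OF _ T(1), of "real (card A) / real n" 1] by simp
  qed
  finally show False by simp
qed

text \<open>The Kleitman--Winston algorithm: vertices of large degree in the set of remaining vertices are
  queried in turn, and the fingerprint records the positive answers.\<close>

lemma graph_containers_aux:
  assumes H: "H \<subseteq> edges n" and A: "A \<subseteq> {..<n}" and T: "T \<ge> 0"
  shows "\<exists>C. \<forall>I\<subseteq>A. inside H I = {} \<longrightarrow> (\<exists>F\<subseteq>I. real (card F) * (T / real n) \<le> real (card A)
     \<and> I \<subseteq> F \<union> C F \<and> C F \<subseteq> A \<and> real (card (inside H (C F))) \<le> T)"
proof -
  have "finite A" using A finite_subset by blast
  then show ?thesis using A
  proof (induction A rule: finite_psubset_induct)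
    case (psubset A)
    show ?case
    proof (cases "real (card (inside H A)) \<le> T")
      case True
      then show ?thesis by (intro exI[of _ "\<lambda>_. A"]) (auto intro!: exI[of _ "{}"])
    next
      case False
      then obtain v where v: "v \<in> A" "T / real n \<le> real (card {w \<in> A. {v, w} \<in> H})"
        using exists_large_degree[OF H psubset.prems T] by auto
      define N where "N = {w \<in> A. {v, w} \<in> H}"
      have vN: "v \<notin> N" using H by (auto simp: N_def nsets_def)
      define A1 where "A1 = A - {v} - N"
      define A2 where "A2 = A - {v}"
      have "A1 \<subset> A" "A2 \<subset> A" using v by (auto simp: A1_def A2_def)
      moreover have "A1 \<subseteq> {..<n}" "A2 \<subseteq> {..<n}" using psubset.prems by (auto simp: A1_def A2_def)
      ultimately obtain C1 C2 where
        C1: "\<And>I. I \<subseteq> A1 \<Longrightarrow> inside H I = {} \<Longrightarrow> \<exists>F\<subseteq>I. real (card F) * (T / real n) \<le> real (card A1)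
           \<and> I \<subseteq> F \<union> C1 F \<and> C1 F \<subseteq> A1 \<and> real (card (inside H (C1 F))) \<le> T"
        and C2: "\<And>I. I \<subseteq> A2 \<Longrightarrow> inside H I = {} \<Longrightarrow> \<exists>F\<subseteq>I. real (card F) * (T / real n) \<le> real (card A2)
           \<and> I \<subseteq> F \<union> C2 F \<and> C2 F \<subseteq> A2 \<and> real (card (inside H (C2 F))) \<le> T"
        using psubset.IH[of A1] psubset.IH[of A2] by metis
      \<comment> \<open>The container is a function of the fingerprint alone: membership of
        \<open>v\<close> in \<open>F\<close> reveals the answer to the query and hence the branch
        taken.\<close>
      define C where "C = (\<lambda>F. if v \<in> F then C1 (F - {v}) else C2 F)"
      have "\<exists>F\<subseteq>I. real (card F) * (T / real n) \<le> real (card A)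
         \<and> I \<subseteq> F \<union> C F \<and> C F \<subseteq> A \<and> real (card (inside H (C F))) \<le> T"
        if I: "I \<subseteq> A" "inside H I = {}" for I
      proof (cases "v \<in> I")
        case True
        have "I - {v} \<subseteq> A1"
        proof
          fix w assume w: "w \<in> I - {v}"
          then have "{v, w} \<subseteq> I" using True by auto
          then have "{v, w} \<notin> H" using I(2) by (auto simp: inside_def)
          then show "w \<in> A1" using w I by (auto simp: A1_def N_def)
        qed
        moreover have "inside H (I - {v}) = {}" using I by (auto simp: inside_def)
        ultimately obtain F where F: "F \<subseteq> I - {v}" "real (card F) * (T / real n) \<le> real (card A1)"
            "I - {v} \<subseteq> F \<union> C1 F" "C1 F \<subseteq> A1" "real (card (inside H (C1 F))) \<le> T"
          using C1 by meson
        have finF: "finite F" using F(1) I(1) psubset.hyps by (meson Diff_subset finite_subset)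
        have vF: "v \<notin> F" using F by auto
        \<comment> \<open>A positive answer discards all neighbours of \<open>v\<close>, at least
          \<open>T / n\<close> vertices; this bounds the size of the fingerprint.\<close>
        have "card A1 + card N \<le> card A"
        proof -
          have "card A1 + card N = card (A1 \<union> N)"
            using psubset.hyps by (intro card_Un_disjoint[symmetric]) (auto simp: A1_def N_def)
          also have "\<dots> \<le> card A" using psubset.hyps by (intro card_mono) (auto simp: A1_def N_def)
          finally show ?thesis .
        qed
        then have "real (card A1) + real (card N) \<le> real (card A)" by linarith
        moreover have "real (card (insert v F)) * (T / real n)
            = real (card F) * (T / real n) + T / real n"
          using finF vF by (simp add: algebra_simps add_divide_distrib)
        ultimately have "real (card (insert v F)) * (T / real n) \<le> real (card A)"
          using F(2) v(2) unfolding N_def by linarith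
        moreover have "C (insert v F) = C1 F" using vF by (simp add: C_def)
        ultimately show ?thesis
          using F True by (intro exI[of _ "insert v F"]) (auto simp: A1_def)
      next
        case False
        then have "I \<subseteq> A2" using I by (auto simp: A2_def)
        then obtain F where F: "F \<subseteq> I" "real (card F) * (T / real n) \<le> real (card A2)"
            "I \<subseteq> F \<union> C2 F" "C2 F \<subseteq> A2" "real (card (inside H (C2 F))) \<le> T"
          using C2 I by meson
        moreover have "C F = C2 F" using F False by (auto simp: C_def)
        moreover have "card A2 \<le> card A" using psubset.hyps by (intro card_mono) (auto simp: A2_def)
        ultimately show ?thesis by (intro exI[of _ F]) (auto simp: A2_def)
      qed
      then show ?thesis by (intro exI[of _ C]) blast
    qed
  qed
qed

lemma graph_containers:
  assumes "H \<subseteq> edges n" "T \<ge> 0"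
  obtains C where "\<And>I. I \<subseteq> {..<n} \<Longrightarrow> inside H I = {} \<Longrightarrow> \<exists>F\<subseteq>I. real (card F) * (T / real n) \<le> real n
     \<and> I \<subseteq> F \<union> C F \<and> C F \<subseteq> {..<n} \<and> real (card (inside H (C F))) \<le> T"
  using graph_containers_aux[OF assms(1) subset_refl assms(2)] by auto

section \<open>Volumes of sparse sets and the weight of a container pattern\<close>

lemma sum_edges_vertices:
  fixes g :: "nat \<Rightarrow> real"
  assumes G: "G \<subseteq> edges n"
  shows "(\<Sum>e\<in>G. \<Sum>u\<in>e. g u) = (\<Sum>u<n. real (degree G u) * g u)"
proof -
  have fin: "finite G" using finite_subset[OF G] by simp
  have "(\<Sum>e\<in>G. \<Sum>u\<in>e. g u) = (\<Sum>e\<in>G. \<Sum>u<n. of_bool (u \<in> e) * g u)"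
  proof (rule sum.cong[OF refl])
    fix e assume "e \<in> G"
    then have "e \<subseteq> {..<n}" using G edges_subset by auto
    then show "(\<Sum>u\<in>e. g u) = (\<Sum>u<n. of_bool (u \<in> e) * g u)"
      by (intro sum.mono_neutral_cong_left) auto
  qed
  also have "\<dots> = (\<Sum>u<n. \<Sum>e\<in>G. of_bool (u \<in> e) * g u)" by (rule sum.swap)
  also have "\<dots> = (\<Sum>u<n. real (degree G u) * g u)"
    unfolding sum_distrib_right[symmetric] using fin
    by (simp add: degree_def of_bool_def sum.If_cases Int_def)
  finally show ?thesis .
qed

lemma sum_degree_edges:
  assumes G: "G \<subseteq> edges n" and S: "S \<subseteq> {..<n}"
  shows "(\<Sum>u\<in>S. real (degree G u)) = (\<Sum>e\<in>G. real (card (e \<inter> S)))"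
proof -
  have fin: "finite G" "finite S" using finite_subset[OF G] finite_subset[OF S] by auto
  have "(\<Sum>u\<in>S. real (degree G u)) = (\<Sum>u\<in>S. \<Sum>e\<in>G. of_bool (u \<in> e))"
    using fin by (simp add: degree_def of_bool_def sum.If_cases Int_def)
  also have "\<dots> = (\<Sum>e\<in>G. \<Sum>u\<in>S. of_bool (u \<in> e))" by (rule sum.swap)
  also have "\<dots> = (\<Sum>e\<in>G. real (card (e \<inter> S)))"
    using fin by (simp add: of_bool_def sum.If_cases Int_def conj_commute)
  finally show ?thesis .
qed

text \<open>An edge inside \<open>S\<close> is counted twice and an edge leaving \<open>S\<close>
  once; the latter form a cut. For a sparse \<open>S\<close>, a small maximum cut thus keeps the
  volume near half of the edges or below.\<close>

lemma volume_le:
  assumes G: "G \<subseteq> edges n" and S: "S \<subseteq> {..<n}"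
  shows "(\<Sum>u\<in>S. real (degree G u)) \<le> 2 * real (card (inside G S)) + real (max_cut n G)"
proof -
  have fin: "finite G" using finite_subset[OF G] by simp
  have "(\<Sum>u\<in>S. real (degree G u)) \<le> (\<Sum>e\<in>G. 2 * of_bool (e \<subseteq> S) + of_bool (e \<inter> S \<noteq> {} \<and> e - S \<noteq> {}))"
    unfolding sum_degree_edges[OF G S]
  proof (rule sum_mono)
    fix e assume "e \<in> G"
    then have e: "card e = 2" "finite e" using G by (auto simp: nsets_def)
    have "card (e \<inter> S) \<le> 2" using e card_mono[of e "e \<inter> S"] by auto
    moreover have "card (e \<inter> S) < 2" if "e - S \<noteq> {}"
      using e that psubset_card_mono[of e "e \<inter> S"] by auto
    moreover have "card (e \<inter> S) = 0" if "e \<inter> S = {}" using that by simp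
    ultimately show "real (card (e \<inter> S)) \<le> 2 * of_bool (e \<subseteq> S) + of_bool (e \<inter> S \<noteq> {} \<and> e - S \<noteq> {})"
      by (cases "e - S = {}"; cases "e \<inter> S = {}") auto
  qed
  also have "\<dots> = 2 * real (card (inside G S)) + real (card (cut_edges G S))"
    using fin by (simp add: sum.distrib sum_distrib_left[symmetric] inside_def cut_edges_def
        of_bool_def
        sum.If_cases Int_def)
  also have "\<dots> \<le> 2 * real (card (inside G S)) + real (max_cut n G)"
    using card_cut_le_max_cut[OF S] by simp
  finally show ?thesis .
qed

text \<open>The quantifiers run over both orientations of \<open>e\<close>, so each endpoint has to
  lie in the container attached to the other.\<close>

definition allowed :: "nat \<Rightarrow> (nat \<Rightarrow> nat set) \<Rightarrow> nat set set" where
  "allowed n c = {e \<in> edges n. \<forall>u v. e = {u, v} \<longrightarrow> u \<in> c v}"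

definition occupancy :: "nat \<Rightarrow> (nat \<Rightarrow> nat set) \<Rightarrow> nat \<Rightarrow> real" where
  "occupancy n c u = real (card {v \<in> {..<n}. u \<in> c v}) / real n"

text \<open>\<open>K\<close> stands for the fingerprint edges. The inequality is the volume bound
  for the containers, averaged over all vertices; \<open>2/3\<close> is the volume share
  \<open>3/5\<close> divided by the share \<open>9/10\<close> of edges that remain outside
  \<open>H\<close>.\<close>

definition pattern :: "nat \<Rightarrow> (nat \<Rightarrow> nat set) \<Rightarrow> nat set set \<Rightarrow> nat set set set" where
  "pattern n c K = {G. K \<subseteq> G \<and> G \<subseteq> K \<union> allowed n c
     \<and> (\<Sum>e\<in>G. \<Sum>u\<in>e. occupancy n c u) \<le> 2 / 3 * real (card G)}"

text \<open>Both bounds rest on \<open>exp 1 \<le> 3\<close>, the first through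
  \<open>(29/20) ^ 3 > 3\<close>.\<close>

lemma exp_third_le: "exp (1 / 3 :: real) \<le> 29 / 20" "exp (4 / 3 :: real) \<le> 5"
proof -
  have "exp (1 / 3 :: real) ^ 3 = exp 1" by (simp add: exp_of_nat_mult[symmetric])
  also have "\<dots> \<le> (29 / 20) ^ 3" by (rule order_trans[OF exp_le]) (simp add: power3_eq_cube)
  finally show *: "exp (1 / 3 :: real) \<le> 29 / 20"
      by (rule power_le_imp_le_base[of _ 2, simplified]) (simp_all add: numeral_3_eq_3)
  have "exp (4 / 3 :: real) = exp (1 / 3) * exp 1" by (simp add: exp_add[symmetric])
  also have "\<dots> \<le> 29 / 20 * 3" using * exp_le by (intro mult_mono) auto
  finally show "exp (4 / 3 :: real) \<le> 5" by simp
qed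

text \<open>Exponential Markov inequality for the constraint in \<^const>\<open>pattern\<close>. The factor \<open>a exp (- 4 a)\<close>
  that arises per vertex of occupancy \<open>a\<close> is at most \<open>exp (- 1) / 4\<close>.\<close>

lemma pattern_sum_le:
  assumes n: "n > 0" and l: "l > 0" and K: "finite K"
  shows "(\<Sum>G\<in>pattern n c K. l ^ card G) \<le> (5 * l) ^ card K * exp (37 / 200 * l * (real n)\<^sup>2)"
proof -
  define a where "a = occupancy n c"
  define P where "P = allowed n c"
  have PE: "P \<subseteq> edges n" by (auto simp: P_def allowed_def)
  have finP: "finite P" using finite_subset[OF PE] by simp
  have a0: "a u \<ge> 0" for u by (simp add: a_def occupancy_def)
  \<comment> \<open>The Markov parameter \<open>2\<close> makes the estimate per vertex below tight
    at occupancy \<open>1/4\<close>, the share of endpoints that a sparse set would touch in the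
    ideal case.\<close>
  define z where "z = (\<lambda>e. l * exp (2 * (2 / 3 - (\<Sum>u\<in>e. a u))))"
  have z0: "z e \<ge> 0" for e using l by (simp add: z_def)
  have sub: "pattern n c K \<subseteq> {G. K \<subseteq> G \<and> G \<subseteq> K \<union> P}" by (auto simp: pattern_def P_def)
  have fin: "finite {G. K \<subseteq> G \<and> G \<subseteq> K \<union> P}"
    by (rule finite_subset[of _ "Pow (K \<union> P)"]) (use K finP in auto)
  have "(\<Sum>G\<in>pattern n c K. l ^ card G) \<le> (\<Sum>G\<in>pattern n c K. \<Prod>e\<in>G. z e)"
  proof (rule sum_mono)
    fix G assume G: "G \<in> pattern n c K"
    then have "G \<subseteq> K \<union> P" by (auto simp: pattern_def P_def)
    then have finG: "finite G" using K finP by (simp add: finite_subset)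
    have "(\<Prod>e\<in>G. z e) = l ^ card G * exp (\<Sum>e\<in>G. 2 * (2 / 3 - (\<Sum>u\<in>e. a u)))"
      using finG by (simp add: z_def prod.distrib exp_sum)
    moreover have "(\<Sum>e\<in>G. 2 * (2 / 3 - (\<Sum>u\<in>e. a u))) \<ge> 0"
      using G unfolding sum_distrib_left[symmetric] sum_subtractf
          by (simp add: pattern_def a_def mult.commute)
    ultimately show "l ^ card G \<le> (\<Prod>e\<in>G. z e)" using l by simp
  qed
  also have "\<dots> \<le> (\<Sum>G\<in>{G. K \<subseteq> G \<and> G \<subseteq> K \<union> P}. \<Prod>e\<in>G. z e)"
    using sub fin z0 by (intro sum_mono2) (auto intro: prod_nonneg)
  also have "\<dots> = (\<Sum>G\<in>{G. K \<subseteq> G \<and> G \<subseteq> K \<union> P}. (\<Prod>e\<in>K. z e) * (\<Prod>e\<in>G - K. z e))"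
  proof (rule sum.cong[OF refl])
    fix G assume "G \<in> {G. K \<subseteq> G \<and> G \<subseteq> K \<union> P}"
    then have "K \<subseteq> G" "G \<subseteq> K \<union> P" by auto
    moreover from this have "finite G" using K finP by (simp add: finite_subset)
    ultimately show "(\<Prod>e\<in>G. z e) = (\<Prod>e\<in>K. z e) * (\<Prod>e\<in>G - K. z e)"
      by (simp add: prod.subset_diff mult.commute)
  qed
  also have "\<dots> = (\<Prod>e\<in>K. z e) * (\<Sum>H\<in>(\<lambda>G. G - K) ` {G. K \<subseteq> G \<and> G \<subseteq> K \<union> P}. \<Prod>e\<in>H. z e)"
    by (subst sum.reindex) (auto simp: inj_on_def sum_distrib_left)
  also have "\<dots> \<le> (\<Prod>e\<in>K. z e) * (\<Sum>H\<in>Pow P. \<Prod>e\<in>H. z e)"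
    using z0 finP by (intro mult_left_mono sum_mono2 prod_nonneg) auto
  also have "\<dots> \<le> (5 * l) ^ card K * exp (37 / 200 * l * (real n)\<^sup>2)"
  proof (rule mult_mono)
    have "z e \<le> 5 * l" for e
    proof -
      have "exp (2 * (2 / 3 - (\<Sum>u\<in>e. a u))) \<le> exp (4 / 3)" using a0 by (simp add: sum_nonneg)
      also have "\<dots> \<le> 5" by (rule exp_third_le)
      finally show ?thesis using l by (simp add: z_def)
    qed
    then have "(\<Prod>e\<in>K. z e) \<le> (\<Prod>e\<in>K. 5 * l)" using z0 by (intro prod_mono) auto
    then show "(\<Prod>e\<in>K. z e) \<le> (5 * l) ^ card K" by simp
  next
    have "(\<Sum>e\<in>P. z e) \<le> (\<Sum>e\<in>P. \<Sum>u\<in>e. l / 2 * exp (4 / 3 - 4 * a u))"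
    proof (rule sum_mono)
      fix e assume "e \<in> P"
      then obtain u v where e: "e = {u, v}" "u \<noteq> v" using PE by (auto elim!: nsets2_E)
      \<comment> \<open>The inequality of arithmetic and geometric means separates the two
        endpoints, so the sum over allowed edges becomes a sum over vertices.\<close>
      define x y where "x = exp (2 / 3 - 2 * a u)" and "y = exp (2 / 3 - 2 * a v)"
      have "z e = l * (x * y)" using e
          by (simp add: z_def x_def y_def exp_add[symmetric] algebra_simps)
      also have "\<dots> \<le> l * ((x * x + y * y) / 2)"
        using l zero_le_power2[of "x - y"]
            by (intro mult_left_mono) (auto simp: power2_eq_square algebra_simps)
      also have "\<dots> = (\<Sum>u\<in>e. l / 2 * exp (4 / 3 - 4 * a u))"
        using e by (simp add: x_def y_def exp_add[symmetric] algebra_simps)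
      finally show "z e \<le> (\<Sum>u\<in>e. l / 2 * exp (4 / 3 - 4 * a u))" .
    qed
    also have "\<dots> = (\<Sum>u<n. real (degree P u) * (l / 2 * exp (4 / 3 - 4 * a u)))"
      by (rule sum_edges_vertices[OF PE])
    also have "\<dots> \<le> (\<Sum>u<n. 37 / 200 * l * real n)"
    proof (rule sum_mono)
      fix u assume "u \<in> {..<n}"
      \<comment> \<open>An allowed edge at \<open>u\<close> needs a partner \<open>v\<close> whose
        container holds \<open>u\<close>, so the allowed degree of \<open>u\<close> is at most
        \<open>n\<close> times its occupancy.\<close>
      have "{e \<in> P. u \<in> e} \<subseteq> (\<lambda>v. {u, v}) ` {v \<in> {..<n}. u \<in> c v}"
      proof
        fix e assume e: "e \<in> {e \<in> P. u \<in> e}"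
        then obtain x y where xy: "e = {x, y}" "x < n" "y < n" using PE by (auto elim!: nsets2_E)
        then obtain v where v: "e = {u, v}" "v < n" using e by (auto simp: insert_commute)
        then have "u \<in> c v" using e by (auto simp: P_def allowed_def)
        then show "e \<in> (\<lambda>v. {u, v}) ` {v \<in> {..<n}. u \<in> c v}" using v by auto
      qed
      then have "degree P u \<le> card {v \<in> {..<n}. u \<in> c v}"
        unfolding degree_def by (intro surj_card_le) auto
      then have "real (degree P u) \<le> real n * a u" using n by (simp add: a_def occupancy_def)
      then have "real (degree P u) * (l / 2 * exp (4 / 3 - 4 * a u))
          \<le> real n * a u * (l / 2 * exp (4 / 3 - 4 * a u))"
        using l by (intro mult_right_mono) auto
      also have "\<dots> = real n * l / 8 * exp (1 / 3) * (4 * a u * exp (1 - 4 * a u))"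
        by (simp add: exp_add[symmetric] exp_diff field_simps)
      also have "4 * a u * exp (1 - 4 * a u) \<le> 1"
      proof -
        have "4 * a u \<le> exp (4 * a u - 1)" using exp_ge_add_one_self[of "4 * a u - 1"] by simp
        then have "4 * a u * exp (1 - 4 * a u) \<le> exp (4 * a u - 1) * exp (1 - 4 * a u)"
          by (intro mult_right_mono) auto
        then show ?thesis by (simp add: exp_add[symmetric])
      qed
      also have "real n * l / 8 * exp (1 / 3) \<le> real n * l / 8 * (29 / 20)"
        using l exp_third_le by (intro mult_left_mono) auto
      finally have "real (degree P u) * (l / 2 * exp (4 / 3 - 4 * a u))
          \<le> real n * l / 8 * (29 / 20)"
        using l by (simp add: mult_left_mono)
      then show "real (degree P u) * (l / 2 * exp (4 / 3 - 4 * a u)) \<le> 37 / 200 * l * real n"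
        using l by (simp add: field_simps)
    qed
    also have "\<dots> = 37 / 200 * l * (real n)\<^sup>2" by (simp add: power2_eq_square)
    finally have "(\<Sum>e\<in>P. z e) \<le> 37 / 200 * l * (real n)\<^sup>2" .
    then show "(\<Sum>H\<in>Pow P. \<Prod>e\<in>H. z e) \<le> exp (37 / 200 * l * (real n)\<^sup>2)"
      using sum_subsets_prod_le_exp[OF finP, of z] z0 by (meson exp_le_cancel_iff order_trans)
  qed (use z0 l in \<open>auto intro: sum_nonneg prod_nonneg\<close>)
  finally show ?thesis .
qed


text \<open>Recovers the fingerprint at \<open>v\<close>: edges in \<open>K1\<close> were chosen at
  their smaller endpoint, edges in \<open>K2\<close> at their larger one.\<close>

definition decode :: "nat set set \<Rightarrow> nat set set \<Rightarrow> nat \<Rightarrow> nat set" where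
  "decode K1 K2 v = {w. v < w \<and> {v, w} \<in> K1 \<or> w < v \<and> {v, w} \<in> K2}"

text \<open>The last clause carries sparsity from the sample to the graph: containers are sparse
  with respect to \<open>H\<close>, whereas \<open>volume_le\<close> counts the edges of
  \<open>G\<close>.\<close>

definition good_split :: "nat \<Rightarrow> real \<Rightarrow> nat set set \<Rightarrow> nat set set \<Rightarrow> bool" where
  "good_split n T G H \<longleftrightarrow> H \<subseteq> G \<and> real (card H) \<le> real (card G) / 10
     \<and> (\<forall>S\<subseteq>{..<n}. real (card (inside H S)) \<le> T \<longrightarrow> real (card (inside G S)) \<le> real (card G) / 40)"

text \<open>The two sets \<open>K1\<close>, \<open>K2\<close> of fingerprint edges record at which endpoint an edge was chosen.\<close>

lemma pattern_cover:
  assumes n: "n > 0" and T: "T \<ge> 0" and G: "G \<in> tri_free n" and good: "good_split n T G H"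
    and cut: "real (max_cut n G) \<le> 11 / 20 * real (card G)"
    and C: "\<And>I. I \<subseteq> {..<n} \<Longrightarrow> inside H I = {} \<Longrightarrow> \<exists>F\<subseteq>I. real (card F) * (T / real n) \<le> real n
     \<and> I \<subseteq> F \<union> C F \<and> C F \<subseteq> {..<n} \<and> real (card (inside H (C F))) \<le> T"
  shows "\<exists>K K1 K2. K1 \<subseteq> K \<and> K2 \<subseteq> K \<and> K \<subseteq> edges n \<and> real (card K) * (T / real n) \<le> real n * real n
     \<and> G - H \<in> pattern n (\<lambda>v. C (decode K1 K2 v)) K"
proof -
  have GE: "G \<subseteq> edges n" using G by (rule tri_free_edges)
  have HG: "H \<subseteq> G" using good by (simp add: good_split_def)
  define G2 where "G2 = G - H"
  have G2E: "G2 \<subseteq> edges n" using GE by (auto simp: G2_def)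
  have finG: "finite G" using finite_tri_free_member[OF G] .
  define I where "I = (\<lambda>v. {w. {v, w} \<in> G2})"
  have I: "I v \<subseteq> {..<n}" "inside H (I v) = {}" for v
  proof -
    show "I v \<subseteq> {..<n}" unfolding I_def using G2E by (auto dest!: subsetD)
    \<comment> \<open>An edge of \<open>H\<close> between two neighbours of \<open>v\<close> in
      \<open>G - H\<close> would complete a triangle of \<open>G\<close>.\<close>
    show "inside H (I v) = {}"
    proof (rule ccontr)
      assume "inside H (I v) \<noteq> {}"
      then obtain e where e: "e \<in> H" "e \<subseteq> I v" by (auto simp: inside_def)
      then obtain x y where xy: "e = {x, y}" using HG GE by (auto elim!: nsets2_E dest!: subsetD)
      then have "{v, x} \<in> G" "{v, y} \<in> G" "{x, y} \<in> G" using e HG by (auto simp: I_def G2_def)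
      then show False using G unfolding tri_free_iff by (metis insert_commute)
    qed
  qed
  have "\<forall>v. \<exists>F\<subseteq>I v. real (card F) * (T / real n) \<le> real n
     \<and> I v \<subseteq> F \<union> C F \<and> C F \<subseteq> {..<n} \<and> real (card (inside H (C F))) \<le> T"
    using C[OF I] by blast
  then obtain F where F: "\<And>v. F v \<subseteq> I v" "\<And>v. real (card (F v)) * (T / real n) \<le> real n"
      "\<And>v. I v \<subseteq> F v \<union> C (F v)" "\<And>v. C (F v) \<subseteq> {..<n}" "\<And>v. real (card (inside H (C (F v)))) \<le> T"
    by metis
  define K1 where "K1 = {{v, w} |v w. v < w \<and> w \<in> F v}"
  define K2 where "K2 = {{v, w} |v w. w < v \<and> w \<in> F v}"
  define K where "K = K1 \<union> K2"
  have vw: "{v, w} \<in> G2" "v < n" "w < n" "v \<noteq> w" if "w \<in> F v" for v w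
  proof -
    show "{v, w} \<in> G2" using F(1) that by (auto simp: I_def)
    then have "{v, w} \<in> edges n" using G2E by blast
    then show "v < n" "w < n" "v \<noteq> w" by auto
  qed
  have mem1: "{v, w} \<in> K1 \<longleftrightarrow> w \<in> F v" if "v < w" for v w
    using that by (auto simp: K1_def doubleton_eq_iff)
  have mem2: "{v, w} \<in> K2 \<longleftrightarrow> w \<in> F v" if "w < v" for v w
    using that by (auto simp: K2_def doubleton_eq_iff)
  have dec: "decode K1 K2 v = F v" for v
  proof -
    have "w \<in> decode K1 K2 v \<longleftrightarrow> w \<in> F v" for w
      using vw(4)[of w v] mem1[of v w] mem2[of w v] by (auto simp: decode_def neq_iff)
    then show ?thesis by blast
  qed
  have KG: "K \<subseteq> G2" using vw(1) by (auto simp: K_def K1_def K2_def)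
  have "K \<subseteq> (\<lambda>(v, w). {v, w}) ` (SIGMA v:{..<n}. F v)"
    using vw(2) by (force simp: K_def K1_def K2_def)
  moreover have finF: "finite (F v)" for v
    using F(1) I(1) finite_subset by (metis finite_lessThan)
  ultimately have "card K \<le> card (SIGMA v:{..<n}. F v)" by (intro surj_card_le) auto
  also have "\<dots> = (\<Sum>v<n. card (F v))" using finF by (subst card_SigmaI) auto
  finally have "real (card K) \<le> (\<Sum>v<n. real (card (F v)))" by (simp flip: of_nat_sum)
  then have "real (card K) * (T / real n) \<le> (\<Sum>v<n. real (card (F v))) * (T / real n)"
    using T by (intro mult_right_mono) auto
  also have "\<dots> \<le> (\<Sum>v<n. real n)" unfolding sum_distrib_right by (intro sum_mono F(2))
  finally have cardK: "real (card K) * (T / real n) \<le> real n * real n" by simp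
  define c where "c = (\<lambda>v. C (F v))"
  have cover: "G2 \<subseteq> K \<union> allowed n c"
  proof
    fix e assume e: "e \<in> G2"
    show "e \<in> K \<union> allowed n c"
    proof (rule ccontr)
      assume no: "e \<notin> K \<union> allowed n c"
      then obtain u v where uv: "e = {u, v}" "u \<notin> c v" using e G2E by (auto simp: allowed_def)
      then have "u \<in> I v" using e by (auto simp: I_def insert_commute)
      then have u: "u \<in> F v" using F(3)[of v] uv by (auto simp: c_def)
      then have "{v, u} \<in> K" using vw(4)[OF u] by (auto simp: K_def K1_def K2_def neq_iff)
      then show False using no uv by (simp add: insert_commute)
    qed
  qed
  define m where "m = real (card G)"
  have vol: "(\<Sum>u\<in>c v. real (degree G2 u)) \<le> 3 / 5 * m" for v
  proof -
    have "(\<Sum>u\<in>c v. real (degree G2 u)) \<le> (\<Sum>u\<in>c v. real (degree G u))"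
      using degree_mono[OF finG, of G2] by (intro sum_mono) (auto simp: G2_def)
    also have "\<dots> \<le> 2 * real (card (inside G (c v))) + real (max_cut n G)"
      using F(4) by (intro volume_le[OF GE]) (auto simp: c_def)
    also have "\<dots> \<le> 2 * (m / 40) + 11 / 20 * m"
      using good F(4)[of v] F(5)[of v] cut unfolding good_split_def m_def c_def
      by (intro add_mono mult_left_mono) auto
    finally show ?thesis by simp
  qed
  have "(\<Sum>e\<in>G2. \<Sum>u\<in>e. occupancy n c u) = (\<Sum>u<n. real (degree G2 u) * occupancy n c u)"
    by (rule sum_edges_vertices[OF G2E])
  \<comment> \<open>Exchanging the summations turns the sum of occupancies over the edges into the
    average, over all \<open>v\<close>, of the volume of the container of \<open>v\<close>.\<close>
  also have "\<dots> = (\<Sum>u<n. \<Sum>v<n. of_bool (u \<in> c v) * real (degree G2 u) / real n)"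
  proof (rule sum.cong[OF refl])
    fix u
    have "real (card {v \<in> {..<n}. u \<in> c v}) = (\<Sum>v<n. of_bool (u \<in> c v))"
      by (simp add: of_bool_def sum.If_cases Int_def)
    then show "real (degree G2 u) * occupancy n c u
        = (\<Sum>v<n. of_bool (u \<in> c v) * real (degree G2 u) / real n)"
      unfolding occupancy_def sum_divide_distrib[symmetric] sum_distrib_right[symmetric] by simp
  qed
  also have "\<dots> = (\<Sum>v<n. \<Sum>u<n. of_bool (u \<in> c v) * real (degree G2 u) / real n)" by (rule sum.swap)
  also have "\<dots> = (\<Sum>v<n. (\<Sum>u\<in>c v. real (degree G2 u)) / real n)"
  proof (rule sum.cong[OF refl])
    fix v
    have "c v \<subseteq> {..<n}" using F(4) by (simp add: c_def)
    then have "(\<Sum>u\<in>c v. real (degree G2 u)) = (\<Sum>u<n. of_bool (u \<in> c v) * real (degree G2 u))"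
      by (intro sum.mono_neutral_cong_left) auto
    then show "(\<Sum>u<n. of_bool (u \<in> c v) * real (degree G2 u) / real n)
        = (\<Sum>u\<in>c v. real (degree G2 u)) / real n"
      by (simp only: sum_divide_distrib[symmetric])
  qed
  also have "\<dots> \<le> (\<Sum>v<n. 3 / 5 * m / real n)"
    using vol by (intro sum_mono divide_right_mono) auto
  also have "\<dots> = 3 / 5 * m" using n by simp
  \<comment> \<open>At least \<open>9/10 * m\<close> edges lie outside \<open>H\<close>, and
    \<open>2/3 * 9/10 = 3/5\<close>.\<close>
  also have "\<dots> \<le> 2 / 3 * real (card G2)"
  proof -
    have "finite H" using HG finG finite_subset by blast
    then have "real (card G2) = m - real (card H)"
      unfolding G2_def m_def using HG finG card_mono[OF finG HG]
          by (simp add: card_Diff_subset of_nat_diff)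
    then show ?thesis using good by (simp add: good_split_def m_def)
  qed
  finally have "G2 \<in> pattern n c K" using KG cover by (simp add: pattern_def)
  then have "K1 \<subseteq> K \<and> K2 \<subseteq> K \<and> K \<subseteq> edges n \<and> real (card K) * (T / real n) \<le> real n * real n
     \<and> G - H \<in> pattern n (\<lambda>v. C (decode K1 K2 v)) K"
    using KG G2E cardK by (auto simp: K_def dec G2_def c_def)
  then show ?thesis by blast
qed

text \<open>Union bound over the fingerprint data. The pairs \<open>K1\<close>, \<open>K2\<close>
  contribute \<open>4 ^ card K\<close>, which turns \<open>5 * l\<close> into \<open>20 * l\<close>.
  Since \<open>K\<close> has at most \<open>n ^ 3 / T = 80000 * n / l\<close> edges, a small
  multiple of \<open>l * n ^ 2\<close> by the bound on \<open>l ^ 2 * n\<close>, the rate rises only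
  from \<open>37/200\<close> to \<open>41/200\<close>.\<close>

lemma remainder_sum_le:
  assumes n: "n > 0" and l: "l > 0" "l \<le> 1 / 100" and ln: "10 ^ 8
      \<le> l\<^sup>2 * real n" and H: "H \<subseteq> edges n"
  defines "T \<equiv> l * (real n)\<^sup>2 / 80000"
  shows "(\<Sum>R\<in>(\<lambda>G. G - H) ` {G \<in> tri_free n. good_split n T G H \<and> real (max_cut n G)
      \<le> 11 / 20 * real (card G)}.
     l ^ card R) \<le> exp (41 / 200 * l * (real n)\<^sup>2)"
proof -
  have T: "T > 0" using n l by (simp add: T_def)
  define Y where "Y = (\<lambda>G. G - H) ` {G \<in> tri_free n. good_split n T G H \<and> real (max_cut n G)
      \<le> 11 / 20 * real (card G)}"
  obtain C where C: "\<And>I. I \<subseteq> {..<n} \<Longrightarrow> inside H I = {} \<Longrightarrow> \<exists>F\<subseteq>I. real (card F) * (T / real n) \<le> real n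
     \<and> I \<subseteq> F \<union> C F \<and> C F \<subseteq> {..<n} \<and> real (card (inside H (C F))) \<le> T"
    using graph_containers[OF H less_imp_le[OF T]] by blast
  define x where "x = real n * real n / (T / real n)"
  define \<K> where "\<K> = {K. K \<subseteq> edges n \<and> real (card K) \<le> x}"
  have fin\<K>: "finite \<K>" unfolding \<K>_def by simp
  have finK: "finite K" if "K \<in> \<K>" for K using that finite_subset[OF _ finite_edges]
      by (auto simp: \<K>_def)
  define J where "J = (SIGMA K:\<K>. Pow K \<times> Pow K)"
  have finJ: "finite J" unfolding J_def using fin\<K> finK by auto
  define X where "X = (\<lambda>(K, K1, K2). pattern n (\<lambda>v. C (decode K1 K2 v)) K \<inter> Pow (edges n))"
  have finX: "finite (X j)" for j by (auto simp: X_def split: prod.split)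
  have "Y \<subseteq> (\<Union>j\<in>J. X j)"
  proof
    fix R assume "R \<in> Y"
    then obtain G where G: "R = G - H" "G \<in> tri_free n" "good_split n T G H"
      "real (max_cut n G) \<le> 11 / 20 * real (card G)" by (auto simp: Y_def)
    obtain K K1 K2 where K: "K1 \<subseteq> K" "K2 \<subseteq> K" "K \<subseteq> edges n" "real (card K) * (T / real n)
        \<le> real n * real n"
      "R \<in> pattern n (\<lambda>v. C (decode K1 K2 v)) K"
      using pattern_cover[OF n less_imp_le[OF T] G(2-4) C] G(1) by blast
    have "K \<in> \<K>" using K n T unfolding \<K>_def x_def by (simp add: field_simps)
    then have "(K, K1, K2) \<in> J" using K by (simp add: J_def)
    moreover have "R \<in> X (K, K1, K2)" using K G tri_free_edges[OF G(2)] by (auto simp: X_def)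
    ultimately show "R \<in> (\<Union>j\<in>J. X j)" by blast
  qed
  then have "(\<Sum>R\<in>Y. l ^ card R) \<le> (\<Sum>R\<in>(\<Union>j\<in>J. X j). l ^ card R)"
    using l finJ finX by (intro sum_mono2) auto
  also have "\<dots> \<le> (\<Sum>j\<in>J. \<Sum>R\<in>X j. l ^ card R)" using l finJ finX by (intro sum_UN_le) auto
  also have "\<dots> \<le> (\<Sum>(K, K1, K2)\<in>J. (5 * l) ^ card K * exp (37 / 200 * l * (real n)\<^sup>2))"
  proof (rule sum_mono)
    fix j assume "j \<in> J"
    then obtain K K1 K2 where j: "j = (K, K1, K2)" "K \<in> \<K>" by (auto simp: J_def)
    have finP: "finite (pattern n c K)" for c
      by (rule finite_subset[of _ "Pow (K \<union> edges n)"]) (use finK[OF j(2)] in \<open>auto simp: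
          pattern_def allowed_def\<close>)
    have "(\<Sum>R\<in>X j. l ^ card R) \<le> (\<Sum>R\<in>pattern n (\<lambda>v. C (decode K1 K2 v)) K. l ^ card R)"
      using l finP by (intro sum_mono2) (auto simp: X_def j)
    also have "\<dots> \<le> (5 * l) ^ card K * exp (37 / 200 * l * (real n)\<^sup>2)"
      using n l finK[OF j(2)] by (intro pattern_sum_le) auto
    finally show "(\<Sum>R\<in>X j. l ^ card R) \<le> (case j of (K, K1, K2) \<Rightarrow> (5 * l) ^ card K * exp (37 / 200
        * l * (real n)\<^sup>2))"
      by (simp add: j)
  qed
  also have "\<dots> = (\<Sum>K\<in>\<K>. \<Sum>(K1, K2)\<in>Pow K \<times> Pow K. (5 * l) ^ card K * exp (37 / 200 * l
      * (real n)\<^sup>2))"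
    unfolding J_def using fin\<K> finK by (subst sum.Sigma) auto
  also have "\<dots> = (\<Sum>K\<in>\<K>. (20 * l) ^ card K * exp (37 / 200 * l * (real n)\<^sup>2))"
  proof (rule sum.cong[OF refl])
    fix K assume "K \<in> \<K>"
    have "20 * l = (2 * 2) * (5 * l)" by simp
    then have "(20 * l) ^ card K = (2 ^ card K * 2 ^ card K) * (5 * l) ^ card K"
      by (simp only: power_mult_distrib)
    moreover have "real (card (Pow K \<times> Pow K)) = 2 ^ card K * 2 ^ card K"
      using finK[OF \<open>K \<in> \<K>\<close>] by (simp add: card_cartesian_product card_Pow)
    ultimately show "(\<Sum>(K1, K2)\<in>Pow K \<times> Pow K. (5 * l) ^ card K * exp (37 / 200 * l * (real n)\<^sup>2))
        = (20 * l) ^ card K * exp (37 / 200 * l * (real n)\<^sup>2)"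
      by (simp only: case_prod_unfold sum_constant mult.assoc)
  qed
  also have "\<dots> = (\<Sum>K\<in>\<K>. (20 * l) ^ card K) * exp (37 / 200 * l * (real n)\<^sup>2)"
    by (rule sum_distrib_right[symmetric])
  \<comment> \<open>With \<open>y = 1/1024\<close> each of the two resulting exponents is at most
    \<open>l * n ^ 2 / 100\<close>.\<close>
  also have "\<dots> \<le> ((1 / 1024) powr (- x) * exp (1 / 1024 * (20 * l) * real (card (edges n))))
      * exp (37 / 200 * l * (real n)\<^sup>2)"
    unfolding \<K>_def using l by (intro mult_right_mono sum_few_edges_le) auto
  also have "(1 / 1024 :: real) powr (- x) = exp (10 * ln 2 * x)"
    using ln_realpow[of 2 10] by (simp add: powr_def ln_div)
  also have "exp (10 * ln 2 * x) * exp (1 / 1024 * (20 * l) * real (card (edges n))) * exp (37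
      / 200 * l * (real n)\<^sup>2)
    = exp (10 * ln 2 * x + 1 / 1024 * (20 * l) * real (card (edges n)) + 37 / 200 * l * (real n)\<^sup>2)"
    by (simp add: exp_add)
  also have "\<dots> \<le> exp (41 / 200 * l * (real n)\<^sup>2)"
  proof -
    have "x = 80000 * real n / l" using n l by (simp add: x_def T_def field_simps power2_eq_square)
    moreover have "80000 * real n / l \<le> 1 / 1000 * l * (real n)\<^sup>2"
    proof -
      have "80000000 * real n \<le> (l\<^sup>2 * real n) * real n"
        using ln by (intro mult_right_mono) auto
      then show ?thesis using l by (simp add: field_simps power2_eq_square)
    qed
    moreover have "0 \<le> x" using T by (simp add: x_def)
    moreover have "10 * ln 2 \<le> (10 :: real)" using ln2_le_25_over_36 by simp
    ultimately have 1: "10 * ln 2 * x \<le> 10 * (1 / 1000 * l * (real n)\<^sup>2)" by (intro mult_mono) auto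
    have "1 / 1024 * (20 * l) * real (card (edges n)) \<le> 1 / 1000 * (20 * l) * ((real n)\<^sup>2 / 2)"
      using card_edges_le l by (intro mult_mono) auto
    with 1 show ?thesis unfolding exp_le_cancel_iff by linarith
  qed
  finally show ?thesis by (simp add: Y_def)
qed


section \<open>Random splitting of a graph\<close>

lemma sum_Un_le:
  fixes f :: "'a \<Rightarrow> real"
  assumes "finite A" "finite B" "\<And>x. f x \<ge> 0"
  shows "sum f (A \<union> B) \<le> sum f A + sum f B"
  using assms by (simp add: sum_Un sum_nonneg)

text \<open>Expectation of a product over \<open>H\<close> when each edge of \<open>G\<close> is put
  into \<open>H\<close> independently with probability \<open>1/20\<close>; the tail bounds below
  insert different \<open>x\<close>.\<close>

lemma split_sum:
  assumes "finite G"
  shows "(\<Sum>H\<in>Pow G. (\<Prod>e\<in>H. x e) * ((1 / 20) ^ card H * (19 / 20) ^ card (G - H)))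
     = (\<Prod>e\<in>G. x e / 20 + 19 / 20 :: real)"
proof -
  have "(\<Prod>e\<in>G. x e / 20 + 19 / 20 :: real) = (\<Sum>H\<in>Pow G. (\<Prod>e\<in>H. x e / 20) * (\<Prod>e\<in>G - H. 19 / 20))"
    by (rule prod_add[OF assms])
  also have "\<dots> = (\<Sum>H\<in>Pow G. (\<Prod>e\<in>H. x e) * ((1 / 20) ^ card H * (19 / 20) ^ card (G - H)))"
    by (intro sum.cong refl) (simp add: prod_dividef power_divide)
  finally show ?thesis by simp
qed

text \<open>Markov's inequality with a factor \<open>2\<close> per edge of \<open>H\<close>: the
  rate is \<open>1/20 - ln 2 / 10\<close>, at most \<open>- 1/60\<close> by
  \<open>ln 2 \<ge> 2/3\<close>.\<close>

lemma split_many_edges: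
  assumes "finite G"
  shows "(\<Sum>H | H \<subseteq> G \<and> real (card H) > real (card G) / 10. (1 / 20) ^ card H * (19 / 20) ^ card (G
      - H))
     \<le> exp (- real (card G) / 60 :: real)"
proof -
  define q where "q = (\<lambda>H. (1 / 20 :: real) ^ card H * (19 / 20) ^ card (G - H))"
  define m where "m = real (card G)"
  have q: "q H \<ge> 0" for H by (simp add: q_def)
  have "(\<Sum>H | H \<subseteq> G \<and> real (card H) > m / 10. q H)
      \<le> (\<Sum>H | H \<subseteq> G \<and> real (card H) > m / 10. 2 powr (- m / 10) * ((\<Prod>e\<in>H. 2) * q H))"
  proof (rule sum_mono)
    fix H assume H: "H \<in> {H. H \<subseteq> G \<and> real (card H) > m / 10}"
    have "(2 :: real) powr 0 \<le> 2 powr (- m / 10 + real (card H))" using H by (intro powr_mono) auto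
    also have "\<dots> = 2 powr (- m / 10) * 2 ^ card H" unfolding powr_add by (simp add: powr_realpow)
    finally have "1 * q H \<le> 2 powr (- m / 10) * 2 ^ card H * q H" using q
        by (intro mult_right_mono) auto
    then show "q H \<le> 2 powr (- m / 10) * ((\<Prod>e\<in>H. 2) * q H)" by (simp add: mult.assoc)
  qed
  also have "\<dots> \<le> (\<Sum>H\<in>Pow G. 2 powr (- m / 10) * ((\<Prod>e\<in>H. 2) * q H))"
    using assms q by (intro sum_mono2) auto
  also have "\<dots> = 2 powr (- m / 10) * (\<Sum>H\<in>Pow G. (\<Prod>e\<in>H. 2) * q H)"
    by (simp only: sum_distrib_left)
  also have "\<dots> = 2 powr (- m / 10) * (21 / 20) ^ card G"
    unfolding q_def split_sum[OF assms] by simp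
  also have "\<dots> \<le> exp (- m / 10 * ln 2) * exp (m * (1 / 20))"
  proof (rule mult_mono)
    have "(21 / 20 :: real) \<le> exp (1 / 20)" using exp_ge_add_one_self[of "1 / 20"] by simp
    then have "(21 / 20 :: real) ^ card G \<le> exp (1 / 20) ^ card G" by (intro power_mono) auto
    also have "\<dots> = exp (m * (1 / 20))" unfolding m_def by (rule exp_of_nat_mult[symmetric])
    finally show "(21 / 20 :: real) ^ card G \<le> exp (m * (1 / 20))" .
  qed (auto simp: powr_def)
  also have "\<dots> \<le> exp (- m / 60)"
  proof -
    have "m * (2 / 3) \<le> m * ln 2" using ln2_ge_two_thirds
        by (intro mult_left_mono) (auto simp: m_def)
    then show ?thesis by (simp add: exp_add[symmetric])
  qed
  finally show ?thesis by (simp add: q_def m_def)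
qed

text \<open>Markov's inequality with a factor \<open>1/2\<close> for each edge of \<open>H\<close>
  inside \<open>S\<close>; every edge of \<open>G\<close> inside \<open>S\<close> then contributes
  \<open>39/40\<close>.\<close>

lemma split_sparse_inside:
  assumes "finite G"
  shows "(\<Sum>H | H \<subseteq> G \<and> real (card (inside H S)) \<le> T. (1 / 20) ^ card H * (19 / 20) ^ card (G - H))
     \<le> exp (max T 0 - real (card (inside G S)) / 40 :: real)"
proof -
  define q where "q = (\<lambda>H. (1 / 20 :: real) ^ card H * (19 / 20) ^ card (G - H))"
  define k where "k = card (inside G S)"
  define x where "x = (\<lambda>e. if e \<subseteq> S then 1 / 2 else 1 :: real)"
  have q: "q H \<ge> 0" for H by (simp add: q_def)
  have x: "x e \<ge> 0" for e by (simp add: x_def)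
  have px: "(\<Prod>e\<in>H. x e) = (1 / 2) ^ card (inside H S)" if "H \<subseteq> G" for H
  proof -
    have "finite H" using that assms finite_subset by blast
    then show ?thesis by (simp add: x_def prod.If_cases inside_def Int_def)
  qed
  have "(\<Sum>H | H \<subseteq> G \<and> real (card (inside H S)) \<le> T. q H)
      \<le> (\<Sum>H | H \<subseteq> G \<and> real (card (inside H S)) \<le> T. 2 powr T * ((\<Prod>e\<in>H. x e) * q H))"
  proof (rule sum_mono)
    fix H assume H: "H \<in> {H. H \<subseteq> G \<and> real (card (inside H S)) \<le> T}"
    have "(2 :: real) powr 0 \<le> 2 powr (T - real (card (inside H S)))" using H
        by (intro powr_mono) auto
    also have "\<dots> = 2 powr T * (\<Prod>e\<in>H. x e)"
      using H by (simp add: powr_diff powr_realpow px power_divide)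
    finally have "1 * q H \<le> 2 powr T * (\<Prod>e\<in>H. x e) * q H" using q by (intro mult_right_mono) auto
    then show "q H \<le> 2 powr T * ((\<Prod>e\<in>H. x e) * q H)" by (simp add: mult.assoc)
  qed
  also have "\<dots> \<le> (\<Sum>H\<in>Pow G. 2 powr T * ((\<Prod>e\<in>H. x e) * q H))"
    using assms q x by (intro sum_mono2) (auto intro!: mult_nonneg_nonneg prod_nonneg)
  also have "\<dots> = 2 powr T * (\<Prod>e\<in>G. x e / 20 + 19 / 20)"
    unfolding q_def split_sum[OF assms, symmetric] by (simp only: sum_distrib_left)
  also have "(\<Prod>e\<in>G. x e / 20 + 19 / 20) = (\<Prod>e\<in>G. if e \<subseteq> S then 39 / 40 else 1)"
    by (intro prod.cong) (auto simp: x_def)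
  also have "\<dots> = (39 / 40) ^ k"
    using assms by (simp add: prod.If_cases inside_def Int_def k_def)
  also have "2 powr T * (39 / 40) ^ k \<le> exp (max T 0) * exp (real k * (- 1 / 40))"
  proof (rule mult_mono)
    have "ln 2 \<le> (1 :: real)" using ln2_le_25_over_36 by simp
    then have "T * ln 2 \<le> max T 0"
      by (cases "T \<ge> 0") (auto simp: mult_left_le mult_nonpos_nonneg)
    then show "2 powr T \<le> exp (max T 0)" by (simp add: powr_def)
    have "(39 / 40 :: real) \<le> exp (- 1 / 40)" using exp_ge_add_one_self[of "- 1 / 40"] by simp
    then have "(39 / 40 :: real) ^ k \<le> exp (- 1 / 40) ^ k" by (intro power_mono) auto
    also have "\<dots> = exp (real k * (- 1 / 40))" by (rule exp_of_nat_mult[symmetric])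
    finally show "(39 / 40 :: real) ^ k \<le> exp (real k * (- 1 / 40))" .
  qed auto
  also have "\<dots> = exp (max T 0 - real k / 40)" by (simp add: exp_add[symmetric])
  finally show ?thesis by (simp add: q_def k_def)
qed

lemma exp_minus_le_quarter: "x \<ge> 3 \<Longrightarrow> exp (- x) \<le> (1 / 4 :: real)"
proof -
  assume "x \<ge> 3"
  then have "4 \<le> exp x" using exp_ge_add_one_self[of x] by linarith
  then show ?thesis by (simp add: exp_minus inverse_eq_divide divide_le_eq)
qed

text \<open>A random split is good with probability at least \<open>1/2\<close>: too many edges in
  \<open>H\<close> and a failure of the sparsity clause for some \<open>S\<close> have probability
  at most \<open>1/4\<close> each, the latter by a union bound over at most \<open>2 ^ n\<close>
  sets.\<close>

lemma good_split_sum_ge: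
  assumes G: "G \<subseteq> edges n" and n: "n > 0" and l: "l > 0" and ln: "10 ^ 6 \<le> l * real n"
    and m: "l * (real n)\<^sup>2 / 32 \<le> real (card G)"
  defines "T \<equiv> l * (real n)\<^sup>2 / 80000"
  shows "1 / 2 \<le> (\<Sum>H | good_split n T G H. (1 / 20) ^ card H * (19 / 20 :: real) ^ card (G - H))"
proof -
  have fin: "finite G" using finite_subset[OF G] by simp
  have T: "T \<ge> 0" using l by (simp add: T_def)
  define q where "q = (\<lambda>H. (1 / 20 :: real) ^ card H * (19 / 20) ^ card (G - H))"
  have q: "q H \<ge> 0" for H by (simp add: q_def)
  have big: "10 ^ 6 * real n \<le> l * (real n)\<^sup>2"
    using mult_right_mono[OF ln, of "real n"] by (simp add: power2_eq_square mult.assoc)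
  define B1 where "B1 = {H. H \<subseteq> G \<and> real (card H) > real (card G) / 10}"
  define B2 where "B2 = (\<lambda>S. {H. H \<subseteq> G \<and> real (card (inside H S)) \<le> T})"
  define SS where "SS = {S \<in> Pow {..<n}. real (card (inside G S)) > real (card G) / 40}"
  define good where "good = {H. good_split n T G H}"
  have finG: "finite good"
      by (rule finite_subset[of _ "Pow G"]) (use fin in \<open>auto simp: good_def good_split_def\<close>)
  have fin12: "finite B1" "finite (B2 S)" "finite SS" for S using fin
      by (auto simp: B1_def B2_def SS_def)
  have "1 = (\<Sum>H\<in>Pow G. q H)" using split_sum[OF fin, of "\<lambda>_. 1"] by (simp add: q_def)
  also have "\<dots> \<le> (\<Sum>H\<in>good \<union> (B1 \<union> (\<Union>S\<in>SS. B2 S)). q H)"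
  proof (rule sum_mono2)
    show "Pow G \<subseteq> good \<union> (B1 \<union> (\<Union>S\<in>SS. B2 S))"
    proof
      fix H assume H: "H \<in> Pow G"
      consider "real (card H) > real (card G) / 10" | "good_split n T G H"
        | S where "S \<subseteq> {..<n}" "real (card (inside H S))
            \<le> T" "real (card (inside G S)) > real (card G) / 40"
        using H unfolding good_split_def Pow_iff by (meson not_le)
      then show "H \<in> good \<union> (B1 \<union> (\<Union>S\<in>SS. B2 S))"
      proof cases
        case (3 S)
        then have "S \<in> SS" "H \<in> B2 S" using H by (simp_all add: SS_def B2_def)
        then show ?thesis by blast
      qed (use H in \<open>simp_all add: B1_def good_def\<close>)
    qed
  qed (use finG fin12 q in simp_all)
  also have "\<dots> \<le> (\<Sum>H\<in>good. q H) + ((\<Sum>H\<in>B1. q H) + (\<Sum>S\<in>SS. \<Sum>H\<in>B2 S. q H))"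
    using finG fin12 q
    by (intro order_trans[OF sum_Un_le] add_left_mono sum_UN_le) auto
  also have "(\<Sum>H\<in>B1. q H) \<le> exp (- real (card G) / 60)"
    unfolding B1_def q_def using fin by (rule split_many_edges)
  also have "\<dots> \<le> exp (- 3)" using m big n by simp
  also have "\<dots> \<le> 1 / 4" by (rule exp_minus_le_quarter) simp
  also have "(\<Sum>S\<in>SS. \<Sum>H\<in>B2 S. q H) \<le> (\<Sum>S\<in>SS. exp (- (4 * real n)))"
  proof (rule sum_mono)
    fix S assume S: "S \<in> SS"
    have "(\<Sum>H\<in>B2 S. q H) \<le> exp (max T 0 - real (card (inside G S)) / 40)"
      unfolding B2_def q_def using fin by (rule split_sparse_inside)
    \<comment> \<open>More than \<open>card G / 40\<close>, hence more than
      \<open>l * n ^ 2 / 1280\<close>, edges lie inside \<open>S\<close>. The exponent is thus below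
      \<open>l * n ^ 2 * (1/80000 - 1/51200)\<close>, and \<open>10 ^ 6 \<le> l * n\<close> brings
      it below \<open>- 4 * n\<close>.\<close>
    also have "\<dots> \<le> exp (- (4 * real n))"
      using S m big T by (simp add: SS_def T_def)
    finally show "(\<Sum>H\<in>B2 S. q H) \<le> exp (- (4 * real n))" .
  qed
  also have "\<dots> = real (card SS) * exp (- (4 * real n))" by simp
  also have "\<dots> \<le> exp (real n) * exp (- (4 * real n))"
  proof (rule mult_right_mono)
    have "card SS \<le> card (Pow {..<n})" unfolding SS_def by (intro card_mono) auto
    then have "real (card SS) \<le> 2 ^ n" by (simp add: card_Pow)
    also have "(2 :: real) ^ n \<le> exp 1 ^ n" using exp_ge_add_one_self[of 1]
        by (intro power_mono) auto
    also have "\<dots> = exp (real n)" by (simp add: exp_of_nat_mult[symmetric])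
    finally show "real (card SS) \<le> exp (real n)" .
  qed simp
  also have "\<dots> = exp (- (3 * real n))" by (simp add: exp_add[symmetric])
  also have "\<dots> \<le> 1 / 4" using n by (intro exp_minus_le_quarter) auto
  finally show ?thesis by (simp add: good_def q_def)
qed

text \<open>Averaging over good splits bounds \<open>l ^ card G\<close> by twice a sum over
  \<open>H\<close> in which \<open>H\<close> carries the reduced activity \<open>l / 20\<close>. For
  fixed \<open>H\<close> the remainders are bounded by containers, and the sum over all
  \<open>H\<close> adds only \<open>1/40\<close> to the rate.\<close>

lemma gibbs_max_cut_large:
  assumes n: "n \<ge> 2" and l: "l > 0" "l \<le> 1 / 100"
    and ln: "10 ^ 6 \<le> l * real n" "10 ^ 8 \<le> l\<^sup>2 * real n"
  shows "gibbs n l {G. MC n G \<le> 11 / 20} \<le> exp (1 - l * (real n)\<^sup>2 / 40) + 2 * exp (1 - l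
      * (real n)\<^sup>2 / 60)"
proof -
  define N where "N = real (card (edges n))"
  define T where "T = l * (real n)\<^sup>2 / 80000"
  define few where "few = {G::nat set set. real (card G) \<le> l * N / 8}"
  define B where "B = {G \<in> tri_free n. l * N / 8 < real (card G) \<and> real (max_cut n G)
      \<le> 11 / 20 * real (card G)}"
  define Z where "Z = (\<Sum>G\<in>tri_free n. l ^ card G)"
  have Z: "Z > 0" unfolding Z_def using l by (simp add: partition_pos)
  have finB: "finite B" by (simp add: B_def)
  have "(\<Sum>G\<in>B. l ^ card G) \<le> (\<Sum>G\<in>B. 2 * (\<Sum>H\<in>Pow (edges n). of_bool (good_split n T G H) * ((l
      / 20) ^ card H * l ^ card (G - H))))"
  proof (rule sum_mono)
    fix G assume G: "G \<in> B"
    then have GE: "G \<subseteq> edges n" using tri_free_edges by (auto simp: B_def)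
    have finG: "finite G" using finite_subset[OF GE] by simp
    have "real n * (real n / 2) \<le> real n * (real n - 1)" using n by (intro mult_left_mono) auto
    then have "(real n)\<^sup>2 / 4 \<le> N" unfolding N_def card_edges_real by (simp add: power2_eq_square)
    then have "l * ((real n)\<^sup>2 / 4) \<le> l * N" using l by (intro mult_left_mono) auto
    then have m: "l * (real n)\<^sup>2 / 32 \<le> real (card G)" using G by (simp add: B_def)
    have fin_Pow: "finite (Pow (edges n))" by simp
    have sub: "{H. good_split n T G H} = {H \<in> Pow (edges n). good_split n T G H}"
      using GE by (auto simp: good_split_def)
    have "1 / 2 \<le> (\<Sum>H | good_split n T G H. (1 / 20) ^ card H * (19 / 20 :: real) ^ card (G - H))"
      unfolding T_def using GE n l ln m by (intro good_split_sum_ge) auto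
    then have "l ^ card G * (1 / 2) \<le> l ^ card G * (\<Sum>H | good_split n T G H. (1 / 20) ^ card H
        * (19 / 20 :: real) ^ card (G - H))"
      using l by (intro mult_left_mono) auto
    also have "\<dots> = (\<Sum>H | good_split n T G H. l ^ card G * ((1 / 20) ^ card H * (19
        / 20 :: real) ^ card (G - H)))"
      by (rule sum_distrib_left)
    also have "\<dots> \<le> (\<Sum>H | good_split n T G H. (l / 20) ^ card H * l ^ card (G - H))"
    proof (rule sum_mono)
      fix H assume "H \<in> {H. good_split n T G H}"
      then have "H \<subseteq> G" by (simp add: good_split_def)
      then have "card G = card H + card (G - H)"
        using finG by (simp add: card_Diff_subset card_mono finite_subset)
      then have "l ^ card G * ((1 / 20) ^ card H * (19 / 20 :: real) ^ card (G - H))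
          = (l / 20) ^ card H * (l ^ card (G - H) * (19 / 20) ^ card (G - H))"
        by (simp add: power_add power_divide)
      \<comment> \<open>The probability \<open>(19/20) ^ card (G - H)\<close> is discarded, while
        the factor \<open>1/20\<close> per edge of \<open>H\<close> is kept: it makes the
        enumeration of \<open>H\<close> cheap.\<close>
      also have "\<dots> \<le> (l / 20) ^ card H * (l ^ card (G - H) * 1)"
        using l by (intro mult_left_mono power_le_one) auto
      finally show "l ^ card G * ((1 / 20) ^ card H * (19 / 20 :: real) ^ card (G - H))
          \<le> (l / 20) ^ card H * l ^ card (G - H)"
        by simp
    qed
    also have "\<dots> = (\<Sum>H\<in>Pow (edges n). of_bool (good_split n T G H) * ((l / 20) ^ card H
        * l ^ card (G - H)))"
      unfolding sub sum.inter_filter[OF fin_Pow] by (intro sum.cong) auto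
    finally show "l ^ card G \<le> 2 * (\<Sum>H\<in>Pow (edges n). of_bool (good_split n T G H) * ((l
        / 20) ^ card H * l ^ card (G - H)))"
      by simp
  qed
  also have "\<dots> = 2 * (\<Sum>H\<in>Pow (edges n). \<Sum>G\<in>B. of_bool (good_split n T G H) * ((l / 20) ^ card H
      * l ^ card (G - H)))"
    unfolding sum_distrib_left[symmetric] by (subst sum.swap) (rule refl)
  also have "\<dots> \<le> 2 * (\<Sum>H\<in>Pow (edges n). (l / 20) ^ card H * exp (41 / 200 * l * (real n)\<^sup>2))"
  proof (intro mult_left_mono sum_mono)
    fix H assume H: "H \<in> Pow (edges n)"
    define BH where "BH = {G \<in> B. good_split n T G H}"
    have "(\<Sum>G\<in>B. of_bool (good_split n T G H) * ((l / 20) ^ card H * l ^ card (G - H)))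
        = (l / 20) ^ card H * (\<Sum>G\<in>BH. l ^ card (G - H))"
      unfolding BH_def sum.inter_filter[OF finB] sum_distrib_left by (rule sum.cong[OF refl]) simp
    \<comment> \<open>For fixed \<open>H\<close>, a graph containing \<open>H\<close> is determined
      by its remainder, so no remainder is counted twice.\<close>
    also have "(\<Sum>G\<in>BH. l ^ card (G - H)) = (\<Sum>R\<in>(\<lambda>G. G - H) ` BH. l ^ card R)"
      by (rule sum.reindex_cong[symmetric, of "\<lambda>G. G
          - H"]) (auto simp: inj_on_def BH_def good_split_def)
    also have "\<dots> \<le> (\<Sum>R\<in>(\<lambda>G. G - H) ` {G \<in> tri_free n. good_split n T G H \<and> real (max_cut n G)
        \<le> 11 / 20 * real (card G)}.
     l ^ card R)"
      using l by (intro sum_mono2) (auto simp: BH_def B_def)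
    also have "\<dots> \<le> exp (41 / 200 * l * (real n)\<^sup>2)"
      unfolding T_def using n l ln H by (intro remainder_sum_le) auto
    finally show "(\<Sum>G\<in>B. of_bool (good_split n T G H) * ((l / 20) ^ card H * l ^ card (G - H)))
        \<le> (l / 20) ^ card H * exp (41 / 200 * l * (real n)\<^sup>2)"
      using l by (simp add: mult_left_mono)
  qed simp
  also have "\<dots> = 2 * ((\<Sum>H\<in>Pow (edges n). (l / 20) ^ card H) * exp (41 / 200 * l * (real n)\<^sup>2))"
    by (simp only: sum_distrib_right)
  also have "\<dots> \<le> 2 * (exp (l * (real n)\<^sup>2 / 40) * exp (41 / 200 * l * (real n)\<^sup>2))"
  proof (intro mult_left_mono mult_right_mono)
    have "(\<Sum>H\<in>Pow (edges n). (l / 20) ^ card H) \<le> exp (l / 20 * N)"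
      unfolding N_def using l by (intro sum_subsets_power_le_exp) auto
    also have "l / 20 * N \<le> l / 20 * ((real n)\<^sup>2 / 2)"
      unfolding N_def using l card_edges_le by (intro mult_left_mono) auto
    finally show "(\<Sum>H\<in>Pow (edges n). (l / 20) ^ card H) \<le> exp (l * (real n)\<^sup>2 / 40)"
      by (simp add: algebra_simps)
  qed auto
  also have "\<dots> = 2 * exp (23 / 100 * l * (real n)\<^sup>2)"
      by (simp add: exp_add[symmetric] algebra_simps)
  \<comment> \<open>For \<open>l \<le> 1/100\<close> the bipartite rate is at least
    \<open>99/400\<close>, which exceeds \<open>23/100\<close> by more than
    \<open>1/60\<close>.\<close>
  also have "\<dots> \<le> 2 * exp ((1 - l * (real n)\<^sup>2 / 60) + (l - l\<^sup>2) * ((real n)\<^sup>2 - 1) / 4)"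
  proof -
    have "99 / 100 * l * (real n)\<^sup>2 \<le> (l - l\<^sup>2) * (real n)\<^sup>2"
      using l by (intro mult_right_mono) (auto simp: power2_eq_square)
    moreover have "l - l\<^sup>2 \<le> 1" "l * (real n)\<^sup>2 \<ge> 0"
      using l by (auto simp: power2_eq_square intro: order_trans[of _ l])
    ultimately show ?thesis by (simp add: field_simps)
  qed
  also have "\<dots> = 2 * exp (1 - l * (real n)\<^sup>2 / 60) * exp ((l - l\<^sup>2) * ((real n)\<^sup>2 - 1) / 4)"
    by (simp add: exp_add)
  also have "\<dots> \<le> 2 * exp (1 - l * (real n)\<^sup>2 / 60) * Z"
    unfolding Z_def using partition_lower_bound[of l n] l by (intro mult_left_mono) auto
  finally have B: "gibbs n l B \<le> 2 * exp (1 - l * (real n)\<^sup>2 / 60)"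
    unfolding gibbs_def using Z by (simp add: Z_def pos_divide_le_eq B_def Int_def)
  have "tri_free n \<inter> {G. MC n G \<le> 11 / 20} \<subseteq> few \<union> B"
  proof
    fix G assume G: "G \<in> tri_free n \<inter> {G. MC n G \<le> 11 / 20}"
    show "G \<in> few \<union> B"
    proof (cases "G \<in> few")
      case False
      moreover have "0 \<le> l * N / 8" using l by (simp add: N_def)
      ultimately have "real (card G) > 0" unfolding few_def by simp
      moreover from this have "G \<noteq> {}" by auto
      ultimately have "real (max_cut n G) \<le> 11 / 20 * real (card G)"
        using G by (simp add: MC_def pos_divide_le_eq)
      then show ?thesis using G False by (auto simp: few_def B_def)
    qed simp
  qed
  then have "gibbs n l {G. MC n G \<le> 11 / 20} \<le> gibbs n l (few \<union> B)" using l by (intro gibbs_mono)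
  also have "\<dots> \<le> gibbs n l few + gibbs n l B" using l by (intro gibbs_Un)
  also have "gibbs n l few \<le> exp (1 - l * (real n)\<^sup>2 / 40)"
    unfolding few_def N_def using l by (intro gibbs_few_edges) auto
  finally show ?thesis using B by simp
qed

subsection \<open>The conditioned random graph\<close>

lemma pmf_erdos_renyi:
  assumes p: "0 < p" "p < 1" and G: "G \<subseteq> edges n"
  shows "pmf (erdos_renyi n p) G = (1 - p) ^ card (edges n) * (p / (1 - p)) ^ card G"
proof -
  define M where "M = Pi_pmf (edges n) False (\<lambda>_. bernoulli_pmf p)"
  define g where "g = (\<lambda>e. e \<in> G)"
  have M: "set_pmf M = PiE_dflt (edges n) False (\<lambda>_. UNIV)"
    unfolding M_def using p by (subst set_Pi_pmf) (auto simp: o_def set_pmf_bernoulli)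
  \<comment> \<open>Functions in the support take the default value \<open>False\<close> off
    \<open>edges n\<close>, so the edge set determines the function.\<close>
  have "inj_on (\<lambda>f. {e \<in> edges n. f e}) (set_pmf M)"
    unfolding M PiE_dflt_def inj_on_def by (auto simp: fun_eq_iff)
  moreover have "g \<in> set_pmf M" using G by (auto simp: M PiE_dflt_def g_def)
  ultimately have "pmf (map_pmf (\<lambda>f. {e \<in> edges n. f e}) M) {e \<in> edges n. g e} = pmf M g"
    by (rule pmf_map_inj)
  moreover have "{e \<in> edges n. g e} = G" using G by (auto simp: g_def)
  ultimately have "pmf (erdos_renyi n p) G = pmf M g" by (simp add: erdos_renyi_def M_def)
  also have "\<dots> = (\<Prod>e\<in>edges n. pmf (bernoulli_pmf p) (g e))"
    unfolding M_def using G by (intro pmf_Pi') (auto simp: g_def)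
  also have "\<dots> = (\<Prod>e\<in>edges n. (1 - p) * (if e \<in> G then p / (1 - p) else 1))"
    using p by (intro prod.cong) (auto simp: g_def)
  also have "\<dots> = (1 - p) ^ card (edges n) * (p / (1 - p)) ^ card G"
    using G by (simp only: prod.distrib prod_constant prod.If_cases[OF finite_edges])
      (simp add: Int_absorb1)
  finally show ?thesis .
qed

lemma set_pmf_erdos_renyi: "set_pmf (erdos_renyi n p) \<subseteq> Pow (edges n)"
  by (auto simp: erdos_renyi_def)

text \<open>The factor \<open>(1 - p) ^ card (edges n)\<close> is common to all graphs and cancels
  in the conditioning, which leaves the odds as weight per edge. The empty graph gives the condition
  positive probability, so \<open>cond_pmf\<close> is specified.\<close>

lemma expectation_tri_free:
  assumes p: "0 < p" "p < 1"
  defines "l \<equiv> p / (1 - p)"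
  shows "measure_pmf.expectation (cond_pmf (erdos_renyi n p) {E. num_triangles n E = 0}) f
    = (\<Sum>G\<in>tri_free n. l ^ card G * f G) / (\<Sum>G\<in>tri_free n. l ^ card G)"
proof -
  define M where "M = erdos_renyi n p"
  define S where "S = {E. num_triangles n E = 0}"
  define q where "q = (1 - p) ^ card (edges n)"
  have q: "q > 0" using p by (simp add: q_def)
  have pmf: "pmf M G = q * l ^ card G" if "G \<in> tri_free n" for G
    unfolding M_def q_def l_def using p tri_free_edges[OF that] by (rule pmf_erdos_renyi)
  have "pmf M {} > 0" using pmf[OF empty_tri_free] q by simp
  then have "{} \<in> set_pmf M" by (simp add: set_pmf_iff)
  moreover have "{} \<in> S" using empty_tri_free[of n] by (simp add: S_def tri_free_def)
  ultimately have ne: "set_pmf M \<inter> S \<noteq> {}" by blast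
  have sub: "set_pmf M \<inter> S \<subseteq> tri_free n"
    using set_pmf_erdos_renyi by (auto simp: M_def S_def tri_free_def)
  have tri: "tri_free n \<subseteq> S" by (auto simp: S_def tri_free_def)
  have "measure M S = measure M (S \<inter> set_pmf M)" by (simp add: measure_Int_set_pmf)
  also have "\<dots> = measure M (tri_free n \<inter> set_pmf M)"
    using sub tri by (intro arg_cong2[where f = measure]) auto
  also have "\<dots> = measure M (tri_free n)" by (simp add: measure_Int_set_pmf)
  also have "\<dots> = (\<Sum>G\<in>tri_free n. q * l ^ card G)"
    by (simp add: measure_measure_pmf_finite pmf)
  finally have meas: "measure M S = q * (\<Sum>G\<in>tri_free n. l ^ card G)" by (simp add: sum_distrib_left)
  have "measure_pmf.expectation (cond_pmf M S) f = (\<Sum>G\<in>tri_free n. pmf (cond_pmf M S) G *\<^sub>R f G)"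
    using sub set_cond_pmf[OF ne] by (intro integral_measure_pmf) auto
  also have "\<dots> = (\<Sum>G\<in>tri_free n. l ^ card G * f G / (\<Sum>G\<in>tri_free n. l ^ card G))"
  proof (rule sum.cong[OF refl])
    fix G assume G: "G \<in> tri_free n"
    then show "pmf (cond_pmf M S) G *\<^sub>R f G = l ^ card G * f G / (\<Sum>G\<in>tri_free n. l ^ card G)"
      using tri q by (auto simp: pmf_cond[OF ne] meas pmf)
  qed
  finally show ?thesis by (simp add: M_def S_def sum_divide_distrib)
qed

lemma sum_card_cut_edges:
  assumes G: "G \<subseteq> edges n"
  shows "2 * (\<Sum>S\<in>Pow {..<n}. card (cut_edges G S)) = 2 ^ n * card G"
proof -
  define split where "split = (\<lambda>e S. e \<inter> S \<noteq> {} \<and> e - S \<noteq> ({}::nat set))"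
  have fin: "finite G" using finite_subset[OF G] by simp
  have half: "(\<Sum>S\<in>Pow {..<n}. of_bool (split e S)) = (\<Sum>S\<in>Pow {..<n}. of_bool (\<not> split e S) :: nat)"
    if "e \<in> G" for e
  proof -
    have "e \<in> edges n" using that G by auto
    then obtain u v where e: "e = {u, v}" "u < n" "u \<noteq> v" by (auto elim!: nsets2_E)
    \<comment> \<open>Moving the endpoint \<open>u\<close> to the other side is an involution that
      exchanges the sets cutting \<open>e\<close> with those that do not.\<close>
    define flip where "flip = (\<lambda>S. if u \<in> S then S - {u} else insert u S)"
    have "split e (flip S) \<longleftrightarrow> \<not> split e S" for S
      using e by (auto simp: flip_def split_def)
    moreover have "flip (flip S) = S" for S by (auto simp: flip_def)
    moreover have "flip S \<in> Pow {..<n}" if "S \<in> Pow {..<n}" for S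
      using that e by (auto simp: flip_def)
    ultimately show ?thesis
      by (intro sum.reindex_bij_witness[where i = flip and j = flip]) auto
  qed
  have "(\<Sum>S\<in>Pow {..<n}. card (cut_edges G S)) = (\<Sum>S\<in>Pow {..<n}. \<Sum>e\<in>G. of_bool (split e S))"
    using fin by (simp add: cut_edges_def split_def of_bool_def sum.If_cases Int_def)
  also have "\<dots> = (\<Sum>e\<in>G. \<Sum>S\<in>Pow {..<n}. of_bool (split e S))" by (rule sum.swap)
  finally have 1: "(\<Sum>S\<in>Pow {..<n}. card (cut_edges G S))
      = (\<Sum>e\<in>G. \<Sum>S\<in>Pow {..<n}. of_bool (split e S))" .
  have "2 * (\<Sum>e\<in>G. \<Sum>S\<in>Pow {..<n}. of_bool (split e S) :: nat)
      = (\<Sum>e\<in>G. (\<Sum>S\<in>Pow {..<n}. of_bool (split e S)) + (\<Sum>S\<in>Pow {..<n}. of_bool (\<not> split e S)))"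
    unfolding sum.distrib mult_2 by (rule arg_cong2[where f
        = "(+)", OF refl sum.cong[OF refl half]])
  also have "\<dots> = (\<Sum>e\<in>G. \<Sum>S\<in>Pow {..<n}. 1)"
    unfolding sum.distrib[symmetric] by (intro sum.cong) auto
  finally show ?thesis unfolding 1 by (simp add: card_Pow)
qed

lemma max_cut_ge_half:
  assumes G: "G \<subseteq> edges n"
  shows "card G \<le> 2 * max_cut n G"
proof -
  have "2 ^ n * card G \<le> 2 * (\<Sum>S\<in>Pow {..<n}. max_cut n G)"
    unfolding sum_card_cut_edges[OF G, symmetric]
    by (intro mult_left_mono sum_mono card_cut_le_max_cut) auto
  also have "\<dots> = 2 ^ n * (2 * max_cut n G)" by (simp add: card_Pow)
  finally show ?thesis by simp
qed

lemma MC_bounds: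
  assumes G: "G \<subseteq> edges n"
  shows "0 \<le> MC n G" "MC n G \<le> 1" "G \<noteq> {} \<Longrightarrow> 1 / 2 \<le> MC n G"
proof -
  have fin: "finite G" using finite_subset[OF G] by simp
  obtain S where S: "max_cut n G = card (cut_edges G S)" using max_cut_witness by blast
  have "max_cut n G \<le> card G" unfolding S using fin by (intro card_mono) (auto simp: cut_edges_def)
  then show "0 \<le> MC n G" "MC n G \<le> 1" by (auto simp: MC_def divide_le_eq_1)
  assume ne: "G \<noteq> {}"
  then have "card G > 0" using fin by (simp add: card_gt_0_iff)
  then show "1 / 2 \<le> MC n G" using max_cut_ge_half[OF G] ne by (simp add: MC_def field_simps)
qed

definition mean_MC :: "nat \<Rightarrow> real \<Rightarrow> real" where
  "mean_MC n l = (\<Sum>G\<in>tri_free n. l ^ card G * MC n G) / (\<Sum>G\<in>tri_free n. l ^ card G)"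

lemma mean_MC_le:
  assumes "l > 0" "a \<ge> 0"
  shows "mean_MC n l \<le> a + gibbs n l {G. MC n G \<ge> a}"
proof -
  define Z where "Z = (\<Sum>G\<in>tri_free n. l ^ card G)"
  have Z: "Z > 0" unfolding Z_def using assms by (simp add: partition_pos)
  have "(\<Sum>G\<in>tri_free n. l ^ card G * MC n G)
      \<le> (\<Sum>G\<in>tri_free n. a * l ^ card G + (if MC n G \<ge> a then l ^ card G else 0))"
  proof (rule sum_mono)
    fix G assume G: "G \<in> tri_free n"
    have "MC n G \<le> a + (if MC n G \<ge> a then 1 else 0)"
      using MC_bounds[OF tri_free_edges[OF G]] assms by auto
    then have "l ^ card G * MC n G \<le> l ^ card G * (a + (if MC n G \<ge> a then 1 else 0))"
      using assms by (intro mult_left_mono) auto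
    then show "l ^ card G * MC n G \<le> a * l ^ card G + (if MC n G \<ge> a then l ^ card G else 0)"
      by (auto simp: algebra_simps split: if_splits)
  qed
  also have "\<dots> = a * Z + (\<Sum>G\<in>tri_free n \<inter> {G. MC n G \<ge> a}. l ^ card G)"
    by (simp add: sum.distrib sum_distrib_left Z_def sum.If_cases)
  finally have "(\<Sum>G\<in>tri_free n. l ^ card G * MC n G) / Z
      \<le> (a * Z + (\<Sum>G\<in>tri_free n \<inter> {G. MC n G \<ge> a}. l ^ card G)) / Z"
    using Z by (intro divide_right_mono) auto
  then show ?thesis using Z by (simp add: mean_MC_def gibbs_def Z_def add_divide_distrib)
qed

lemma mean_MC_ge:
  assumes l: "l > 0" and a: "a \<ge> 0" and A: "\<And>G. G \<in> tri_free n \<Longrightarrow> G \<notin> A \<Longrightarrow> MC n G \<ge> a"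
  shows "a * (1 - gibbs n l A) \<le> mean_MC n l"
proof -
  define Z where "Z = (\<Sum>G\<in>tri_free n. l ^ card G)"
  have Z: "Z > 0" unfolding Z_def using l by (simp add: partition_pos)
  have "a * (Z - (\<Sum>G\<in>tri_free n \<inter> A. l ^ card G))
      = (\<Sum>G\<in>tri_free n. a * l ^ card G - (if G \<in> A then a * l ^ card G else 0))"
    by (simp add: sum_subtractf sum_distrib_left right_diff_distrib Z_def sum.If_cases)
  also have "\<dots> \<le> (\<Sum>G\<in>tri_free n. l ^ card G * MC n G)"
  proof (rule sum_mono)
    fix G assume G: "G \<in> tri_free n"
    show "a * l ^ card G - (if G \<in> A then a * l ^ card G else 0) \<le> l ^ card G * MC n G"
      using MC_bounds(1)[OF tri_free_edges[OF G]] A[OF G] l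
      by (cases "G \<in> A") (auto simp: mult.commute)
  qed
  finally have "a * (Z - (\<Sum>G\<in>tri_free n \<inter> A. l ^ card G)) / Z
      \<le> (\<Sum>G\<in>tri_free n. l ^ card G * MC n G) / Z"
    using Z by (intro divide_right_mono) auto
  moreover have "a * (Z - (\<Sum>G\<in>tri_free n \<inter> A. l ^ card G)) / Z = a * (1 - gibbs n l A)"
    using Z by (simp add: gibbs_def Z_def diff_divide_distrib right_diff_distrib)
  ultimately show ?thesis by (simp add: mean_MC_def Z_def)
qed

section \<open>Limits at edge probability \<open>c / sqrt n\<close>\<close>

definition odds :: "real \<Rightarrow> nat \<Rightarrow> real" where
  "odds c n = c / sqrt (real n) / (1 - c / sqrt (real n))"

lemma eventually_odds:
  assumes c: "c > 0" and b: "b > 0"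
  shows "\<forall>\<^sub>F n in sequentially. n \<ge> 2 \<and> c / sqrt (real n) < 1 \<and> odds c n > 0 \<and> c / sqrt (real n)
      \<le> odds c n
    \<and> odds c n \<le> 2 * c / sqrt (real n) \<and> odds c n \<le> b"
proof -
  have "((\<lambda>n. c / sqrt (real n)) \<longlongrightarrow> 0) sequentially" by real_asymp
  then have "\<forall>\<^sub>F n in sequentially. c / sqrt (real n) < min (1 / 2) (b / 2)"
    using b by (intro order_tendstoD) auto
  then show ?thesis using eventually_ge_at_top[of 2]
  proof eventually_elim
    case (elim n)
    define p where "p = c / sqrt (real n)"
    have p: "0 < p" "p < 1 / 2" "p < b / 2" using elim c by (auto simp: p_def)
    have "p \<le> p / (1 - p)" using p by (simp add: field_simps)
    moreover have "p / (1 - p) \<le> 2 * p" using p by (simp add: field_simps)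
    moreover have "2 * c / sqrt (real n) = 2 * p" by (simp add: p_def)
    ultimately show ?case using elim p by (auto simp: odds_def p_def[symmetric])
  qed
qed

lemma g0_eq_liminf_mean_MC:
  assumes "c > 0"
  shows "g0 c = real_of_ereal (liminf (\<lambda>n. ereal (mean_MC n (odds c n))))"
  unfolding g0_def
proof (intro arg_cong[where f = real_of_ereal] Liminf_eq)
  show "\<forall>\<^sub>F n in sequentially. ereal (measure_pmf.expectation
     (cond_pmf (erdos_renyi n (c / sqrt (real n))) {E. num_triangles n E = 0}) (MC n))
         = ereal (mean_MC n (odds c n))"
    using eventually_odds[OF assms zero_less_one]
    by eventually_elim (simp add: mean_MC_def odds_def expectation_tri_free assms)
qed

lemma gibbs_few_edges_tendsto:
  assumes "c > 0"
  shows "(\<lambda>n. exp (1 - odds c n * (real n)\<^sup>2 / 40)) \<longlonglongrightarrow> 0"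
    "(\<lambda>n. exp (1 - odds c n * (real n)\<^sup>2 / 60)) \<longlonglongrightarrow> 0"
proof -
  have *: "(\<lambda>n. exp (1 - odds c n * (real n)\<^sup>2 / k)) \<longlonglongrightarrow> 0" if k: "k > 0" for k
  proof (rule tendsto_sandwich[OF always_eventually _ tendsto_const])
    show "(\<lambda>n. exp (1 - c / sqrt (real n) * (real n)\<^sup>2 / k)) \<longlonglongrightarrow> 0"
      using assms k by real_asymp
    show "\<forall>\<^sub>F n in sequentially. exp (1 - odds c n * (real n)\<^sup>2 / k)
        \<le> exp (1 - c / sqrt (real n) * (real n)\<^sup>2 / k)"
      using eventually_odds[OF assms zero_less_one]
    proof eventually_elim
      case (elim n)
      then have "c / sqrt (real n) * (real n)\<^sup>2 / k \<le> odds c n * (real n)\<^sup>2 / k"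
        using k by (intro divide_right_mono mult_right_mono) auto
      then show ?case unfolding exp_le_cancel_iff by (rule diff_left_mono)
    qed
  qed simp
  show "(\<lambda>n. exp (1 - odds c n * (real n)\<^sup>2 / 40)) \<longlonglongrightarrow> 0"
    "(\<lambda>n. exp (1 - odds c n * (real n)\<^sup>2 / 60)) \<longlonglongrightarrow> 0" by (simp_all add: *)
qed

text \<open>Eventually \<open>odds c n \<le> 2 * c / sqrt n\<close>, so \<open>c \<le> 1/64\<close>
  meets the bound \<open>1 / (32 * sqrt n)\<close> of the contraction. For fixed \<open>eps\<close>
  the exponent has order \<open>- n powr (3/2)\<close> and overcomes \<open>2 ^ n\<close>.\<close>

lemma gibbs_max_cut_tendsto:
  assumes c: "c > 0" "c \<le> 1 / 64" and eps: "0 < eps" "eps \<le> 1"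
  shows "(\<lambda>n. gibbs n (odds c n) {G. MC n G \<ge> 1 / 2 + eps}) \<longlonglongrightarrow> 0"
proof (rule tendsto_sandwich)
  show "(\<lambda>_. 0 :: real) \<longlonglongrightarrow> 0" by (rule tendsto_const)
  show "\<forall>\<^sub>F n in sequentially. 0 \<le> gibbs n (odds c n) {G. MC n G \<ge> 1 / 2 + eps}"
    using eventually_odds[OF c(1) zero_less_one] by eventually_elim (simp add: gibbs_nonneg)
  show "\<forall>\<^sub>F n in sequentially. gibbs n (odds c n) {G. MC n G \<ge> 1 / 2 + eps}
    \<le> exp (1 - odds c n * (real n)\<^sup>2 / 40)
      + (2 ^ n * exp (- (eps / 96) * (eps * (c / sqrt (real n)) * ((real n)\<^sup>2 / 4) / 16 - real n
          / 4))
         + real n * exp (- sqrt n / 2))"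
    using eventually_odds[OF c(1) zero_less_one]
  proof eventually_elim
    case (elim n)
    define N where "N = real (card (edges n))"
    have n: "sqrt (real n) > 0" using elim by simp
    have "2 * c / sqrt (real n) \<le> 1 / (32 * sqrt (real n))"
      using c n by (simp add: field_simps)
    then have le: "gibbs n (odds c n) {G. MC n G \<ge> 1 / 2 + eps}
      \<le> exp (1 - odds c n * (real n)\<^sup>2 / 40)
        + (2 ^ n * exp (- (eps / 96) * (eps * odds c n * N / 16 - real n / 4)) + real n
            * exp (- sqrt n / 2))"
      unfolding N_def using elim eps by (intro gibbs_max_cut_small) auto
    have "real n * (real n / 2) \<le> real n * (real n - 1)" using elim by (intro mult_left_mono) auto
    then have "(real n)\<^sup>2 / 4 \<le> N" unfolding N_def card_edges_real by (simp add: power2_eq_square)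
    then have "eps * (c / sqrt (real n)) * ((real n)\<^sup>2 / 4) \<le> eps * odds c n * N"
      using elim eps c by (intro mult_mono) auto
    then have "eps * (c / sqrt (real n)) * ((real n)\<^sup>2 / 4) / 16 - real n / 4
        \<le> eps * odds c n * N / 16 - real n / 4"
      by (intro diff_right_mono divide_right_mono) auto
    then have "- (eps / 96) * (eps * odds c n * N / 16 - real n / 4)
       \<le> - (eps / 96) * (eps * (c / sqrt (real n)) * ((real n)\<^sup>2 / 4) / 16 - real n / 4)"
      by (rule mult_left_mono_neg) (use eps in simp)
    then show ?case using le
        by (intro order_trans[OF le] add_left_mono add_right_mono mult_left_mono) auto
  qed
  show "(\<lambda>n. exp (1 - odds c n * (real n)\<^sup>2 / 40)
      + (2 ^ n * exp (- (eps / 96) * (eps * (c / sqrt (real n)) * ((real n)\<^sup>2 / 4) / 16 - real n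
          / 4))
         + real n * exp (- sqrt n / 2))) \<longlonglongrightarrow> 0"
  proof (rule tendsto_add_zero[OF gibbs_few_edges_tendsto(1)[OF c(1)]])
    show "(\<lambda>n. 2 ^ n * exp (- (eps / 96) * (eps * (c / sqrt (real n)) * ((real n)\<^sup>2 / 4) / 16
        - real n / 4))
         + real n * exp (- sqrt n / 2)) \<longlonglongrightarrow> 0"
      using c(1) eps(1) by real_asymp
  qed
qed

lemma g0_small:
  assumes c: "c > 0" "c \<le> 1 / 64"
  shows "g0 c = 1 / 2"
proof -
  have "(\<lambda>n. mean_MC n (odds c n)) \<longlonglongrightarrow> 1 / 2"
  proof (rule order_tendstoI)
    fix a :: real assume a: "a < 1 / 2"
    have "(\<lambda>n. 1 / 2 * (1 - exp (1 - odds c n * (real n)\<^sup>2 / 40))) \<longlonglongrightarrow> 1 / 2 * (1 - 0)"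
      by (intro tendsto_intros gibbs_few_edges_tendsto c)
    then have "\<forall>\<^sub>F n in sequentially. a < 1 / 2 * (1 - exp (1 - odds c n * (real n)\<^sup>2 / 40))"
      using a by (intro order_tendstoD) auto
    moreover have "\<forall>\<^sub>F n in sequentially. odds c n > 0 \<and> odds c n \<le> 1 / 10"
      using eventually_odds[OF c(1), of "1 / 10"] by (auto elim: eventually_mono)
    ultimately show "\<forall>\<^sub>F n in sequentially. a < mean_MC n (odds c n)"
    proof eventually_elim
      case (elim n)
      define A where "A = {G::nat set set. real (card G) \<le> odds c n * real (card (edges n)) / 8}"
      have "gibbs n (odds c n) A \<le> exp (1 - odds c n * (real n)\<^sup>2 / 40)"
        unfolding A_def using elim by (intro gibbs_few_edges) auto
      moreover have "1 / 2 \<le> MC n G" if "G \<in> tri_free n" "G \<notin> A" for G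
      proof (rule MC_bounds(3)[OF tri_free_edges[OF that(1)]])
        \<comment> \<open>The empty graph has \<open>MC\<close> equal to \<open>0\<close> by
          convention; it belongs to the exceptional graphs with few edges.\<close>
        have "{} \<in> A" using elim by (simp add: A_def)
        then show "G \<noteq> {}" using that by auto
      qed
      then have "1 / 2 * (1 - gibbs n (odds c n) A) \<le> mean_MC n (odds c n)"
        using elim by (intro mean_MC_ge) auto
      ultimately show ?case using elim by simp
    qed
  next
    fix a :: real assume a: "a > 1 / 2"
    define eps where "eps = min 1 ((a - 1 / 2) / 2)"
    have eps: "0 < eps" "eps \<le> 1" "1 / 2 + eps < a"
      using a by (auto simp: eps_def min_def field_simps)
    have "(\<lambda>n. 1 / 2 + eps + gibbs n (odds c n) {G. MC n G \<ge> 1 / 2 + eps}) \<longlonglongrightarrow> 1 / 2 + eps + 0"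
      using c eps by (intro tendsto_intros gibbs_max_cut_tendsto)
    then have "\<forall>\<^sub>F n in sequentially. 1 / 2 + eps + gibbs n (odds c n) {G. MC n G \<ge> 1 / 2
        + eps} < a"
      using eps by (intro order_tendstoD) auto
    then show "\<forall>\<^sub>F n in sequentially. mean_MC n (odds c n) < a"
      using eventually_odds[OF c(1) zero_less_one]
    proof eventually_elim
      case (elim n)
      then show ?case using mean_MC_le[of "odds c n" "1 / 2 + eps" n] eps by auto
    qed
  qed
  then have "liminf (\<lambda>n. ereal (mean_MC n (odds c n))) = ereal (1 / 2)"
    by (intro lim_imp_Liminf) (auto intro: tendsto_ereal)
  then show ?thesis using g0_eq_liminf_mean_MC[OF c(1)] by simp
qed

text \<open>With \<open>c = 10 ^ 4\<close> the condition \<open>10 ^ 8 \<le> l ^ 2 * n\<close> holds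
  because the odds are at least \<open>c / sqrt n\<close>.\<close>

lemma g0_large: "g0 (10 ^ 4) > 1 / 2"
proof -
  define c where "c = (10 ^ 4 :: real)"
  have c: "c > 0" by (simp add: c_def)
  define r where "r = (\<lambda>n. exp (1 - odds c n * (real n)\<^sup>2 / 40) + 2 * exp (1 - odds c n
      * (real n)\<^sup>2 / 60))"
  have "(\<lambda>n. 11 / 20 * (1 - r n)) \<longlonglongrightarrow> 11 / 20 * (1 - (0 + 2 * 0))"
    unfolding r_def by (intro tendsto_intros gibbs_few_edges_tendsto c)
  then have lim: "liminf (\<lambda>n. ereal (11 / 20 * (1 - r n))) = ereal (11 / 20)"
    by (intro lim_imp_Liminf) (auto intro: tendsto_ereal)
  have "filterlim (\<lambda>n. c / sqrt (real n) * real n) at_top sequentially" using c by real_asymp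
  then have big: "\<forall>\<^sub>F n in sequentially. 10 ^ 6 \<le> c / sqrt (real n) * real n"
    by (simp add: filterlim_at_top)
  have ev: "\<forall>\<^sub>F n in sequentially. 11 / 20 * (1 - r n) \<le> mean_MC n (odds c n)
      \<and> mean_MC n (odds c n) \<le> 2"
    using big eventually_odds[OF c, of "1 / 100", simplified]
  proof eventually_elim
    case (elim n)
    define l where "l = odds c n"
    have l: "l > 0" "l \<le> 1 / 100" "n \<ge> 2" "c / sqrt (real n) \<le> l" using elim by (auto simp: l_def)
    have "10 ^ 6 \<le> l * real n" using elim l by (intro order_trans[OF elim(1) mult_right_mono]) auto
    moreover have "10 ^ 8 \<le> l\<^sup>2 * real n"
    proof -
      have "10 ^ 8 = (c / sqrt (real n))\<^sup>2 * real n" using l by (simp add: c_def power_divide)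
      also have "\<dots> \<le> l\<^sup>2 * real n" using l c by (intro mult_right_mono power_mono) auto
      finally show ?thesis .
    qed
    ultimately have "gibbs n l {G. MC n G \<le> 11 / 20} \<le> r n"
      unfolding r_def l_def[symmetric] using l by (intro gibbs_max_cut_large) auto
    moreover have "11 / 20 * (1 - gibbs n l {G. MC n G \<le> 11 / 20}) \<le> mean_MC n l"
      using l by (intro mean_MC_ge) auto
    moreover have "mean_MC n l \<le> 1 + gibbs n l {G. MC n G \<ge> 1}"
      using l by (intro mean_MC_le) auto
    moreover have "gibbs n l {G. MC n G \<ge> 1} \<le> 1"
    proof -
      have "gibbs n l {G. MC n G \<ge> 1} \<le> gibbs n l UNIV" using l by (intro gibbs_mono) auto
      also have "\<dots> = 1" using partition_pos[OF l(1), of n] by (simp add: gibbs_def)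
      finally show ?thesis .
    qed
    ultimately show ?case by (simp add: l_def)
  qed
  define L where "L = liminf (\<lambda>n. ereal (mean_MC n (odds c n)))"
  have "ereal (11 / 20) \<le> L"
    unfolding L_def lim[symmetric] using ev by (intro Liminf_mono) (auto elim: eventually_mono)
  \<comment> \<open>Finiteness from above matters, since \<open>real_of_ereal\<close> would send an
    infinite lower limit to \<open>0\<close>.\<close>
  moreover have "L \<le> 2"
    unfolding L_def using ev by (intro Liminf_le) (auto elim: eventually_mono)
  ultimately have "11 / 20 \<le> real_of_ereal L" by (cases L) auto
  then show ?thesis using g0_eq_liminf_mean_MC[OF c] by (simp add: L_def c_def)
qed

section \<open>One-sided identity theorem and the non-analytic point\<close>

lemma fps_eq_0_if_eval_0_left:
  fixes F :: "real fps"
  assumes r: "fps_conv_radius F > 0" and F: "eventually (\<lambda>h. eval_fps F h = 0) (at_left 0)"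
  shows "F = 0"
proof (rule ccontr)
  assume "F \<noteq> 0"
  \<comment> \<open>Once the lowest power \<open>fps_X ^ k\<close> is split off, the cofactor is
    nonzero at \<open>0\<close> and by continuity nearby, while \<open>h ^ k\<close> is nonzero for
    \<open>h < 0\<close>.\<close>
  define k where "k = subdegree F"
  define G where "G = fps_shift k F"
  have G0: "fps_nth G 0 \<noteq> 0" using \<open>F \<noteq> 0\<close> by (simp add: G_def k_def)
  have rG: "fps_conv_radius G = fps_conv_radius F" by (simp add: G_def)
  have eq: "F = G * fps_X ^ k" unfolding G_def k_def by (rule subdegree_decompose)
  have "isCont (eval_fps G) 0" using r rG by (intro continuous_eval_fps) (auto simp: zero_ereal_def)
  then have "(eval_fps G \<longlongrightarrow> eval_fps G 0) (at_left 0)"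
    by (simp add: isCont_def filterlim_at_split)
  then have "eventually (\<lambda>h. eval_fps G h \<noteq> 0) (at_left 0)"
    using G0 by (intro tendsto_imp_eventually_ne) (auto simp: eval_fps_at_0)
  moreover have "eventually (\<lambda>h. h < 0) (at_left (0::real))" by (simp add: eventually_at_filter)
  moreover have "eventually (\<lambda>h. h \<in> eball 0 (fps_conv_radius F)) (nhds 0)"
    using r by (intro eventually_nhds_in_open) (auto simp: zero_ereal_def)
  then have "eventually (\<lambda>h. h \<in> eball 0 (fps_conv_radius F)) (at_left 0)"
    by (auto simp: eventually_at_filter elim: eventually_mono)
  ultimately have "eventually (\<lambda>h::real. False) (at_left 0)" using F
  proof eventually_elim
    case (elim h)
    have "eval_fps (G * fps_X ^ k) h = eval_fps G h * eval_fps (fps_X ^ k) h"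
      using elim rG by (intro eval_fps_mult) (auto simp: in_eball_iff)
    then show ?case using elim by (simp add: eq[symmetric])
  qed
  then show False by (simp add: trivial_limit_at_left_real)
qed

theorem corollary1p7:
  shows "\<exists>c > 0. \<not> real_analytic_at g0 c"
proof (rule ccontr)
  assume "\<not> ?thesis"
  then have an: "real_analytic_at g0 c" if "c > 0" for c using that by blast
  define A where "A = {c. c > 0 \<and> (\<forall>x. 0 < x \<and> x \<le> c \<longrightarrow> g0 x = 1 / 2)}"
  have A0: "1 / 64 \<in> A" by (simp add: A_def g0_small)
  have "c \<le> 10 ^ 4" if "c \<in> A" for c
  proof (rule ccontr)
    assume "\<not> c \<le> 10 ^ 4"
    then have "g0 (10 ^ 4) = 1 / 2" using that by (auto simp: A_def)
    then show False using g0_large by simp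
  qed
  then have bdd: "bdd_above A" by (auto simp: bdd_above_def)
  define s where "s = Sup A"
  have s: "s \<ge> 1 / 64" unfolding s_def using A0 bdd by (rule cSup_upper)
  have below: "g0 x = 1 / 2" if "0 < x" "x < s" for x
  proof -
    obtain c where "c \<in> A" "x < c" using \<open>x < s\<close> A0 bdd unfolding s_def
        by (subst (asm) less_cSup_iff) auto
    then show ?thesis using that by (auto simp: A_def)
  qed
  obtain F where F: "(\<lambda>h. g0 (s + h)) has_fps_expansion F"
    using an[of s] s by (auto simp: real_analytic_at_def)
  define H where "H = F - fps_const (1 / 2)"
  have H: "(\<lambda>h. g0 (s + h) - 1 / 2) has_fps_expansion H"
    unfolding H_def by (intro has_fps_expansion_diff F has_fps_expansion_const)
  then have rH: "fps_conv_radius H > 0" and evH: "\<forall>\<^sub>F h in nhds 0. eval_fps H h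
      = g0 (s + h) - 1 / 2"
    by (auto simp: has_fps_expansion_def)
  have "\<forall>\<^sub>F h in at_left 0. eval_fps H h = g0 (s + h) - 1 / 2"
    using evH by (rule filter_leD[rotated]) (simp add: at_within_def)
  moreover have "\<forall>\<^sub>F h in at_left 0. h \<in> {- s<..<0}"
    using s by (intro eventually_at_leftI[of "- s"]) auto
  ultimately have "\<forall>\<^sub>F h in at_left 0. eval_fps H h = 0"
    by eventually_elim (use below in auto)
  \<comment> \<open>Vanishing to the left of \<open>s\<close> kills the whole series, so the
    constant value \<open>1/2\<close> persists to the right of \<open>s\<close>, against the choice
    of \<open>s\<close> as a supremum.\<close>
  then have "H = 0" using rH by (rule fps_eq_0_if_eval_0_left[rotated])
  then have "\<forall>\<^sub>F h in nhds 0. g0 (s + h) = 1 / 2" using evH by (auto elim: eventually_mono)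
  then obtain d where d: "d > 0" "\<And>h. \<bar>h\<bar> < d \<Longrightarrow> g0 (s + h) = 1 / 2"
    by (auto simp: eventually_nhds_metric dist_real_def)
  have "s + d / 2 \<in> A"
    unfolding A_def
  proof (intro CollectI conjI allI impI)
    show "s + d / 2 > 0" using s d by simp
    fix x assume x: "0 < x \<and> x \<le> s + d / 2"
    show "g0 x = 1 / 2"
    proof (cases "x < s")
      case False
      then show ?thesis using d(2)[of "x - s"] x d(1) by simp
    qed (use x below in auto)
  qed
  then have "s + d / 2 \<le> s" unfolding s_def using bdd by (rule cSup_upper)
  then show False using d by simp
qed

end
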